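(* Let $\Bbbk$ be a field, $0\ne v\in\Bbbk$, $n\ge1$, assume $[n]!\ne0$ in $\Bbbk$, and set $\delta=v+v^{-1}$. Let $\lambda$ be a partition of $n$ with at most two parts. Then the linear map $\varphi:L(\lambda)\to C(\lambda)$ defined by $\varphi(\ell)=\eta(\alpha^\ell)$, for link diagrams $\ell$ on $n$ vertices with exactly $\lambda_1-\lambda_2$ defects, is an isomorphism $L(\lambda)\cong C(\lambda)$ of $\mathrm{TL}_n(-\delta)$-modules. We also have $L(\lambda)\cong C(\lambda)$ as $\mathrm{TL}_n(\delta)$-modules.
   Context: Quantum integers: for $k\ge0$, $[k]=\sum_{t=0}^{k-1}v^{k-1-2t}\in\Bbbk$, $[-k]=-[k]$, $[k]!=[1][2]\cdots[k]$, $[0]!=1$. $V$ is the two-dimensional space with basis $y_1,y_{-1}$ and operators $Fy_1=y_{-1}$, $Fy_{-1}=0$, $Ky_{\pm1}=v^{\pm1}y_{\pm1}$. On $V^{\otimes m}$, $F$ acts as $\sum_{j=1}^m1^{\otimes(j-1)}\otimes F\otimes(K^{-1})^{\otimes(m-j)}$; $y_{i_1}\otimes\cdots\otimes y_{i_m}$ ($i_j\in\{\pm1\}$) has weight $\sum_ji_j$. ($V^{\otimes0}=\Bbbk$, of weight $0$, with $F=0$.) For $b\in V^{\otimes(m-1)}$ of weight $i_b$, $\Phi_1(b)=b\otimes y_1$ and $\Phi_2(b)=[i_b]\,b\otimes y_{-1}-v^{i_b}Fb\otimes y_1$. A $1$-factor of length $l$ is a sequence $\alpha=(\alpha_1,\dots,\alpha_l)$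 with $\alpha_i=\pm1$ and all partial sums $\alpha_1+\cdots+\alpha_i\ge0$. If $\alpha_i=1$ and $j$ is the smallest index with $i<j\le l$ and $\alpha_i+\cdots+\alpha_j=0$, then $(i,j)$ is a pairing of $\alpha$; unpaired indices are called defects. The shape of $\alpha$ is the partition $(l-p,p)$, $p$ being the number of entries $-1$. $\mu(\alpha)=\Upsilon_l\cdots\Upsilon_1(1)$, where $\Upsilon_i=\Phi_1$ if $\alpha_i=1$ and $\Upsilon_i=\Phi_2$ if $\alpha_i=-1$. $\eta(\emptyset)=1$; if index $1$ is a defect, $\eta(\alpha)=y_1\otimes\eta(\alpha_2,\dots,\alpha_l)$; if $1$ is paired with $j$, $\eta(\alpha)=\Psi(\eta(\alpha_2,\dots,\alpha_{j-1}))\otimes\eta(\alpha_{j+1},\dots,\alpha_l)$, where $\Psi(b)=y_1\otimes b\otimes y_{-1}-v\,y_{-1}\otimes b\otimes y_1$. $C(\lambda)\subseteq V^{\otimes n}$ is the span of the $\mu(\alpha)$ with $\alpha$ of shape $\lambda$ (equivalently of the $\eta(\alpha)$ with $\alpha$ of shape $\lambda$). For a scalar $\epsilon$, $\mathrm{TL}_n(\epsilon)$ is the unital algebra generated by $e_1,\dots,e_{n-1}$ with relations $e_i^2=\epsilon e_i$, $e_ie_je_i=e_i$ if $|i-j|=1$, $e_ie_j=e_je_i$ if $|i-j|>1$; equivalently the diagram algebra with basis the planar (non-crossing) perfect matchings of two parallel rows of $n$ vertices, with product $D_1D_2=\epsilon^N(D_1\circ D_2)$ ($D_1$ stacked above $D_2$,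 with $N$ interior loops removed), $e_i$ being the diagram linking vertices $i,i+1$ in each row, all other vertices being joined vertically. Let $\dot e_i$ be the operator on $V^{\otimes n}$ acting in tensor positions $i,i+1$ by $y_1\otimes y_1\mapsto0$, $y_{-1}\otimes y_{-1}\mapsto0$, $y_1\otimes y_{-1}\mapsto-v^{-1}y_1\otimes y_{-1}+y_{-1}\otimes y_1$, $y_{-1}\otimes y_1\mapsto y_1\otimes y_{-1}-v\,y_{-1}\otimes y_1$. $C(\lambda)$ is a $\mathrm{TL}_n(-\delta)$-module with $e_i$ acting as $\dot e_i$, and a $\mathrm{TL}_n(\delta)$-module with $e_i$ acting as $-\dot e_i$. A link diagram on $n$ vertices (in a row) consists of pairwise non-crossing arcs (links) drawn below the row, each joining two vertices, such that every vertex lies on at most one link and no unlinked vertex lies beneath a link, i.e. strictly between the endpoints of a link; unlinked vertices, called defects, carry a hanging segment. $\alpha^\ell$ is the $1$-factor with $1$ at left endpoints of links, $-1$ at right endpoints, and $1$ at defects; $\ell\mapsto\alpha^\ell$ is a bijection onto $1$-factors of length $n$, links corresponding to pairings. For a parameter $\epsilon$, let $L_0$ be the vector space with basis the link diagrams on $n$ vertices. A diagram $D$ of $\mathrm{TL}_n(\epsilon)$ acts by $D\ell=\epsilon^N(D\circ\ell)$, where $D$ is stacked above $\ell$, the $N$ closed loops are removed, and $D\circ\ell$ is the resulting link diagram on the top row of $D$ (top vertices not joined to another top vertex are defects; any components not meeting the top row are discarded). $L_0^{\le d}$ (resp. $L_0^{<d}$) is the submodule spanned by link diagrams with at most (resp.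 fewer than) $d$ defects, $L(d)=L_0^{\le d}/L_0^{<d}$, and $L(\lambda)=L(\lambda_1-\lambda_2)$. As a $\mathrm{TL}_n(\epsilon)$-module, $L(\lambda)$ is formed with loop parameter $\epsilon$ (so $\epsilon=-\delta$ in the first assertion and $\epsilon=\delta$ in the second). *)

theory Defs
  imports
    Complex_Main
    "HOL-Library.Poly_Mapping"
    "HOL-Algebra.QuotRing"
    "HOL-Algebra.Module"
begin

section \<open>Free vector spaces, tensor powers and free algebras\<close>

text \<open>
  The vector space with basis a type \<open>'b\<close> is the type of finitely supported functions
  \<open>'b \<Rightarrow>\<^sub>0 'a\<close>, the basis vector of \<open>w\<close> being \<open>single w 1\<close>.
\<close>

definition scale :: "'a::field \<Rightarrow> ('b \<Rightarrow>\<^sub>0 'a) \<Rightarrow> ('b \<Rightarrow>\<^sub>0 'a)" where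
  "scale c = Poly_Mapping.map ((*) c)"

lemma lookup_scale [simp]: "Poly_Mapping.lookup (scale c x) w = c * Poly_Mapping.lookup x w"
  unfolding scale_def by transfer (simp add: when_def)

global_interpretation free: vector_space "scale :: 'a::field \<Rightarrow> ('b \<Rightarrow>\<^sub>0 'a) \<Rightarrow> ('b \<Rightarrow>\<^sub>0 'a)"
  by unfold_locales (auto intro!: poly_mapping_eqI simp: lookup_add algebra_simps)

definition lin :: "('b \<Rightarrow> ('c \<Rightarrow>\<^sub>0 'a::field)) \<Rightarrow> ('b \<Rightarrow>\<^sub>0 'a) \<Rightarrow> ('c \<Rightarrow>\<^sub>0 'a)" where
  "lin f x = (\<Sum>w\<in>Poly_Mapping.keys x. scale (Poly_Mapping.lookup x w) (f w))"

text \<open>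
  With concatenation as the monoid operation on words, the convolution product makes
  \<open>'x list \<Rightarrow>\<^sub>0 'a\<close> the free associative algebra on \<open>'x\<close>, which is also the tensor algebra of
  the vector space with basis \<open>'x\<close>: the \<open>m\<close>-th tensor power is spanned by the words of
  length \<open>m\<close>, and the product of the ring is the tensor product.
\<close>

instantiation list :: (type) monoid_add
begin
definition zero_list :: "'a list" where "zero_list = []"
definition plus_list :: "'a list \<Rightarrow> 'a list \<Rightarrow> 'a list" where "plus_list = (@)"
instance by standard (simp_all add: zero_list_def plus_list_def)
end


section \<open>Quantum integers and the operators on tensor powers of V\<close>

definition qint :: "'a::field \<Rightarrow> int \<Rightarrow> 'a" where
  "qint v k = (if 0 \<le> k then (\<Sum>t<nat k. v powi (k - 1 - 2 * int t))
               else - (\<Sum>t<nat (- k). v powi (- k - 1 - 2 * int t)))"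

definition qfact :: "'a::field \<Rightarrow> nat \<Rightarrow> 'a" where
  "qfact v n = (\<Prod>k=1..n. qint v (int k))"

text \<open>A word over \<open>{1, -1}\<close> stands for the corresponding tensor product of the \<open>y\<close>'s;
  its weight is the sum of its letters.\<close>

definition yw :: "int list \<Rightarrow> (int list \<Rightarrow>\<^sub>0 'a::field)" where
  "yw w = Poly_Mapping.single w 1"

abbreviation y :: "int \<Rightarrow> (int list \<Rightarrow>\<^sub>0 'a::field)" where
  "y i \<equiv> yw [i]"

definition F1 :: "int \<Rightarrow> (int list \<Rightarrow>\<^sub>0 'a::field)" where
  "F1 i = (if i = 1 then y (-1) else 0)"

definition Kinv1 :: "'a::field \<Rightarrow> int \<Rightarrow> (int list \<Rightarrow>\<^sub>0 'a)" where
  "Kinv1 v i = scale (v powi (- i)) (y i)"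

definition F :: "'a::field \<Rightarrow> (int list \<Rightarrow>\<^sub>0 'a) \<Rightarrow> (int list \<Rightarrow>\<^sub>0 'a)" where
  "F v = lin (\<lambda>w. \<Sum>j<length w.
     yw (take j w) * F1 (w ! j) * prod_list (map (Kinv1 v) (drop (Suc j) w)))"

definition Phi1 :: "(int list \<Rightarrow>\<^sub>0 'a::field) \<Rightarrow> (int list \<Rightarrow>\<^sub>0 'a)" where
  "Phi1 b = b * y 1"

text \<open>\<open>\<Phi>\<^sub>2\<close>, given on weight vectors by a formula linear in the vector, is extended linearly.\<close>

definition Phi2 :: "'a::field \<Rightarrow> (int list \<Rightarrow>\<^sub>0 'a) \<Rightarrow> (int list \<Rightarrow>\<^sub>0 'a)" where
  "Phi2 v = lin (\<lambda>w. scale (qint v (sum_list w)) (yw w * y (-1))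
                   - scale (v powi sum_list w) (F v (yw w) * y 1))"

definition Psi :: "'a::field \<Rightarrow> (int list \<Rightarrow>\<^sub>0 'a) \<Rightarrow> (int list \<Rightarrow>\<^sub>0 'a)" where
  "Psi v b = y 1 * b * y (-1) - scale v (y (-1) * b * y 1)"

definition edot2 :: "'a::field \<Rightarrow> int \<Rightarrow> int \<Rightarrow> (int list \<Rightarrow>\<^sub>0 'a)" where
  "edot2 v a b =
     (if a = 1 \<and> b = -1 then - scale (inverse v) (y 1 * y (-1)) + y (-1) * y 1
      else if a = -1 \<and> b = 1 then y 1 * y (-1) - scale v (y (-1) * y 1)
      else 0)"

text \<open>Positions of tensors are counted from 1, entries of lists from 0.\<close>

definition edot :: "'a::field \<Rightarrow> nat \<Rightarrow> (int list \<Rightarrow>\<^sub>0 'a) \<Rightarrow> (int list \<Rightarrow>\<^sub>0 'a)" where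
  "edot v i = lin (\<lambda>w. yw (take (i - 1) w) * edot2 v (w ! (i - 1)) (w ! i) * yw (drop (i + 1) w))"


section \<open>1-factors\<close>

definition one_factor :: "int list \<Rightarrow> bool" where
  "one_factor \<alpha> \<longleftrightarrow> set \<alpha> \<subseteq> {1, -1} \<and> (\<forall>i\<le>length \<alpha>. 0 \<le> sum_list (take i \<alpha>))"

definition shape :: "int list \<Rightarrow> nat \<times> nat" where
  "shape \<alpha> = (length \<alpha> - count_list \<alpha> (-1), count_list \<alpha> (-1))"

text \<open>Indices of 1-factors are counted from 1.\<close>

definition pairing :: "int list \<Rightarrow> nat \<Rightarrow> nat \<Rightarrow> bool" where
  "pairing \<alpha> i j \<longleftrightarrow> 1 \<le> i \<and> i < j \<and> j \<le> length \<alpha> \<and> \<alpha> ! (i - 1) = 1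
     \<and> (\<Sum>k=i..j. \<alpha> ! (k - 1)) = 0
     \<and> (\<forall>j'. i < j' \<and> j' < j \<longrightarrow> (\<Sum>k=i..j'. \<alpha> ! (k - 1)) \<noteq> 0)"

definition mu :: "'a::field \<Rightarrow> int list \<Rightarrow> (int list \<Rightarrow>\<^sub>0 'a)" where
  "mu v \<alpha> = fold (\<lambda>a. if a = 1 then Phi1 else Phi2 v) \<alpha> 1"

text \<open>For \<open>\<alpha> = (a, \<beta>)\<close> with index 1 paired with \<open>j\<close>, the entries of \<open>\<alpha>\<close> at \<open>2, \<dots>, j - 1\<close> are
  \<open>take (j - 2) \<beta>\<close>, and those after \<open>j\<close> are \<open>drop (j - 1) \<beta>\<close>. Values at lists that are not
  1-factors are irrelevant.\<close>

function eta :: "'a::field \<Rightarrow> int list \<Rightarrow> (int list \<Rightarrow>\<^sub>0 'a)" where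
  "eta v [] = 1"
| "eta v (a # \<beta>) =
     (if \<exists>j. pairing (a # \<beta>) 1 j
      then let j = (THE j. pairing (a # \<beta>) 1 j)
           in Psi v (eta v (take (j - 2) \<beta>)) * eta v (drop (j - 1) \<beta>)
      else y 1 * eta v \<beta>)"
  by pat_completeness auto
termination
  by (relation "measure (length \<circ> snd)") auto

definition cell_space :: "'a::field \<Rightarrow> nat \<times> nat \<Rightarrow> (int list \<Rightarrow>\<^sub>0 'a) set" where
  "cell_space v lam = free.span {mu v \<alpha> | \<alpha>. one_factor \<alpha> \<and> shape \<alpha> = lam}"


section \<open>Left modules over a ring that need not be commutative\<close>

locale left_module = R?: ring R + M?: abelian_group M
  for R (structure) and M :: "('r, 'm, 'e) module_scheme" (structure) +
  assumes smult_closed [simp, intro]: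
      "\<lbrakk>a \<in> carrier R; x \<in> carrier M\<rbrakk> \<Longrightarrow> a \<odot>\<^bsub>M\<^esub> x \<in> carrier M"
    and smult_l_distr:
      "\<lbrakk>a \<in> carrier R; b \<in> carrier R; x \<in> carrier M\<rbrakk> \<Longrightarrow>
       (a \<oplus>\<^bsub>R\<^esub> b) \<odot>\<^bsub>M\<^esub> x = a \<odot>\<^bsub>M\<^esub> x \<oplus>\<^bsub>M\<^esub> b \<odot>\<^bsub>M\<^esub> x"
    and smult_r_distr:
      "\<lbrakk>a \<in> carrier R; x \<in> carrier M; z \<in> carrier M\<rbrakk> \<Longrightarrow>
       a \<odot>\<^bsub>M\<^esub> (x \<oplus>\<^bsub>M\<^esub> z) = a \<odot>\<^bsub>M\<^esub> x \<oplus>\<^bsub>M\<^esub> a \<odot>\<^bsub>M\<^esub> z"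
    and smult_assoc1:
      "\<lbrakk>a \<in> carrier R; b \<in> carrier R; x \<in> carrier M\<rbrakk> \<Longrightarrow>
       (a \<otimes>\<^bsub>R\<^esub> b) \<odot>\<^bsub>M\<^esub> x = a \<odot>\<^bsub>M\<^esub> (b \<odot>\<^bsub>M\<^esub> x)"
    and smult_one [simp]:
      "x \<in> carrier M \<Longrightarrow> \<one>\<^bsub>R\<^esub> \<odot>\<^bsub>M\<^esub> x = x"

locale left_module_iso = dom: left_module R M + cod: left_module R N
  for R (structure) and M :: "('r, 'm, 'e) module_scheme" (structure)
    and N :: "('r, 'n, 'f) module_scheme" (structure) and \<phi> :: "'m \<Rightarrow> 'n" +
  assumes bij: "bij_betw \<phi> (carrier M) (carrier N)"
    and additive: "\<lbrakk>x \<in> carrier M; z \<in> carrier M\<rbrakk> \<Longrightarrow> \<phi> (x \<oplus>\<^bsub>M\<^esub> z) = \<phi> x \<oplus>\<^bsub>N\<^esub> \<phi> z"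
    and equivariant: "\<lbrakk>a \<in> carrier R; x \<in> carrier M\<rbrakk> \<Longrightarrow> \<phi> (a \<odot>\<^bsub>M\<^esub> x) = a \<odot>\<^bsub>N\<^esub> \<phi> x"

text \<open>The quotient of a module by (the carrier of) a submodule, following the construction of
  quotient rings by \<^const>\<open>FactRing\<close>. The ring fields \<open>mult\<close> and \<open>one\<close> of the record of a
  module play no role.\<close>

definition quot_module :: "('r, 'm, 'e) module_scheme \<Rightarrow> 'm set \<Rightarrow> ('r, 'm set) module" where
  "quot_module M W =
     \<lparr>carrier = a_rcosets\<^bsub>M\<^esub> W, mult = undefined, one = undefined, zero = W, add = set_add M,
      smult = (\<lambda>a X. \<Union>x\<in>X. W +>\<^bsub>M\<^esub> (a \<odot>\<^bsub>M\<^esub> x))\<rparr>"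


section \<open>The Temperley-Lieb algebra and its modules\<close>

definition tl_gen :: "nat \<Rightarrow> (nat list \<Rightarrow>\<^sub>0 'a::field)" where
  "tl_gen i = Poly_Mapping.single [i] 1"

definition free_alg :: "nat \<Rightarrow> (nat list \<Rightarrow>\<^sub>0 'a::field) ring" where
  "free_alg n = \<lparr>carrier = {p. \<forall>w\<in>Poly_Mapping.keys p. set w \<subseteq> {1..<n}},
     mult = (*), one = 1, zero = 0, add = (+)\<rparr>"

definition tl_relators :: "nat \<Rightarrow> 'a::field \<Rightarrow> (nat list \<Rightarrow>\<^sub>0 'a) set" where
  "tl_relators n \<epsilon> =
     {tl_gen i * tl_gen i - scale \<epsilon> (tl_gen i) | i. i \<in> {1..<n}}
   \<union> {tl_gen i * tl_gen j * tl_gen i - tl_gen i | i j.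
        i \<in> {1..<n} \<and> j \<in> {1..<n} \<and> \<bar>int i - int j\<bar> = 1}
   \<union> {tl_gen i * tl_gen j - tl_gen j * tl_gen i | i j.
        i \<in> {1..<n} \<and> j \<in> {1..<n} \<and> \<bar>int i - int j\<bar> > 1}"

definition TL :: "nat \<Rightarrow> 'a::field \<Rightarrow> (nat list \<Rightarrow>\<^sub>0 'a) set ring" where
  "TL n \<epsilon> = free_alg n Quot (Idl\<^bsub>free_alg n\<^esub> (tl_relators n \<epsilon>))"

text \<open>
  Let linear operators \<open>E i\<close>, for \<open>1 \<le> i < n\<close>, satisfy the relations of \<open>TL n \<epsilon>\<close> on some space.
  The generators then act by the \<open>E i\<close>: a word acts by the composition of the operators of its
  letters, and an element of \<open>TL n \<epsilon>\<close>, which is a coset \<open>A\<close> in the free algebra, acts by the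
  common value at all its representatives. In particular the coset of the scalar \<open>c\<close> acts as
  \<open>scale c\<close>, so that maps compatible with the action are linear over the ground field.
\<close>

definition word_act ::
  "(nat \<Rightarrow> ('b \<Rightarrow>\<^sub>0 'a) \<Rightarrow> ('b \<Rightarrow>\<^sub>0 'a)) \<Rightarrow> (nat list \<Rightarrow>\<^sub>0 'a::field) \<Rightarrow> ('b \<Rightarrow>\<^sub>0 'a) \<Rightarrow> ('b \<Rightarrow>\<^sub>0 'a)" where
  "word_act E p x = (\<Sum>w\<in>Poly_Mapping.keys p. scale (Poly_Mapping.lookup p w) (foldr E w x))"

definition tl_module ::
  "(nat \<Rightarrow> ('b \<Rightarrow>\<^sub>0 'a) \<Rightarrow> ('b \<Rightarrow>\<^sub>0 'a)) \<Rightarrow> ('b \<Rightarrow>\<^sub>0 'a) set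
     \<Rightarrow> ((nat list \<Rightarrow>\<^sub>0 'a::field) set, 'b \<Rightarrow>\<^sub>0 'a) module" where
  "tl_module E X = \<lparr>carrier = X, mult = undefined, one = undefined, zero = 0, add = (+),
     smult = (\<lambda>A x. the_elem ((\<lambda>p. word_act E p x) ` A))\<rparr>"

text \<open>The module structures of \<open>C(\<lambda>)\<close> over the algebra with parameter \<open>-\<delta>\<close>, where \<open>e\<^sub>i\<close> acts as
  \<open>edot v i\<close>, and over the algebra with parameter \<open>\<delta>\<close>, where it acts as the negative.\<close>

definition cell_module ::
  "'a::field \<Rightarrow> nat \<times> nat \<Rightarrow> ((nat list \<Rightarrow>\<^sub>0 'a) set, int list \<Rightarrow>\<^sub>0 'a) module" where
  "cell_module v lam = tl_module (edot v) (cell_space v lam)"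

definition cell_module_neg ::
  "'a::field \<Rightarrow> nat \<times> nat \<Rightarrow> ((nat list \<Rightarrow>\<^sub>0 'a) set, int list \<Rightarrow>\<^sub>0 'a) module" where
  "cell_module_neg v lam = tl_module (\<lambda>i x. - edot v i x) (cell_space v lam)"


section \<open>Link diagrams and link modules\<close>

text \<open>A link diagram is the set of its links, each written as \<open>(i, j)\<close> with \<open>i < j\<close>;
  the vertices are \<open>1, \<dots>, n\<close>.\<close>

definition linked :: "(nat \<times> nat) set \<Rightarrow> nat set" where
  "linked l = fst ` l \<union> snd ` l"

definition link_diagrams :: "nat \<Rightarrow> (nat \<times> nat) set set" where
  "link_diagrams n = {l.
     (\<forall>(i, j)\<in>l. 1 \<le> i \<and> i < j \<and> j \<le> n)
   \<and> (\<forall>a\<in>l. \<forall>b\<in>l. a \<noteq> b \<longrightarrow> {fst a, snd a} \<inter> {fst b, snd b} = {})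
   \<and> (\<forall>(i, j)\<in>l. \<forall>(k, m)\<in>l. \<not> (i < k \<and> k < j \<and> j < m))
   \<and> (\<forall>(i, j)\<in>l. \<forall>k. i < k \<and> k < j \<longrightarrow> k \<in> linked l)}"

definition defects :: "nat \<Rightarrow> (nat \<times> nat) set \<Rightarrow> nat set" where
  "defects n l = {1..n} - linked l"

definition link_seq :: "nat \<Rightarrow> (nat \<times> nat) set \<Rightarrow> int list" where
  "link_seq n l = map (\<lambda>i. if i \<in> snd ` l then -1 else 1) [1..<n + 1]"

text \<open>
  A diagram \<open>D\<close> with two rows of \<open>n\<close> vertices is given by its set of edges \<open>{x, y}\<close>. In the graph
  obtained by stacking \<open>D\<close> above a link diagram \<open>l\<close>, the bottom row of \<open>D\<close> is the row of \<open>l\<close>.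
  As \<open>D\<close> is a perfect matching, the closed loops are the connected components all of whose
  vertices lie in the bottom row and are on a link of \<open>l\<close> (a component in the bottom row with a
  defect of \<open>l\<close> is an open path, which is discarded without contributing a factor).
\<close>

datatype vertex = Top nat | Bot nat

definition vertices :: "nat \<Rightarrow> vertex set" where
  "vertices n = Top ` {1..n} \<union> Bot ` {1..n}"

definition stack_conn :: "nat \<Rightarrow> vertex set set \<Rightarrow> (nat \<times> nat) set \<Rightarrow> (vertex \<times> vertex) set" where
  "stack_conn n D l =
     {(x, z). {x, z} \<in> D \<union> {{Bot i, Bot j} | i j. (i, j) \<in> l}}\<^sup>* \<inter> vertices n \<times> vertices n"

definition stack_loops :: "nat \<Rightarrow> vertex set set \<Rightarrow> (nat \<times> nat) set \<Rightarrow> nat" where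
  "stack_loops n D l = card {K \<in> vertices n // stack_conn n D l. K \<subseteq> Bot ` linked l}"

definition stack_links :: "nat \<Rightarrow> vertex set set \<Rightarrow> (nat \<times> nat) set \<Rightarrow> (nat \<times> nat) set" where
  "stack_links n D l = {(i, j). 1 \<le> i \<and> i < j \<and> j \<le> n \<and> (Top i, Top j) \<in> stack_conn n D l}"

definition diagram_act ::
  "nat \<Rightarrow> 'a::field \<Rightarrow> vertex set set \<Rightarrow> ((nat \<times> nat) set \<Rightarrow>\<^sub>0 'a) \<Rightarrow> ((nat \<times> nat) set \<Rightarrow>\<^sub>0 'a)" where
  "diagram_act n \<epsilon> D =
     lin (\<lambda>l. scale (\<epsilon> ^ stack_loops n D l) (Poly_Mapping.single (stack_links n D l) 1))"

definition e_diagram :: "nat \<Rightarrow> nat \<Rightarrow> vertex set set" where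
  "e_diagram n i = {{Top i, Top (i + 1)}, {Bot i, Bot (i + 1)}}
     \<union> {{Top k, Bot k} | k. k \<in> {1..n} - {i, i + 1}}"

text \<open>\<open>link_span n P\<close> is the subspace of \<open>L\<^sub>0\<close> spanned by the link diagrams whose number of
  defects satisfies \<open>P\<close>.\<close>

definition link_span :: "nat \<Rightarrow> (nat \<Rightarrow> bool) \<Rightarrow> ((nat \<times> nat) set \<Rightarrow>\<^sub>0 'a::field) set" where
  "link_span n P =
     free.span {Poly_Mapping.single l 1 | l. l \<in> link_diagrams n \<and> P (card (defects n l))}"

text \<open>The algebra acts on link diagrams through the diagrams of its generators; these determine
  the action of every other element.\<close>

definition link_module_le ::
  "nat \<Rightarrow> 'a::field \<Rightarrow> nat \<Rightarrow> ((nat list \<Rightarrow>\<^sub>0 'a) set, (nat \<times> nat) set \<Rightarrow>\<^sub>0 'a) module" where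
  "link_module_le n \<epsilon> d =
     tl_module (\<lambda>i. diagram_act n \<epsilon> (e_diagram n i)) (link_span n (\<lambda>k. k \<le> d))"

definition link_module ::
  "nat \<Rightarrow> 'a::field \<Rightarrow> nat \<Rightarrow> ((nat list \<Rightarrow>\<^sub>0 'a) set, ((nat \<times> nat) set \<Rightarrow>\<^sub>0 'a) set) module" where
  "link_module n \<epsilon> d = quot_module (link_module_le n \<epsilon> d) (link_span n (\<lambda>k. k < d))"

definition link_class ::
  "nat \<Rightarrow> 'a::field \<Rightarrow> nat \<Rightarrow> (nat \<times> nat) set \<Rightarrow> ((nat \<times> nat) set \<Rightarrow>\<^sub>0 'a) set" where
  "link_class n \<epsilon> d l =
     link_span n (\<lambda>k. k < d) +>\<^bsub>link_module_le n \<epsilon> d\<^esub> Poly_Mapping.single l 1"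

end

theory Submission
  imports Defs "HOL-Library.List_Lexorder"
begin

text \<open>
  A link diagram is treated as an involution \<open>p\<close> of \<open>{1..n}\<close> whose value \<open>0\<close> marks a defect, and
  the vector \<open>\<eta>\<close> of a link diagram is described by its coefficients. The coefficient at a word \<open>w\<close>
  is a product with one factor per link and per defect: a link \<open>(i, j)\<close> contributes \<open>1\<close> if
  \<open>(w\<^sub>i, w\<^sub>j) = (1, -1)\<close>, \<open>- v\<close> if \<open>(w\<^sub>i, w\<^sub>j) = (-1, 1)\<close> and \<open>0\<close> otherwise, and a defect \<open>i\<close> contributes
  \<open>1\<close> or \<open>0\<close> according to whether \<open>w\<^sub>i = 1\<close>. (Lemma \<open>eta_coeff\<close>.)

  With this formula the theorem becomes local. The operator \<open>edot v i\<close> contracts positions \<open>i\<close>, \<open>i + 1\<close>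
  and inserts the vector of a link there. Contracting two links, or a link and a defect, with
  different partners gives exactly the factor of the link, or of the defect, obtained by joining the
  partners; contracting one link gives \<open>- \<delta>\<close>, and two defects give \<open>0\<close>. These are the rules by which
  the generator \<open>e\<^sub>i\<close> acts on link diagrams modulo diagrams with fewer defects
  (\<open>word_coeff_e_link\<close>). For the parameter \<open>\<delta>\<close>, where \<open>e\<^sub>i\<close> acts by \<open>- edot v i\<close>, a basis vector is
  rescaled by \<open>-1\<close> to the sum of the right endpoints of its links: since the two ends of a link have
  opposite parity, this sign changes whenever the partners of \<open>i\<close> and \<open>i + 1\<close> are joined. Both cases
  are handled together by a parameter \<open>\<sigma> = \<plusminus>1\<close>.

  Injectivity holds because the matrix of coefficients is unitriangular: the largest word, in
  lexicographic order, in the vector of a link diagram is its 1-factor, which determines the diagram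
  (\<open>word_coeff_triangular\<close>, \<open>seq_of_inj\<close>).

  Surjectivity amounts to the equality of the spans of the \<open>\<mu>\<close> and of the \<open>\<eta>\<close> (\<open>cell_space_eq\<close>), and
  this is where the quantum factorial enters. The operator \<open>\<Phi>\<^sub>1\<close> adds a defect at the right end. For a
  link diagram with \<open>d\<close> defects, a telescoping computation shows that \<open>\<Phi>\<^sub>2\<close> gives the sum over
  \<open>k = 1, \<dots>, d\<close> of \<open>[k]\<close> times the vector in which the \<open>k\<close>-th defect is linked to the next one, the
  new vertex being the last. All terms but \<open>k = d\<close> end in a defect, and \<open>[d]\<close> is invertible, so that the
  two families are obtained from each other by induction on the number of vertices.

  Finally the link diagrams satisfy the Temperley-Lieb relations by a computation with involutions,
  and the relations on the space \<open>C(\<lambda>)\<close> follow through the equivariant surjection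
  (\<open>quotient_tl_module_iso\<close>).
\<close>

section \<open>Linear maps between spaces with a basis\<close>

abbreviation flinear :: "(('b \<Rightarrow>\<^sub>0 'a::field) \<Rightarrow> ('c \<Rightarrow>\<^sub>0 'a)) \<Rightarrow> bool" where
  "flinear \<equiv> module_hom scale scale"

abbreviation lookup :: "('b \<Rightarrow>\<^sub>0 'a::zero) \<Rightarrow> 'b \<Rightarrow> 'a" where
  "lookup \<equiv> Poly_Mapping.lookup"

abbreviation keys :: "('b \<Rightarrow>\<^sub>0 'a::zero) \<Rightarrow> 'b set" where
  "keys \<equiv> Poly_Mapping.keys"

abbreviation single :: "'b \<Rightarrow> 'a::zero \<Rightarrow> ('b \<Rightarrow>\<^sub>0 'a)" where
  "single \<equiv> Poly_Mapping.single"

abbreviation unit_vec :: "'b \<Rightarrow> ('b \<Rightarrow>\<^sub>0 'a::field)" where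
  "unit_vec w \<equiv> single w 1"

lemma scale_conv_mult: "scale c (x :: 'b::monoid_add \<Rightarrow>\<^sub>0 'a::field) = single 0 c * x"
  unfolding scale_def by (rule mult_map_scale_conv_mult)

lemma scale_mult_left: "scale c (x :: 'b::monoid_add \<Rightarrow>\<^sub>0 'a::field) * z = scale c (x * z)"
  by (simp add: scale_conv_mult mult.assoc)

lemma scale_mult_right: "(x :: 'b::monoid_add \<Rightarrow>\<^sub>0 'a::field) * scale c z = scale c (x * z)"
proof -
  have "x * single 0 c = scale c x"
  proof (induction x rule: update_induct)
    case (update f a b)
    have "Poly_Mapping.update a b f = f + single a b"
      using update(1) by (intro poly_mapping_eqI)
        (auto simp: lookup_update lookup_add lookup_single when_def in_keys_iff)
    then show ?case using update(3)
      by (simp add: distrib_right free.scale_right_distrib mult_single)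
        (simp add: scale_def mult.commute)
  qed simp
  then show ?thesis by (simp add: scale_conv_mult mult.assoc[symmetric])
qed

lemma scale_single [simp]: "scale c (single w a) = single w (c * a)"
  by (simp add: scale_def)

lemma flinearI:
  assumes "\<And>x z. f (x + z) = f x + f z" and "\<And>c x. f (scale c x) = scale c (f x)"
  shows "flinear f"
  by (rule module_hom.intro[OF free.module_axioms free.module_axioms])
    (unfold_locales, use assms in auto)

lemma sum_unit_vec: "(\<Sum>w\<in>keys x. scale (lookup x w) (unit_vec w)) = x"
  by (rule poly_mapping_eqI)
    (auto simp: lookup_sum lookup_single when_def in_keys_iff if_distrib cong: if_cong)

lemma lin_superset:
  assumes "finite S" "keys x \<subseteq> S"
  shows "lin f x = (\<Sum>w\<in>S. scale (lookup x w) (f w))"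
  unfolding lin_def using assms
  by (intro sum.mono_neutral_left) (auto simp: in_keys_iff)

lemma flinear_lin: "flinear (lin (f :: 'b \<Rightarrow> ('c \<Rightarrow>\<^sub>0 'a::field)))"
proof (rule flinearI)
  fix x z :: "'b \<Rightarrow>\<^sub>0 'a"
  have "keys (x + z) \<subseteq> keys x \<union> keys z"
    by (rule keys_add)
  then show "lin f (x + z) = lin f x + lin f z"
    by (simp add: lin_superset[where S = "keys x \<union> keys z"]
        lookup_add free.scale_left_distrib sum.distrib)
next
  fix c and x :: "'b \<Rightarrow>\<^sub>0 'a"
  have "keys (scale c x) \<subseteq> keys x"
    by (auto simp: in_keys_iff)
  then show "lin f (scale c x) = scale c (lin f x)"
    by (simp add: lin_superset[where S = "keys x"] free.scale_sum_right)
qed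

lemma lin_single [simp]: "lin f (single w a) = scale a (f w)"
  by (cases "a = 0") (simp_all add: lin_def)

lemmas flinear_add = module_hom.add
  and flinear_scale = module_hom.scale
  and flinear_sum = module_hom.sum
  and flinear_diff = module_hom.diff
  and flinear_zero = module_hom.zero
  and flinear_neg = module_hom.neg

lemma flinear_eq_on_keys:
  assumes "flinear f" "flinear g" "\<And>w. w \<in> keys x \<Longrightarrow> f (unit_vec w) = g (unit_vec w)"
  shows "f x = g x"
proof -
  have "f (\<Sum>w\<in>keys x. scale (lookup x w) (unit_vec w))
      = g (\<Sum>w\<in>keys x. scale (lookup x w) (unit_vec w))"
    using assms(3) by (simp add: flinear_sum[OF assms(1)] flinear_sum[OF assms(2)]
        flinear_scale[OF assms(1)] flinear_scale[OF assms(2)] del: scale_single)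
  then show ?thesis by (simp only: sum_unit_vec)
qed

lemma flinear_compose: "flinear f \<Longrightarrow> flinear g \<Longrightarrow> flinear (\<lambda>x. f (g x))"
  by (intro flinearI) (simp_all add: flinear_add flinear_scale)

lemma span_unit_vec:
  "free.span {unit_vec w | w. w \<in> S} = {x :: 'b \<Rightarrow>\<^sub>0 'a::field. keys x \<subseteq> S}" (is "?L = ?R")
proof
  have sub: "free.subspace ?R"
  proof (rule free.subspaceI)
    fix x z :: "'b \<Rightarrow>\<^sub>0 'a" assume "x \<in> ?R" "z \<in> ?R"
    then show "x + z \<in> ?R" using keys_add[of x z] by blast
  qed (auto simp: in_keys_iff)
  show "?L \<subseteq> ?R"
    by (rule free.span_minimal[OF _ sub]) auto
  show "?R \<subseteq> ?L"
  proof
    fix x :: "'b \<Rightarrow>\<^sub>0 'a" assume "x \<in> ?R"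
    then have "(\<Sum>w\<in>keys x. scale (lookup x w) (unit_vec w)) \<in> ?L"
      by (intro free.span_sum free.span_scale free.span_base) auto
    then show "x \<in> ?L" by (simp only: sum_unit_vec)
  qed
qed

lemma flinear_span_subset:
  assumes "flinear f" "\<And>x. x \<in> S \<Longrightarrow> f x \<in> free.span T"
  shows "x \<in> free.span S \<Longrightarrow> f x \<in> free.span T"
proof (induction rule: free.span_induct_alt)
  case base
  then show ?case by (simp add: flinear_zero[OF assms(1)] free.span_zero)
next
  case (step c x z)
  then show ?case
    using assms by (simp add: flinear_add flinear_scale free.span_add free.span_scale)
qed

section \<open>Modules over the Temperley-Lieb algebra\<close>

abbreviation tl_ideal :: "nat \<Rightarrow> 'a::field \<Rightarrow> (nat list \<Rightarrow>\<^sub>0 'a) set" where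
  "tl_ideal n \<epsilon> \<equiv> Idl\<^bsub>free_alg n\<^esub> (tl_relators n \<epsilon>)"

abbreviation tl_class :: "nat \<Rightarrow> 'a::field \<Rightarrow> (nat list \<Rightarrow>\<^sub>0 'a) \<Rightarrow> (nat list \<Rightarrow>\<^sub>0 'a) set" where
  "tl_class n \<epsilon> p \<equiv> tl_ideal n \<epsilon> +>\<^bsub>free_alg n\<^esub> p"

lemma ring_free_alg: "ring (free_alg n :: (nat list \<Rightarrow>\<^sub>0 'a::field) ring)"
proof (rule ringI)
  show "abelian_group (free_alg n :: (nat list \<Rightarrow>\<^sub>0 'a::field) ring)"
  proof (rule abelian_groupI)
    fix x y :: "nat list \<Rightarrow>\<^sub>0 'a"
    assume "x \<in> carrier (free_alg n)" "y \<in> carrier (free_alg n)"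
    then show "x \<oplus>\<^bsub>free_alg n\<^esub> y \<in> carrier (free_alg n)"
      using keys_add[of x y] by (auto simp: free_alg_def)
  next
    fix x :: "nat list \<Rightarrow>\<^sub>0 'a"
    assume "x \<in> carrier (free_alg n)"
    then show "\<exists>y\<in>carrier (free_alg n). y \<oplus>\<^bsub>free_alg n\<^esub> x = \<zero>\<^bsub>free_alg n\<^esub>"
      by (intro bexI[of _ "- x"]) (auto simp: free_alg_def in_keys_iff)
  qed (auto simp: free_alg_def algebra_simps)
  show "Group.monoid (free_alg n :: (nat list \<Rightarrow>\<^sub>0 'a::field) ring)"
  proof (rule monoidI)
    fix x y :: "nat list \<Rightarrow>\<^sub>0 'a"
    assume "x \<in> carrier (free_alg n)" "y \<in> carrier (free_alg n)"
    then show "x \<otimes>\<^bsub>free_alg n\<^esub> y \<in> carrier (free_alg n)"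
      using keys_mult[of x y] by (fastforce simp: free_alg_def plus_list_def)
  qed (auto simp: free_alg_def mult.assoc zero_list_def)
qed (auto simp: free_alg_def algebra_simps)

lemma free_alg_ops:
  "x \<oplus>\<^bsub>free_alg n\<^esub> z = x + z" "x \<otimes>\<^bsub>free_alg n\<^esub> z = x * z"
  "\<one>\<^bsub>free_alg n\<^esub> = 1" "\<zero>\<^bsub>free_alg n\<^esub> = 0"
  by (simp_all add: free_alg_def)

lemma free_alg_closed:
  assumes "p \<in> carrier (free_alg n)" "q \<in> carrier (free_alg n)"
  shows "p + q \<in> carrier (free_alg n)" "p * q \<in> carrier (free_alg n)"
  using ring.ring_simprules(1,5)[OF ring_free_alg] assms by (metis free_alg_ops(1,2))+

lemma free_alg_one_closed: "1 \<in> carrier (free_alg n)"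
  using ring.ring_simprules(6)[OF ring_free_alg] by (metis free_alg_ops(3))

lemma free_alg_uminus:
  assumes "x \<in> carrier (free_alg n)"
  shows "\<ominus>\<^bsub>free_alg n\<^esub> x = - x"
proof -
  interpret ring "free_alg n :: (nat list \<Rightarrow>\<^sub>0 'a::field) ring" by (rule ring_free_alg)
  have "- x \<in> carrier (free_alg n)"
    using assms by (auto simp: free_alg_def in_keys_iff)
  then show ?thesis
    using assms by (intro minus_equality) (auto simp: free_alg_def)
qed

lemma tl_relators_subset: "tl_relators n \<epsilon> \<subseteq> carrier (free_alg n)"
  by (auto simp: tl_relators_def free_alg_def tl_gen_def mult_single plus_list_def
      lookup_minus in_keys_iff lookup_single when_def split: if_splits)

lemma ideal_tl_ideal: "ideal (tl_ideal n \<epsilon>) (free_alg n)"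
  by (rule ring.genideal_ideal[OF ring_free_alg tl_relators_subset])

lemma ring_TL: "ring (TL n \<epsilon>)"
  unfolding TL_def by (rule ideal.quotient_is_ring[OF ideal_tl_ideal])

lemma word_act_lin: "word_act E p x = lin (\<lambda>w. foldr E w x) p"
  by (simp add: word_act_def lin_def)

lemma flinear_foldr:
  assumes "\<And>i. flinear (E i)"
  shows "flinear (foldr E w)"
proof (induction w)
  case Nil
  show ?case by (rule flinearI) simp_all
next
  case (Cons i w)
  then show ?case using flinear_compose[OF assms Cons] by (simp add: comp_def)
qed

lemma flinear_word_act:
  assumes "\<And>i. flinear (E i)"
  shows "flinear (word_act E p)"
  by (rule flinearI)
    (simp_all add: word_act_def flinear_add[OF flinear_foldr[OF assms]]
      flinear_scale[OF flinear_foldr[OF assms]] free.scale_right_distrib sum.distrib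
      free.scale_sum_right mult.commute)

lemma word_act_add: "word_act E (p + q) x = word_act E p x + word_act E q x"
  unfolding word_act_lin by (rule flinear_add[OF flinear_lin])

lemma word_act_diff: "word_act E (p - q) x = word_act E p x - word_act E q x"
  unfolding word_act_lin by (rule flinear_diff[OF flinear_lin])

lemma word_act_uminus: "word_act E (- p) x = - word_act E p x"
  unfolding word_act_lin by (rule flinear_neg[OF flinear_lin])

lemma word_act_scale: "word_act E (scale c p) x = scale c (word_act E p x)"
  unfolding word_act_lin by (rule flinear_scale[OF flinear_lin])

lemma word_act_one: "word_act E 1 x = x"
  unfolding word_act_lin single_one[symmetric] lin_single by (simp add: zero_list_def)

lemma word_act_gen: "word_act E (tl_gen i) x = E i x"
  by (simp add: word_act_lin tl_gen_def)

lemma word_act_mult: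
  assumes "\<And>i. flinear (E i)"
  shows "word_act E (p * q) x = word_act E p (word_act E q x)"
proof (rule flinear_eq_on_keys[of "\<lambda>p. word_act E (p * q) x" "\<lambda>p. word_act E p (word_act E q x)"])
  show "flinear (\<lambda>p. word_act E (p * q) x)"
    by (rule flinearI) (simp_all add: distrib_right word_act_add scale_mult_left word_act_scale)
  show "flinear (\<lambda>p. word_act E p (word_act E q x))"
    by (rule flinearI) (simp_all add: word_act_add word_act_scale)
  fix u
  show "word_act E (unit_vec u * q) x = word_act E (unit_vec u) (word_act E q x)"
  proof (rule flinear_eq_on_keys[of "\<lambda>q. word_act E (unit_vec u * q) x"])
    show "flinear (\<lambda>q. word_act E (unit_vec u * q) x)"
      by (rule flinearI) (simp_all add: distrib_left word_act_add scale_mult_right word_act_scale)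
    show "flinear (\<lambda>q. word_act E (unit_vec u) (word_act E q x))"
      by (rule flinearI) (simp_all add: word_act_add word_act_scale
          flinear_add[OF flinear_word_act[OF assms]] flinear_scale[OF flinear_word_act[OF assms]])
  qed (simp add: word_act_lin mult_single plus_list_def)
qed

text \<open>
  The relations are required on the invariant subspace \<open>X\<close> only. An operator given by a formula on a
  larger space may well violate them outside \<open>X\<close>; for instance, short words have no positions \<open>i\<close> and
  \<open>i + 1\<close> at which \<open>edot v i\<close> could act.
\<close>

locale tl_operators =
  fixes n :: nat and \<epsilon> :: "'a::field"
    and E :: "nat \<Rightarrow> ('b \<Rightarrow>\<^sub>0 'a) \<Rightarrow> ('b \<Rightarrow>\<^sub>0 'a)" and X :: "('b \<Rightarrow>\<^sub>0 'a) set"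
  assumes linear: "\<And>i. flinear (E i)"
    and subspace: "free.subspace X"
    and invariant: "\<And>i x. i \<in> {1..<n} \<Longrightarrow> x \<in> X \<Longrightarrow> E i x \<in> X"
    and square: "\<And>i x. i \<in> {1..<n} \<Longrightarrow> x \<in> X \<Longrightarrow> E i (E i x) = scale \<epsilon> (E i x)"
    and braid: "\<And>i j x. i \<in> {1..<n} \<Longrightarrow> j \<in> {1..<n} \<Longrightarrow> \<bar>int i - int j\<bar> = 1 \<Longrightarrow> x \<in> X \<Longrightarrow>
      E i (E j (E i x)) = E i x"
    and far_commute: "\<And>i j x. i \<in> {1..<n} \<Longrightarrow> j \<in> {1..<n} \<Longrightarrow> \<bar>int i - int j\<bar> > 1 \<Longrightarrow> x \<in> X \<Longrightarrow>
      E i (E j x) = E j (E i x)"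
begin

lemma word_act_closed:
  assumes "p \<in> carrier (free_alg n)" "x \<in> X"
  shows "word_act E p x \<in> X"
proof -
  have *: "set w \<subseteq> {1..<n} \<Longrightarrow> foldr E w x \<in> X" for w
    using assms(2) by (induction w) (auto intro!: invariant)
  show ?thesis
    unfolding word_act_def
    using assms by (intro free.subspace_sum[OF subspace] free.subspace_scale[OF subspace] *)
      (auto simp: free_alg_def)
qed

text \<open>
  The annihilator of \<open>X\<close> in the free algebra is a two-sided ideal containing the relators. Hence all
  representatives of an element of the Temperley-Lieb algebra act in the same way.
\<close>

lemma word_act_tl_ideal:
  assumes "p \<in> tl_ideal n \<epsilon>" "x \<in> X"
  shows "word_act E p x = 0"
proof -
  let ?J = "{p \<in> carrier (free_alg n). \<forall>x\<in>X. word_act E p x = 0}"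
  interpret R: ring "free_alg n :: (nat list \<Rightarrow>\<^sub>0 'a) ring" by (rule ring_free_alg)
  have "ideal ?J (free_alg n)"
  proof (rule idealI[OF ring_free_alg])
    show "subgroup ?J (add_monoid (free_alg n))"
    proof (rule R.add.subgroupI)
      show "?J \<noteq> {}" using R.zero_closed
        by (auto simp: free_alg_def word_act_def intro!: exI[of _ 0])
    next
      fix a assume "a \<in> ?J"
      then show "\<ominus>\<^bsub>free_alg n\<^esub> a \<in> ?J"
        using R.a_inv_closed[of a] by (simp add: free_alg_uminus word_act_uminus)
    next
      fix a b assume "a \<in> ?J" "b \<in> ?J"
      then show "a \<oplus>\<^bsub>free_alg n\<^esub> b \<in> ?J"
        using free_alg_closed(1)[of a n b] by (simp add: free_alg_ops word_act_add)
    qed auto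
  next
    fix a p :: "nat list \<Rightarrow>\<^sub>0 'a" assume "a \<in> ?J" "p \<in> carrier (free_alg n)"
    then show "p \<otimes>\<^bsub>free_alg n\<^esub> a \<in> ?J" "a \<otimes>\<^bsub>free_alg n\<^esub> p \<in> ?J"
      using free_alg_closed(2)[of p n a] free_alg_closed(2)[of a n p] word_act_closed[of p]
      by (auto simp: free_alg_ops word_act_mult[OF linear]
          flinear_zero[OF flinear_word_act[OF linear]])
  qed
  moreover have "tl_relators n \<epsilon> \<subseteq> ?J"
  proof (rule Int_greatest[THEN subset_trans, OF tl_relators_subset])
    show "tl_relators n \<epsilon> \<subseteq> {p. \<forall>x\<in>X. word_act E p x = 0}"
      using square braid far_commute
      by (auto simp: tl_relators_def word_act_diff word_act_mult[OF linear] word_act_gen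
          word_act_scale)
  qed blast
  ultimately show ?thesis
    using R.genideal_minimal assms by blast
qed

lemma smult_coset:
  assumes "p \<in> carrier (free_alg n)" "x \<in> X"
  shows "(tl_class n \<epsilon> p) \<odot>\<^bsub>tl_module E X\<^esub> x = word_act E p x"
proof -
  interpret ideal "tl_ideal n \<epsilon>" "free_alg n" by (rule ideal_tl_ideal)
  have "p \<in> tl_class n \<epsilon> p"
    using assms by (intro a_rcos_self)
  moreover have "word_act E q x = word_act E p x" if "q \<in> tl_class n \<epsilon> p" for q
    using that word_act_tl_ideal[OF _ assms(2)]
    by (auto simp: a_r_coset_def' free_alg_def word_act_add)
  ultimately have "(\<lambda>q. word_act E q x) ` (tl_class n \<epsilon> p) = {word_act E p x}"
    by blast
  then show ?thesis by (simp add: tl_module_def)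
qed

lemma carrier_TL_E:
  assumes "A \<in> carrier (TL n \<epsilon>)"
  obtains p where "p \<in> carrier (free_alg n)" "A = tl_class n \<epsilon> p"
  using assms by (auto simp: TL_def FactRing_def A_RCOSETS_def')

lemma left_module_tl_module: "left_module (TL n \<epsilon>) (tl_module E X)"
proof -
  interpret I: ideal "tl_ideal n \<epsilon>" "free_alg n" by (rule ideal_tl_ideal)
  have ag: "abelian_group (tl_module E X)"
  proof (rule abelian_groupI)
    fix x assume "x \<in> carrier (tl_module E X)"
    then show "\<exists>z\<in>carrier (tl_module E X). z \<oplus>\<^bsub>tl_module E X\<^esub> x = \<zero>\<^bsub>tl_module E X\<^esub>"
      using free.subspace_neg[OF subspace] by (intro bexI[of _ "- x"]) (auto simp: tl_module_def)
  qed (use subspace in \<open>auto simp: tl_module_def algebra_simps free.subspace_add free.subspace_0\<close>)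
  have cosetE: "\<exists>p. p \<in> carrier (free_alg n) \<and> a = tl_class n \<epsilon> p"
    if "a \<in> carrier (TL n \<epsilon>)" for a
    using carrier_TL_E[OF that] by blast
  have carrier: "carrier (tl_module E X) = X" and plus: "x \<oplus>\<^bsub>tl_module E X\<^esub> z = x + z" for x z
    by (simp_all add: tl_module_def)
  have add: "(tl_class n \<epsilon> p) \<oplus>\<^bsub>TL n \<epsilon>\<^esub> (tl_class n \<epsilon> q)
      = tl_class n \<epsilon> (p + q)"
    and mult: "(tl_class n \<epsilon> p) \<otimes>\<^bsub>TL n \<epsilon>\<^esub> (tl_class n \<epsilon> q)
      = tl_class n \<epsilon> (p * q)"
    if "p \<in> carrier (free_alg n)" "q \<in> carrier (free_alg n)" for p q
    using I.a_rcos_sum[OF that] I.rcoset_mult_add[OF that]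
    by (simp_all only: TL_def FactRing_def free_alg_ops ring.simps monoid.simps)
  have one: "\<one>\<^bsub>TL n \<epsilon>\<^esub> = tl_class n \<epsilon> 1"
    by (simp only: TL_def FactRing_def free_alg_ops monoid.simps)
  show ?thesis
  proof (intro left_module.intro left_module_axioms.intro ring_TL ag, goal_cases)
    case (1 a x)
    then show ?case
      using cosetE[OF 1(1)] by (auto simp: carrier smult_coset word_act_closed)
  next
    case (2 a b x)
    then show ?case
      using cosetE[OF 2(1)] cosetE[OF 2(2)]
      by (auto simp: carrier plus add free_alg_closed smult_coset word_act_add)
  next
    case (3 a x z)
    then show ?case
      using cosetE[OF 3(1)]
      by (auto simp: carrier plus smult_coset free.subspace_add[OF subspace]
          flinear_add[OF flinear_word_act[OF linear]])
  next
    case (4 a b x)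
    then show ?case
      using cosetE[OF 4(1)] cosetE[OF 4(2)]
      by (auto simp: carrier mult free_alg_closed smult_coset word_act_closed word_act_mult[OF linear])
  next
    case (5 x)
    then show ?case
      by (simp add: carrier one smult_coset free_alg_one_closed word_act_one)
  qed
qed

end

text \<open>
  Module axioms are equations, so they pull back along a bijection that respects the operations. In this
  way a quotient is seen to be a module at the same time as it is identified with its image.
\<close>

lemma left_module_iso_pullback:
  fixes R (structure)
  assumes N: "left_module R N"
    and bij: "bij_betw \<phi> (carrier Q) (carrier N)"
    and zero: "\<zero>\<^bsub>Q\<^esub> \<in> carrier Q" "\<phi> \<zero>\<^bsub>Q\<^esub> = \<zero>\<^bsub>N\<^esub>"
    and add: "\<And>x z. x \<in> carrier Q \<Longrightarrow> z \<in> carrier Q \<Longrightarrow> x \<oplus>\<^bsub>Q\<^esub> z \<in> carrier Q"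
      "\<And>x z. x \<in> carrier Q \<Longrightarrow> z \<in> carrier Q \<Longrightarrow> \<phi> (x \<oplus>\<^bsub>Q\<^esub> z) = \<phi> x \<oplus>\<^bsub>N\<^esub> \<phi> z"
    and smult: "\<And>a x. a \<in> carrier R \<Longrightarrow> x \<in> carrier Q \<Longrightarrow> a \<odot>\<^bsub>Q\<^esub> x \<in> carrier Q"
      "\<And>a x. a \<in> carrier R \<Longrightarrow> x \<in> carrier Q \<Longrightarrow> \<phi> (a \<odot>\<^bsub>Q\<^esub> x) = a \<odot>\<^bsub>N\<^esub> \<phi> x"
  shows "left_module_iso R Q N \<phi>"
proof -
  interpret N: left_module R N by (rule N)
  have eqI: "x = z" if "\<phi> x = \<phi> z" "x \<in> carrier Q" "z \<in> carrier Q" for x z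
    using that bij by (meson bij_betw_def inj_onD)
  have cl [simp]: "\<phi> x \<in> carrier N" if "x \<in> carrier Q" for x
    using that bij by (meson bij_betwE)
  note [simp] = zero add smult
  have ag: "abelian_group Q"
  proof (rule abelian_groupI)
    fix x assume x: "x \<in> carrier Q"
    obtain z where z: "z \<in> carrier Q" "\<phi> z = \<ominus>\<^bsub>N\<^esub> \<phi> x"
      using bij x by (metis N.M.a_inv_closed bij_betw_imp_surj_on cl imageE)
    then have "\<phi> (z \<oplus>\<^bsub>Q\<^esub> x) = \<phi> \<zero>\<^bsub>Q\<^esub>"
      using x by (simp add: N.M.l_neg)
    then show "\<exists>z\<in>carrier Q. z \<oplus>\<^bsub>Q\<^esub> x = \<zero>\<^bsub>Q\<^esub>"
      using x z by (blast intro: eqI add(1) zero(1))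
  next
    fix x y z assume "x \<in> carrier Q" "y \<in> carrier Q" "z \<in> carrier Q"
    then show "x \<oplus>\<^bsub>Q\<^esub> y \<oplus>\<^bsub>Q\<^esub> z = x \<oplus>\<^bsub>Q\<^esub> (y \<oplus>\<^bsub>Q\<^esub> z)"
      by (intro eqI) (simp_all add: N.M.a_assoc)
  next
    fix x y assume "x \<in> carrier Q" "y \<in> carrier Q"
    then show "x \<oplus>\<^bsub>Q\<^esub> y = y \<oplus>\<^bsub>Q\<^esub> x"
      by (intro eqI) (simp_all add: N.M.a_comm)
  next
    fix x assume "x \<in> carrier Q"
    then show "\<zero>\<^bsub>Q\<^esub> \<oplus>\<^bsub>Q\<^esub> x = x"
      by (intro eqI) simp_all
  qed auto
  have "left_module R Q"
    by (intro left_module.intro left_module_axioms.intro ag N.R.ring_axioms)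
      (auto intro!: eqI simp: N.smult_l_distr N.smult_r_distr N.smult_assoc1)
  then show ?thesis
    using N bij by (intro left_module_iso.intro left_module_iso_axioms.intro) auto
qed

text \<open>
  The homomorphism theorem for spaces with operators. The relations are assumed only for the source: on
  \<open>X\<close> they follow, since every element of \<open>X\<close> is an image.
\<close>

lemma quotient_tl_module_iso:
  assumes Y: "tl_operators n \<epsilon> E Y"
    and E': "\<And>i. flinear (E' i)"
    and h: "flinear h" and hE: "\<And>i y. i \<in> {1..<n} \<Longrightarrow> y \<in> Y \<Longrightarrow> h (E i y) = E' i (h y)"
    and image: "h ` Y = X" and kernel: "{y \<in> Y. h y = 0} = W"
  defines "M \<equiv> tl_module E Y"
  shows "\<exists>\<phi>. (\<forall>y\<in>Y. \<phi> (W +>\<^bsub>M\<^esub> y) = h y)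
    \<and> left_module_iso (TL n \<epsilon>) (quot_module M W) (tl_module E' X) \<phi>"
proof -
  interpret Y: tl_operators n \<epsilon> E Y by (rule Y)
  interpret X: tl_operators n \<epsilon> E' X
  proof (rule tl_operators.intro)
    show "free.subspace X"
      unfolding image[symmetric] using Y.subspace h
      by (rule module_hom.subspace_image[rotated])
    show "flinear (E' i)" for i by (rule E')
  qed (use Y.invariant Y.square Y.braid Y.far_commute in
      \<open>auto simp: image[symmetric] hE[symmetric] Y.invariant flinear_scale[OF h, symmetric]\<close>)
  interpret I: ideal "tl_ideal n \<epsilon>" "free_alg n" by (rule ideal_tl_ideal)
  have h_word_act: "h (word_act E p y) = word_act E' p (h y)"
    if "p \<in> carrier (free_alg n)" "y \<in> Y" for p y
  proof -
    have "foldr E w y \<in> Y \<and> h (foldr E w y) = foldr E' w (h y)" if "set w \<subseteq> {1..<n}" for w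
      using that \<open>y \<in> Y\<close> by (induction w) (auto intro!: Y.invariant simp: hE)
    then show ?thesis
      using that unfolding word_act_def flinear_sum[OF h] flinear_scale[OF h]
      by (intro sum.cong) (auto simp: free_alg_def)
  qed
  define C where "C y = W +>\<^bsub>M\<^esub> y" for y
  have C: "C y = {w + y | w. w \<in> W}" for y
    by (auto simp: C_def M_def a_r_coset_def' tl_module_def)
  have W_Y: "w \<in> Y" and h_W: "h w = 0" if "w \<in> W" for w
    using that by (auto simp: kernel[symmetric])
  have C_eq: "C y = {z \<in> Y. h z = h y}" if "y \<in> Y" for y
  proof (intro equalityI subsetI)
    fix z assume "z \<in> C y"
    then show "z \<in> {z \<in> Y. h z = h y}"
      using that W_Y h_W by (auto simp: C flinear_add[OF h] free.subspace_add[OF Y.subspace])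
  next
    fix z assume "z \<in> {z \<in> Y. h z = h y}"
    then have "z - y \<in> W"
      using that by (auto simp: kernel[symmetric] flinear_diff[OF h] free.subspace_diff[OF Y.subspace])
    then show "z \<in> C y" unfolding C by (metis (mono_tags, lifting) diff_add_cancel mem_Collect_eq)
  qed
  define Q where "Q = quot_module M W"
  have carrier_Q: "carrier Q = C ` Y"
    by (auto simp: Q_def quot_module_def A_RCOSETS_def' C_def M_def tl_module_def)
  have zero_Y: "0 \<in> Y" by (rule free.subspace_0[OF Y.subspace])
  have C_self: "y \<in> C y" if "y \<in> Y" for y using that by (simp add: C_eq)
  have C_cong: "C z = C y" if "z \<in> C y" "y \<in> Y" for y z
    using that by (auto simp: C_eq)
  have add_Q: "C x \<oplus>\<^bsub>Q\<^esub> C y = C (x + y)" if "x \<in> Y" "y \<in> Y" for x y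
  proof -
    have "C x \<oplus>\<^bsub>Q\<^esub> C y = {a + b | a b. a \<in> C x \<and> b \<in> C y}"
      by (auto simp: Q_def quot_module_def set_add_def' M_def tl_module_def)
    also have "\<dots> = C (x + y)"
    proof (intro equalityI subsetI)
      fix z assume "z \<in> {a + b | a b. a \<in> C x \<and> b \<in> C y}"
      then show "z \<in> C (x + y)"
        using that by (auto simp: C_eq free.subspace_add[OF Y.subspace] flinear_add[OF h])
    next
      fix z assume "z \<in> C (x + y)"
      then obtain w where "w + x \<in> C x" "z = (w + x) + y" by (auto simp: C add.assoc)
      then show "z \<in> {a + b | a b. a \<in> C x \<and> b \<in> C y}"
        using C_self[OF that(2)] by blast
    qed
    finally show ?thesis .
  qed
  have zero_Q: "\<zero>\<^bsub>Q\<^esub> = C 0"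
    by (simp add: Q_def quot_module_def C)
  have smult_Q: "(tl_class n \<epsilon> p) \<odot>\<^bsub>Q\<^esub> C y = C (word_act E p y)"
    if p: "p \<in> carrier (free_alg n)" and y: "y \<in> Y" for p y
  proof -
    have "(tl_class n \<epsilon> p) \<odot>\<^bsub>Q\<^esub> C y
        = (\<Union>x\<in>C y. C ((tl_class n \<epsilon> p) \<odot>\<^bsub>M\<^esub> x))"
      by (simp add: Q_def quot_module_def C_def)
    also have "\<dots> = (\<Union>x\<in>C y. C (word_act E p x))"
      using y by (auto simp: M_def C_eq Y.smult_coset[OF p])
    also have "C (word_act E p x) = C (word_act E p y)" if "x \<in> C y" for x
      using that y by (simp add: C_eq Y.word_act_closed[OF p] h_word_act[OF p])
    then have "(\<Union>x\<in>C y. C (word_act E p x)) = C (word_act E p y)"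
      using C_self[OF y] by blast
    finally show ?thesis .
  qed
  define \<phi> where "\<phi> A = the_elem (h ` A)" for A
  have \<phi>: "\<phi> (C y) = h y" if "y \<in> Y" for y
  proof -
    have "h ` C y = {h y}" using that C_self[OF that] by (auto simp: C_eq)
    then show ?thesis by (simp add: \<phi>_def)
  qed
  have "left_module_iso (TL n \<epsilon>) Q (tl_module E' X) \<phi>"
  proof (rule left_module_iso_pullback[OF X.left_module_tl_module])
    show "bij_betw \<phi> (carrier Q) (carrier (tl_module E' X))"
      unfolding bij_betw_def
    proof
      show "inj_on \<phi> (carrier Q)"
        by (rule inj_onI) (use \<phi> C_eq in \<open>force simp: carrier_Q\<close>)
      show "\<phi> ` carrier Q = carrier (tl_module E' X)"
        by (auto simp: carrier_Q image_image \<phi> image[symmetric] tl_module_def)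
    qed
    show "\<zero>\<^bsub>Q\<^esub> \<in> carrier Q" using zero_Y by (simp add: zero_Q carrier_Q)
    show "\<phi> \<zero>\<^bsub>Q\<^esub> = \<zero>\<^bsub>tl_module E' X\<^esub>"
      using zero_Y by (simp add: zero_Q \<phi> flinear_zero[OF h]) (simp add: tl_module_def)
  next
    fix x z assume "x \<in> carrier Q" "z \<in> carrier Q"
    then obtain a b where "a \<in> Y" "x = C a" "b \<in> Y" "z = C b"
      by (auto simp: carrier_Q)
    moreover from this have "a + b \<in> Y" by (intro free.subspace_add[OF Y.subspace])
    ultimately show "x \<oplus>\<^bsub>Q\<^esub> z \<in> carrier Q" "\<phi> (x \<oplus>\<^bsub>Q\<^esub> z) = \<phi> x \<oplus>\<^bsub>tl_module E' X\<^esub> \<phi> z"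
      by (simp_all add: add_Q \<phi> carrier_Q flinear_add[OF h]) (simp add: tl_module_def)
  next
    fix a x assume a: "a \<in> carrier (TL n \<epsilon>)" and "x \<in> carrier Q"
    then obtain y p where *: "y \<in> Y" "x = C y" "p \<in> carrier (free_alg n)"
      "a = tl_class n \<epsilon> p"
      by (auto simp: carrier_Q elim!: Y.carrier_TL_E)
    moreover from \<open>y \<in> Y\<close> have "h y \<in> X" using image by blast
    ultimately show "a \<odot>\<^bsub>Q\<^esub> x \<in> carrier Q" "\<phi> (a \<odot>\<^bsub>Q\<^esub> x) = a \<odot>\<^bsub>tl_module E' X\<^esub> \<phi> x"
      by (auto simp: smult_Q carrier_Q \<phi> Y.word_act_closed h_word_act X.smult_coset)
  qed
  then show ?thesis using \<phi> unfolding Q_def C_def by blast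
qed

section \<open>Link diagrams as involutions\<close>

text \<open>
  \<open>p x\<close> is the vertex linked to \<open>x\<close>, and \<open>p x = 0\<close> says that \<open>x\<close> is a defect; this value also stands for
  everything outside \<open>{1..n}\<close>. As \<open>x < p z\<close> forces \<open>p z \<noteq> 0\<close>, the last clause says both that links do not
  cross and that no defect lies beneath a link.
\<close>

definition matching :: "nat \<Rightarrow> (nat \<Rightarrow> nat) \<Rightarrow> bool" where
  "matching n p \<longleftrightarrow> p 0 = 0 \<and> (\<forall>x>n. p x = 0) \<and> (\<forall>x. p x \<noteq> 0 \<longrightarrow> p (p x) = x)
     \<and> (\<forall>x. p x = x \<longrightarrow> x = 0) \<and> (\<forall>x z. x < z \<and> z < p x \<longrightarrow> x < p z \<and> p z < p x)"

definition links_of :: "(nat \<Rightarrow> nat) \<Rightarrow> (nat \<times> nat) set" where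
  "links_of p = {(x, p x) | x. x < p x}"

text \<open>
  The diagram of the generator \<open>e\<^sub>i\<close> links \<open>i\<close> to \<open>i + 1\<close> and the former partners of \<open>i\<close> and \<open>i + 1\<close> to
  each other. If one of the partners is \<open>0\<close>, the other one becomes a defect by the same assignment; the
  final update discards what was written at \<open>0\<close>. The order of the updates makes the formula correct also
  if \<open>i\<close> and \<open>i + 1\<close> are linked already.
\<close>

definition e_link :: "nat \<Rightarrow> (nat \<Rightarrow> nat) \<Rightarrow> (nat \<Rightarrow> nat)" where
  "e_link i p = p(p i := p (i + 1), p (i + 1) := p i, i := i + 1, i + 1 := i, 0 := 0)"

lemma matchingD:
  assumes "matching n p"
  shows "p 0 = 0" "x > n \<Longrightarrow> p x = 0" "p x \<noteq> 0 \<Longrightarrow> p (p x) = x" "p x = x \<Longrightarrow> x = 0"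
    "x < z \<Longrightarrow> z < p x \<Longrightarrow> x < p z" "x < z \<Longrightarrow> z < p x \<Longrightarrow> p z < p x"
  using assms by (auto simp: matching_def)

lemma matching_le: "matching n p \<Longrightarrow> p x \<le> n"
  by (metis bot_nat_0.extremum matchingD(1,2,3) not_le)

lemma matching_inj: "matching n p \<Longrightarrow> p x = p z \<Longrightarrow> p x \<noteq> 0 \<Longrightarrow> x = z"
  by (metis matchingD(3))

lemma matching_adjacent:
  assumes "matching n p" "1 \<le> i"
  shows "p i \<noteq> i" "p (i + 1) \<noteq> i + 1" "p i = i + 1 \<longleftrightarrow> p (i + 1) = i"
  using matchingD(3)[OF assms(1), of i] matchingD(3)[OF assms(1), of "i + 1"]
    matchingD(4)[OF assms(1), of i] matchingD(4)[OF assms(1), of "i + 1"] assms(2) by auto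

lemma e_link_other:
  assumes "matching n p" "x \<noteq> 0" "x \<noteq> i" "x \<noteq> i + 1" "x \<noteq> p i" "x \<noteq> p (i + 1)"
  shows "e_link i p x = p x"
  using assms by (simp add: e_link_def)

lemma e_link_self:
  assumes "1 \<le> i"
  shows "e_link i p i = i + 1" "e_link i p (i + 1) = i"
  using assms by (simp_all add: e_link_def)

lemma e_link_partner:
  assumes "matching n p" "1 \<le> i" "p i \<noteq> i + 1"
  shows "p i \<noteq> 0 \<Longrightarrow> e_link i p (p i) = p (i + 1)" "p (i + 1) \<noteq> 0 \<Longrightarrow> e_link i p (p (i + 1)) = p i"
proof -
  have "p i \<noteq> i" "p (i + 1) \<noteq> i + 1" "p (i + 1) \<noteq> i"
    using matchingD(4)[OF assms(1), of i] matchingD(4)[OF assms(1), of "i + 1"]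
      matchingD(3)[OF assms(1), of "i + 1"] assms(2,3) by auto
  moreover have "p i = p (i + 1) \<Longrightarrow> p i = 0"
    using matching_inj[OF assms(1), of i "i + 1"] by auto
  ultimately show "p i \<noteq> 0 \<Longrightarrow> e_link i p (p i) = p (i + 1)" "p (i + 1) \<noteq> 0 \<Longrightarrow> e_link i p (p (i + 1)) = p i"
    using assms(2,3) by (auto simp: e_link_def)
qed

lemma e_link_loop:
  assumes "matching n p" "1 \<le> i" "p i = i + 1"
  shows "e_link i p = p"
proof -
  have "p (i + 1) = i" using matchingD(3)[OF assms(1), of i] assms by simp
  then show ?thesis using assms matchingD(1)[OF assms(1)] by (auto simp: e_link_def fun_eq_iff)
qed

lemma e_link_cases:
  assumes "x = 0 \<Longrightarrow> P" "x = i \<Longrightarrow> P" "x = i + 1 \<Longrightarrow> P"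
    "x \<noteq> 0 \<Longrightarrow> x = p i \<Longrightarrow> P" "x \<noteq> 0 \<Longrightarrow> x = p (i + 1) \<Longrightarrow> P"
    "x \<noteq> 0 \<Longrightarrow> x \<noteq> i \<Longrightarrow> x \<noteq> i + 1 \<Longrightarrow> x \<noteq> p i \<Longrightarrow> x \<noteq> p (i + 1) \<Longrightarrow> P"
  shows P
  using assms by blast

lemma matching_e_link:
  assumes p: "matching n p" and i: "1 \<le> i" "i < n"
  shows "matching n (e_link i p)"
proof (cases "p i = i + 1")
  case True
  then show ?thesis using e_link_loop[OF p i(1)] p by simp
next
  case False
  note m = matchingD[OF p]
  define q where "q = e_link i p"
  have q0: "q 0 = 0" and qi: "q i = i + 1" "q (i + 1) = i"
    using i(1) by (simp_all add: q_def e_link_def)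
  have qa: "p i \<noteq> 0 \<Longrightarrow> q (p i) = p (i + 1)" and qb: "p (i + 1) \<noteq> 0 \<Longrightarrow> q (p (i + 1)) = p i"
    using e_link_partner[OF p i(1) False] by (simp_all add: q_def)
  have qo: "q x = p x" if "x \<noteq> 0" "x \<noteq> i" "x \<noteq> i + 1" "x \<noteq> p i" "x \<noteq> p (i + 1)" for x
    using e_link_other[OF p that] by (simp add: q_def)
  have po: "p x \<noteq> i" "p x \<noteq> i + 1" "p x = 0 \<or> p x \<noteq> p i \<and> p x \<noteq> p (i + 1)"
    if "x \<noteq> 0" "x \<noteq> i" "x \<noteq> i + 1" "x \<noteq> p i" "x \<noteq> p (i + 1)" for x
    using that i m(3)[of x] matching_inj[OF p, of x i] matching_inj[OF p, of x "i + 1"] by auto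
  have b: "p (i + 1) \<noteq> i" "p (i + 1) \<noteq> i + 1" "p i \<noteq> i"
    using False m(3)[of "i + 1"] m(4)[of i] m(4)[of "i + 1"] i(1) by auto
  have ab: "p i \<noteq> p (i + 1) \<or> p i = 0"
    using matching_inj[OF p, of i "i + 1"] by auto
  have pa: "p i \<noteq> 0 \<Longrightarrow> p (p i) = i" and pb: "p (i + 1) \<noteq> 0 \<Longrightarrow> p (p (i + 1)) = i + 1"
    using m(3) by blast+
  have inv: "q (q x) = x" if "q x \<noteq> 0" for x
    by (rule e_link_cases[of x _ i p]) (use that q0 qi qa qb qo po[of x] qo[of "p x"] po[of "p x"] m(3)[of x] in auto)
  have fix_free: "x = 0" if "q x = x" for x
    by (rule e_link_cases[of x _ i p]) (use that q0 qi qa qb qo[of x] m(4)[of x] ab in auto)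
  have bound: "q x = 0" if "x > n" for x
  proof -
    have "p i \<le> n" "p (i + 1) \<le> n" by (rule matching_le[OF p])+
    then show ?thesis using that i qo[of x] m(2)[of x] by auto
  qed
  \<comment> \<open>The new link joins the old partners; neither the vertices next to it nor an old link can
    cross it, since the two old links did not cross.\<close>
  have new: "u < q z \<and> q z < w"
    if uw: "u = p i \<and> w = p (i + 1) \<or> u = p (i + 1) \<and> w = p i" and u: "u \<noteq> 0"
      and z: "u < z" "z < w" for u w z
  proof -
    have pu: "p u = i \<and> p w = i + 1 \<or> p u = i + 1 \<and> p w = i"
    proof -
      have "w \<noteq> 0" using z by simp
      with uw u show ?thesis using pa pb by metis
    qed
    have sides: "(u < i \<and> (i + 1 < w \<or> w < i)) \<or> i + 1 < u"
    proof -
      have "u \<noteq> i" "u \<noteq> i + 1" "w \<noteq> i" "w \<noteq> i + 1" using uw b False by metis+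
      then show ?thesis using z by linarith
    qed
    consider "z = i \<or> z = i + 1" | "z \<noteq> i" "z \<noteq> i + 1" by blast
    then show ?thesis
    proof cases
      case 1
      then show ?thesis using sides qi z by auto
    next
      case 2
      have "q z = p z" using 2 uw z u by (intro qo) auto
      moreover have "u < p z \<and> p z < w"
      proof -
        consider "u < i" "i + 1 < w" | "w < i" | "i + 1 < u" using sides by blast
        then show ?thesis
        proof cases
          case 1
          have "p u = i \<and> p w = i + 1"
          proof (rule ccontr)
            assume "\<not> ?thesis"
            then have "p u = i + 1" "p w = i" "p i = w"
              using pu m(3)[of w] i(1) by auto
            then show False using m(6)[of u i] m(5)[of u i] 1 by auto
          qed
          then have "p i = u" "p (i + 1) = w" using m(3)[of u] m(3)[of w] i(1) by auto
          consider "z < i" | "i + 1 < z" using 2 by linarith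
          then show ?thesis
          proof cases
            case 1
            then show ?thesis using m(5,6)[of u z] \<open>p u = i \<and> _\<close> z \<open>i + 1 < w\<close> by auto
          next
            case 2
            then show ?thesis using m(5,6)[of "i + 1" z] \<open>p (i + 1) = w\<close> z \<open>u < i\<close> by auto
          qed
        next
          case 2
          have "p u = i + 1 \<and> p w = i"
          proof (rule ccontr)
            assume "\<not> ?thesis"
            then have "p u = i" "p w = i + 1" using pu by auto
            then show False using m(6)[of u w] 2 z by auto
          qed
          then show ?thesis
            using m(5,6)[of u z] m(5)[of w "p z"] m(3)[of z] matching_inj[OF p, of z w] z 2 m(3)[of u] u
            by (cases "p z = w"; cases "w < p z") (auto simp: less_Suc_eq)
        next
          case 3
          have "p i = w \<and> p (i + 1) = u"
          proof (rule ccontr)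
            assume "\<not> ?thesis"
            then have "p i = u" "p (i + 1) = w" using uw by auto
            then show False using m(5)[of "i + 1" u] pa 3 z by auto
          qed
          then show ?thesis
            using m(5,6)[of i z] m(6)[of "i + 1" "p z"] m(3)[of z] matching_inj[OF p, of z u] z 3
              m(3)[of i] pb u
            by (cases "p z = u"; cases "p z < u") (auto dest: Suc_lessI)
        qed
      qed
      ultimately show ?thesis by simp
    qed
  qed
  have nc: "x < q z \<and> q z < q x" if "x < z" "z < q x" for x z
  proof (rule e_link_cases[of x _ i p])
    assume x: "x \<noteq> 0" "x \<noteq> i" "x \<noteq> i + 1" "x \<noteq> p i" "x \<noteq> p (i + 1)"
    then have qx: "q x = p x" by (rule qo)
    have i_iff: "x < i \<and> i < p x \<longleftrightarrow> x < i + 1 \<and> i + 1 < p x"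
      using po[OF x] x by auto
    show ?thesis
    proof (rule e_link_cases[of z _ i p])
      assume "z \<noteq> 0" "z = p i"
      moreover from this have "x < i \<and> i < p x" using m(5,6)[of x z] that qx pa by auto
      ultimately show ?thesis using i_iff m(5,6)[of x "i + 1"] qa qx by auto
    next
      assume "z \<noteq> 0" "z = p (i + 1)"
      moreover from this have "x < i \<and> i < p x" using m(5,6)[of x z] that qx pb i_iff by auto
      ultimately show ?thesis using i_iff m(5,6)[of x i] qb qx by auto
    qed (use that qx i_iff qi qo[of z] m(5,6)[of x z] in auto)
  qed (use that q0 qi qa qb new in auto)
  show ?thesis
    unfolding matching_def q_def[symmetric] using q0 inv fix_free bound nc by blast
qed

lemma e_link_square:
  assumes "matching n p" "1 \<le> i" "i < n"
  shows "e_link i (e_link i p) = e_link i p"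
  by (rule e_link_loop[OF matching_e_link[OF assms]]) (use assms in \<open>simp_all add: e_link_self\<close>)

lemma e_link_braid:
  assumes p: "matching n p" and i: "1 \<le> i" "i < n" and j: "1 \<le> j" "j = i + 1 \<or> i = j + 1"
  shows "e_link i (e_link j (e_link i p)) = e_link i p" "e_link i p j \<noteq> j + 1" "e_link j (e_link i p) i \<noteq> i + 1"
proof -
  define q where "q = e_link i p"
  have q: "matching n q" "q i = i + 1" "q (i + 1) = i"
    unfolding q_def by (rule matching_e_link[OF p i], rule e_link_self(1)[OF i(1)], rule e_link_self(2)[OF i(1)])
  note m = matchingD[OF q(1)]
  have "e_link i (e_link j q) = q \<and> q j \<noteq> j + 1 \<and> e_link j q i \<noteq> i + 1"
  proof (cases "j = i + 1")
    case True
    define c where "c = q (i + 2)"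
    have "c \<noteq> i" "c \<noteq> i + 1" "c \<noteq> i + 2" "c \<noteq> 0 \<Longrightarrow> q c = i + 2"
      using q(2,3) m(3)[of "i + 2"] m(4)[of "i + 2"] i by (auto simp: c_def)
    then show ?thesis
      using q(2,3) m(1) i(1) c_def by (auto simp: True e_link_def fun_eq_iff)
  next
    case False
    then have ij: "i = j + 1" using j by simp
    define c where "c = q j"
    have "c \<noteq> i" "c \<noteq> i + 1" "c \<noteq> j" "c \<noteq> 0 \<Longrightarrow> q c = j"
      using q(2,3) m(3)[of j] m(4)[of j] j ij by (auto simp: c_def)
    then show ?thesis
      using q(2,3) m(1) j(1) c_def by (auto simp: ij e_link_def fun_eq_iff)
  qed
  then show "e_link i (e_link j (e_link i p)) = e_link i p" "e_link i p j \<noteq> j + 1" "e_link j (e_link i p) i \<noteq> i + 1"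
    by (simp_all add: q_def)
qed

text \<open>
  The two sides are the explicit values at \<open>x\<close> of the two composites of relinkings at \<open>i, i'\<close> and at
  \<open>j, j'\<close>, where \<open>a, b, c, d\<close> are the partners of \<open>i, i', j, j'\<close> and \<open>e\<close> is the partner of \<open>x\<close>.
\<close>

lemma relink_commute:
  fixes a b c d e i i' j j' x :: nat
  assumes ne: "i \<noteq> i'" "i \<noteq> j" "i \<noteq> j'" "i' \<noteq> j" "i' \<noteq> j'" "j \<noteq> j'"
      "i \<noteq> 0" "i' \<noteq> 0" "j \<noteq> 0" "j' \<noteq> 0" "x \<noteq> 0"
    and inv: "a = j \<longleftrightarrow> c = i" "a = j' \<longleftrightarrow> d = i" "b = j \<longleftrightarrow> c = i'" "b = j' \<longleftrightarrow> d = i'"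
      "a = i' \<longleftrightarrow> b = i" "c = j' \<longleftrightarrow> d = j"
    and self: "a \<noteq> i" "b \<noteq> i'" "c \<noteq> j" "d \<noteq> j'"
    and dist: "a = b \<longrightarrow> a = 0" "a = c \<longrightarrow> a = 0" "a = d \<longrightarrow> a = 0" "b = c \<longrightarrow> b = 0"
      "b = d \<longrightarrow> b = 0" "c = d \<longrightarrow> c = 0"
  shows "(if x = i' then i else if x = i then i'
       else if x = (if b = j then d else if b = j' then c else b)
         then (if a = j then d else if a = j' then c else a)
       else if x = (if a = j then d else if a = j' then c else a)
         then (if b = j then d else if b = j' then c else b)
       else if x = j' then j else if x = j then j' else if x = d then c else if x = c then d else e)
     = (if x = j' then j else if x = j then j'
       else if x = (if d = i then b else if d = i' then a else d)
         then (if c = i then b else if c = i' then a else c)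
       else if x = (if c = i then b else if c = i' then a else c)
         then (if d = i then b else if d = i' then a else d)
       else if x = i' then i else if x = i then i' else if x = b then a else if x = a then b else e)"
proof (cases "x = i \<or> x = i' \<or> x = j \<or> x = j'")
  case True
  then show ?thesis using ne inv self by (smt (verit))
next
  case False
  have "x = a \<longrightarrow> x \<noteq> b \<and> x \<noteq> c \<and> x \<noteq> d" "x = b \<longrightarrow> x \<noteq> c \<and> x \<noteq> d" "x = c \<longrightarrow> x \<noteq> d"
    using dist \<open>x \<noteq> 0\<close> by auto
  then show ?thesis using False ne inv self dist by (smt (verit))
qed

text \<open>
  The last two claims compare the closed loops: a loop is created at the second step exactly if it was
  there before, or if the two pairs \<open>{i, i + 1}\<close> and \<open>{j, j + 1}\<close> are linked to each other, which is a
  symmetric condition. So the powers of the parameter agree as well.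
\<close>

lemma e_link_commute:
  assumes p: "matching n p" and ij: "1 \<le> i"  "i + 1 < j"
  shows "e_link i (e_link j p) = e_link j (e_link i p)"
    "e_link j p i = i + 1 \<longleftrightarrow> p i = i + 1 \<or> p i = j \<and> p (i + 1) = j + 1 \<or> p i = j + 1 \<and> p (i + 1) = j"
    "e_link i p j = j + 1 \<longleftrightarrow> p j = j + 1 \<or> p i = j \<and> p (i + 1) = j + 1 \<or> p i = j + 1 \<and> p (i + 1) = j"
proof -
  note m = matchingD(1,3,4)[OF p] and inj = matching_inj[OF p]
  define a b c d where "a = p i" and "b = p (i + 1)" and "c = p j" and "d = p (j + 1)"
  note defs = a_def[symmetric] b_def[symmetric] c_def[symmetric] d_def[symmetric]
  have ne: "i \<noteq> 0" "i \<noteq> j" "i + 1 \<noteq> j" "i \<noteq> j + 1" "i + 1 \<noteq> j + 1" "j \<noteq> 0"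
    using ij by auto
  have inv: "a = j \<longleftrightarrow> c = i" "a = j + 1 \<longleftrightarrow> d = i" "b = j \<longleftrightarrow> c = i + 1" "b = j + 1 \<longleftrightarrow> d = i + 1"
    "a = i + 1 \<longleftrightarrow> b = i" "c = j + 1 \<longleftrightarrow> d = j"
    using m(2)[of i] m(2)[of "i + 1"] m(2)[of j] m(2)[of "j + 1"] ne
    by (auto simp: a_def b_def c_def d_def)
  have self: "a \<noteq> i" "b \<noteq> i + 1" "c \<noteq> j" "d \<noteq> j + 1"
    using m(3) ne by (auto simp: a_def b_def c_def d_def)
  have dist: "a = b \<longrightarrow> a = 0" "a = c \<longrightarrow> a = 0" "a = d \<longrightarrow> a = 0" "b = c \<longrightarrow> b = 0"
    "b = d \<longrightarrow> b = 0" "c = d \<longrightarrow> c = 0"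
    using inj ne unfolding a_def b_def c_def d_def by (metis Suc_eq_plus1 n_not_Suc_n)+
  have p0: "p 0 = 0" by (rule m)
  have ji: "e_link j p i = (if a = j then d else if a = j + 1 then c else a)"
    "e_link j p (i + 1) = (if b = j then d else if b = j + 1 then c else b)"
    "e_link i p j = (if c = i then b else if c = i + 1 then a else c)"
    "e_link i p (j + 1) = (if d = i then b else if d = i + 1 then a else d)"
    unfolding e_link_def fun_upd_apply defs using ne inv(1-4) by auto
  show "e_link i (e_link j p) = e_link j (e_link i p)"
  proof
    fix x
    define e where "e = p x"
    have L: "e_link i (e_link j p) x =
        (if x = 0 then 0 else if x = i + 1 then i else if x = i then i + 1
         else if x = e_link j p (i + 1) then e_link j p i
         else if x = e_link j p i then e_link j p (i + 1) else e_link j p x)"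
      and R: "e_link j (e_link i p) x =
        (if x = 0 then 0 else if x = j + 1 then j else if x = j then j + 1
         else if x = e_link i p (j + 1) then e_link i p j
         else if x = e_link i p j then e_link i p (j + 1) else e_link i p x)"
      by (simp_all only: e_link_def[of i "e_link j p"] e_link_def[of j "e_link i p"] fun_upd_apply)
    have jx: "e_link j p x = (if x = j + 1 then j else if x = j then j + 1
        else if x = d then c else if x = c then d else e)"
      "e_link i p x = (if x = i + 1 then i else if x = i then i + 1
        else if x = b then a else if x = a then b else e)" if "x \<noteq> 0"
      using that unfolding e_link_def fun_upd_apply defs e_def by auto
    show "e_link i (e_link j p) x = e_link j (e_link i p) x"
    proof (cases "x = 0")
      case True
      show ?thesis
        unfolding True by (simp only: e_link_def[of i "e_link j p"] e_link_def[of j "e_link i p"] fun_upd_same)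
    next
      case False
      show ?thesis
        unfolding L R ji jx[OF False] if_not_P[OF False]
        by (rule relink_commute; (fact ne inv self dist False | simp))
    qed
  qed
  show "e_link j p i = i + 1 \<longleftrightarrow> p i = i + 1 \<or> p i = j \<and> p (i + 1) = j + 1 \<or> p i = j + 1 \<and> p (i + 1) = j"
    unfolding ji defs using inv ne by auto
  show "e_link i p j = j + 1 \<longleftrightarrow> p j = j + 1 \<or> p i = j \<and> p (i + 1) = j + 1 \<or> p i = j + 1 \<and> p (i + 1) = j"
    unfolding ji defs using inv ne by auto
qed

section \<open>From involutions to link diagrams\<close>

lemma matching_neq: "matching n p \<Longrightarrow> p x \<noteq> 0 \<Longrightarrow> x < p x \<or> p x < x"
  by (metis matchingD(1,4) nat_neq_iff)

lemma mem_links_of: "(a, b) \<in> links_of p \<longleftrightarrow> a < p a \<and> b = p a"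
  by (auto simp: links_of_def)

lemma links_of_partner:
  assumes "matching n p" "p x \<noteq> 0"
  shows "(x, p x) \<in> links_of p \<or> (p x, x) \<in> links_of p"
  using matchingD(3)[OF assms] matching_neq[OF assms] by (auto simp: mem_links_of)

lemma links_of_inj:
  assumes "matching n p" "matching n q" "links_of p = links_of q"
  shows "p = q"
proof
  fix x
  have val: "r x = u" if "(x, u) \<in> links_of r \<or> (u, x) \<in> links_of r" "matching n r" for u r
    using that(1) matchingD(3)[OF that(2), of u] by (auto simp: links_of_def)
  show "p x = q x"
    using links_of_partner[of n p] links_of_partner[of n q] val[of _ p] val[of _ q] assms by metis
qed

lemma linked_links_of:
  assumes "matching n p"
  shows "linked (links_of p) = {x. p x \<noteq> 0}"
proof (intro equalityI subsetI)
  fix x assume "x \<in> {x. p x \<noteq> 0}"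
  then have "(x, p x) \<in> links_of p \<or> (p x, x) \<in> links_of p"
    using links_of_partner[OF assms] by simp
  then show "x \<in> linked (links_of p)"
    unfolding linked_def by (metis UnCI fst_conv image_eqI snd_conv)
next
  fix x assume "x \<in> linked (links_of p)"
  then obtain a where "a < p a" "x = a \<or> x = p a"
    by (auto simp: linked_def links_of_def)
  then show "x \<in> {x. p x \<noteq> 0}"
    using matchingD(1)[OF assms] matchingD(3)[OF assms, of a] by (cases "a = 0") auto
qed

lemma defects_links_of:
  assumes "matching n p"
  shows "defects n (links_of p) = {x \<in> {1..n}. p x = 0}"
  by (auto simp: defects_def linked_links_of[OF assms])

lemma link_diagrams_eq: "link_diagrams n = links_of ` {p. matching n p}"
proof (intro equalityI subsetI)
  fix l assume "l \<in> links_of ` {p. matching n p}"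
  then obtain p where p: "matching n p" "l = links_of p" by blast
  note m = matchingD[OF p(1)]
  show "l \<in> link_diagrams n"
    unfolding link_diagrams_def
  proof (intro CollectI conjI)
    show "\<forall>(i, j)\<in>l. 1 \<le> i \<and> i < j \<and> j \<le> n"
      using m(1) matching_le[OF p(1)] by (fastforce simp: p links_of_def intro!: Suc_leI gr0I)
    show "\<forall>a\<in>l. \<forall>b\<in>l. a \<noteq> b \<longrightarrow> {fst a, snd a} \<inter> {fst b, snd b} = {}"
    proof (intro ballI impI)
      fix a b assume "a \<in> l" "b \<in> l" "a \<noteq> b"
      then obtain x z where "a = (x, p x)" "b = (z, p z)" "x < p x" "z < p z" "x \<noteq> z"
        by (auto simp: p links_of_def)
      moreover from this have "p (p x) = x" "p (p z) = z" using m(3) by auto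
      ultimately show "{fst a, snd a} \<inter> {fst b, snd b} = {}" by auto
    qed
    show "\<forall>(i, j)\<in>l. \<forall>(k, m)\<in>l. \<not> (i < k \<and> k < j \<and> j < m)"
      using m(6) by (auto simp: p links_of_def) (meson less_asym)
    show "\<forall>(i, j)\<in>l. \<forall>k. i < k \<and> k < j \<longrightarrow> k \<in> linked l"
      unfolding p(2) linked_links_of[OF p(1)] by (auto simp: links_of_def dest: m(5))
  qed
next
  fix l assume "l \<in> link_diagrams n"
  then have "\<forall>(i, j)\<in>l. 1 \<le> i \<and> i < j \<and> j \<le> n"
    "\<forall>a\<in>l. \<forall>b\<in>l. a \<noteq> b \<longrightarrow> {fst a, snd a} \<inter> {fst b, snd b} = {}"
    "\<forall>(i, j)\<in>l. \<forall>(k, m)\<in>l. \<not> (i < k \<and> k < j \<and> j < m)"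
    "\<forall>(i, j)\<in>l. \<forall>k. i < k \<and> k < j \<longrightarrow> k \<in> linked l"
    by (simp_all add: link_diagrams_def)
  then have range: "\<And>i j. (i, j) \<in> l \<Longrightarrow> 1 \<le> i \<and> i < j \<and> j \<le> n"
    and disj: "\<And>a b. a \<in> l \<Longrightarrow> b \<in> l \<Longrightarrow> a \<noteq> b \<Longrightarrow> {fst a, snd a} \<inter> {fst b, snd b} = {}"
    and nocross: "\<And>i j k m. (i, j) \<in> l \<Longrightarrow> (k, m) \<in> l \<Longrightarrow> \<not> (i < k \<and> k < j \<and> j < m)"
    and beneath: "\<And>i j k. (i, j) \<in> l \<Longrightarrow> i < k \<Longrightarrow> k < j \<Longrightarrow> k \<in> linked l"
    by fast+
  define R where "R x z \<longleftrightarrow> (x, z) \<in> l \<or> (z, x) \<in> l" for x z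
  have R_unique: "z = z'" if R: "R x z" "R x z'" for x z z'
  proof -
    consider "(x, z) \<in> l" "(x, z') \<in> l" | "(x, z) \<in> l" "(z', x) \<in> l"
      | "(z, x) \<in> l" "(x, z') \<in> l" | "(z, x) \<in> l" "(z', x) \<in> l"
      using R by (auto simp: R_def)
    then show ?thesis by cases (auto dest: disj range)
  qed
  define p where "p x = (if \<exists>z. R x z then THE z. R x z else 0)" for x
  have p: "p x = z" if "R x z" for x z
    using that R_unique by (auto simp: p_def)
  have R_pos: "x \<noteq> 0 \<and> z \<noteq> 0 \<and> x \<le> n \<and> z \<le> n \<and> x \<noteq> z" if "R x z" for x z
    using that by (auto simp: R_def dest: range)
  have p_R: "R x (p x)" if "p x \<noteq> 0" for x
    using that p by (metis p_def)
  have R_sym: "R x z \<Longrightarrow> R z x" for x z by (auto simp: R_def)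
  have linked: "x \<in> linked l \<longleftrightarrow> p x \<noteq> 0" for x
  proof -
    have "x \<in> linked l \<longleftrightarrow> (\<exists>z. R x z)" by (force simp: linked_def R_def)
    then show ?thesis using p R_pos p_R by metis
  qed
  have lt: "(x, p x) \<in> l" if "x < p x" for x
    using p_R[of x] that by (auto simp: R_def dest: range)
  have "matching n p"
    unfolding matching_def
  proof (intro conjI allI impI)
    show "p 0 = 0" using p_R R_pos by blast
    show "p x = 0" if "x > n" for x using that p_R R_pos not_le by blast
    show "p (p x) = x" if "p x \<noteq> 0" for x using that p_R R_sym p by blast
    show "x = 0" if "p x = x" for x using that p_R R_pos by metis
  next
    fix x z assume xz: "x < z \<and> z < p x"
    then have "R z (p z)" using beneath[OF lt] linked p_R by auto
    then have r: "(z, p z) \<in> l \<or> (p z, z) \<in> l" by (simp add: R_def)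
    have ne: "p z \<noteq> x" "p z \<noteq> p x"
      using xz p[OF R_sym[OF \<open>R z (p z)\<close>]] p[OF R_sym[OF p_R[of x]]] by auto
    show "x < p z" using r nocross[OF _ lt[of x], of "p z" z] range ne xz by fastforce
    show "p z < p x" using r nocross[OF lt[of x], of z "p z"] range ne xz by fastforce
  qed
  moreover have "l = links_of p"
  proof (intro equalityI subsetI)
    fix a assume "a \<in> l"
    then obtain x z where a: "a = (x, z)" "(x, z) \<in> l" by (cases a) auto
    then have "p x = z" "x < z" using p[of x z] range by (auto simp: R_def)
    then show "a \<in> links_of p" using a by (auto simp: links_of_def)
  qed (use lt in \<open>auto simp: links_of_def\<close>)
  ultimately show "l \<in> links_of ` {p. matching n p}" by blast
qed

lemma link_seq_links_of:
  assumes "matching n p"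
  shows "link_seq n (links_of p) = map (\<lambda>x. if p x \<noteq> 0 \<and> p x < x then -1 else 1) [1..<n + 1]"
proof -
  have "x \<in> snd ` links_of p \<longleftrightarrow> p x \<noteq> 0 \<and> p x < x" for x
  proof
    assume "p x \<noteq> 0 \<and> p x < x"
    then have "p (p x) = x" using matchingD(3)[OF assms] by blast
    then have "(p x, x) \<in> links_of p"
      unfolding links_of_def using \<open>p x \<noteq> 0 \<and> p x < x\<close> by (intro CollectI exI[of _ "p x"]) simp
    then show "x \<in> snd ` links_of p" by (rule rev_image_eqI) simp
  next
    assume "x \<in> snd ` links_of p"
    then obtain a where "a < p a" "x = p a" by (auto simp: links_of_def)
    then show "p x \<noteq> 0 \<and> p x < x"
      using matchingD(1)[OF assms] matchingD(3)[OF assms, of a] by (cases "a = 0") auto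
  qed
  then show ?thesis by (simp add: link_seq_def)
qed

section \<open>Stacking the diagram of a generator above a link diagram\<close>

context
  fixes n i :: nat and p :: "nat \<Rightarrow> nat"
  assumes p: "matching n p" and i: "1 \<le> i" "i < n"
begin

definition stack_edges :: "vertex set set" where
  "stack_edges = e_diagram n i \<union> {{Bot a, Bot b} | a b. (a, b) \<in> links_of p}"

definition stack_path :: "(vertex \<times> vertex) set" where
  "stack_path = {(x, z). {x, z} \<in> stack_edges}\<^sup>*"

text \<open>
  To show that vertices are not connected, they are separated by an invariant. The label of a vertex is
  the set of those top vertices to which the relinked diagram says it should be connected; a closed loop
  and a component that ends in defects of the link diagram without reaching the top get the empty label.
\<close>

definition stack_label :: "vertex \<Rightarrow> nat set" where
  "stack_label x = (let L = (\<lambda>t. {t, e_link i p t} - {0}) in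
     case x of Top t \<Rightarrow> L t
     | Bot t \<Rightarrow> if t = i \<or> t = i + 1 then
           (if p i = i + 1 then {} else if p i \<noteq> 0 then L (p i)
            else if p (i + 1) \<noteq> 0 then L (p (i + 1)) else {})
         else L t)"

lemma stack_path_sym: "(x, z) \<in> stack_path \<Longrightarrow> (z, x) \<in> stack_path"
  unfolding stack_path_def
proof (induction rule: rtrancl_induct)
  case (step z w)
  then have "(w, z) \<in> {(x, z). {x, z} \<in> stack_edges}" by (simp add: insert_commute)
  then show ?case using step.IH by (rule converse_rtrancl_into_rtrancl)
qed simp

lemma label_invariant:
  assumes "(x, z) \<in> stack_path"
  shows "stack_label x = stack_label z"
proof -
  let ?L = "\<lambda>t. {t, e_link i p t} - {0}"
  have bot: "stack_label (Bot t) = ?L t" if "t \<noteq> i" "t \<noteq> i + 1" for t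
    using that by (simp add: stack_label_def)
  have ne: "p i \<noteq> i" "p (i + 1) \<noteq> i + 1" "p i = i + 1 \<longleftrightarrow> p (i + 1) = i"
    by (rule matching_adjacent[OF p i(1)])+
  have at_i: "stack_label (Bot i) = stack_label (Bot (p i))" if "p i \<noteq> 0"
    using that bot[of "p i"] ne by (cases "p i = i + 1") (simp_all add: stack_label_def)
  have at_i1: "stack_label (Bot (i + 1)) = stack_label (Bot (p (i + 1)))" if "p (i + 1) \<noteq> 0"
  proof (cases "p i = i + 1")
    case True
    then show ?thesis using ne by (simp add: stack_label_def)
  next
    case False
    have "stack_label (Bot (i + 1)) = ?L (p (i + 1))"
      using False that e_link_partner[OF p i(1) False] by (auto simp: stack_label_def)
    then show ?thesis using bot[of "p (i + 1)"] ne False by simp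
  qed
  have link: "stack_label (Bot t) = stack_label (Bot (p t))" if "t < p t" for t
  proof -
    have t: "t \<noteq> 0" "p (p t) = t" "p t \<noteq> 0"
      using that matchingD(1)[OF p] matchingD(3)[OF p, of t] by (auto intro: ccontr)
    consider "t = i" | "t = i + 1" | "p t = i" | "p t = i + 1"
      | "t \<noteq> i" "t \<noteq> i + 1" "p t \<noteq> i" "p t \<noteq> i + 1" by blast
    then show ?thesis
    proof cases
      case 5
      then have "t \<noteq> p i" "t \<noteq> p (i + 1)"
        using t matchingD(3)[OF p, of i] matchingD(3)[OF p, of "i + 1"] by auto
      moreover have "p t \<noteq> p i" "p t \<noteq> p (i + 1)"
        using t 5 matching_inj[OF p, of t i] matching_inj[OF p, of t "i + 1"] by auto
      ultimately have "e_link i p t = p t" "e_link i p (p t) = t"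
        using e_link_other[OF p, of t i] e_link_other[OF p, of "p t" i] t 5 by simp_all
      then have "stack_label (Bot t) = {t, p t} - {0}" "stack_label (Bot (p t)) = {p t, t} - {0}"
        using bot[of t] bot[of "p t"] 5 by simp_all
      then show ?thesis by (simp only: insert_commute)
    next
      case 1
      then show ?thesis using at_i t by simp
    next
      case 2
      then show ?thesis using at_i1 t by simp
    next
      case 3
      then show ?thesis using at_i t by simp
    next
      case 4
      then show ?thesis using at_i1 t by simp
    qed
  qed
  have edge: "stack_label x = stack_label z" if e: "{x, z} \<in> stack_edges" for x z
  proof -
    have top: "stack_label (Top i) = stack_label (Top (i + 1))"
      unfolding stack_label_def vertex.case Let_def e_link_self[OF i(1)] by auto
    have bot_i: "stack_label (Bot i) = stack_label (Bot (i + 1))"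
      by (simp add: stack_label_def)
    have vert: "stack_label (Top t) = stack_label (Bot t)" if "t \<noteq> i" "t \<noteq> i + 1" for t
      using that by (simp add: stack_label_def)
    consider "{x, z} = {Top i, Top (i + 1)}" | "{x, z} = {Bot i, Bot (i + 1)}"
      | t where "t \<noteq> i" "t \<noteq> i + 1" "{x, z} = {Top t, Bot t}"
      | t where "t < p t" "{x, z} = {Bot t, Bot (p t)}"
      using e unfolding stack_edges_def e_diagram_def links_of_def by blast
    then show ?thesis
    proof cases
      case 1
      then show ?thesis using top by (auto simp: doubleton_eq_iff)
    next
      case 2
      then show ?thesis using bot_i by (auto simp: doubleton_eq_iff)
    next
      case 3
      then show ?thesis using vert[of t] by (auto simp: doubleton_eq_iff)
    next
      case 4
      then show ?thesis using link[of t] by (auto simp: doubleton_eq_iff)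
    qed
  qed
  show ?thesis using assms unfolding stack_path_def by (induction rule: rtrancl_induct) (auto dest: edge)
qed

lemma stack_path_step: "{x, z} \<in> stack_edges \<Longrightarrow> (x, z) \<in> stack_path"
  unfolding stack_path_def by (rule r_into_rtrancl) simp

lemma stack_path_trans: "(x, z) \<in> stack_path \<Longrightarrow> (z, w) \<in> stack_path \<Longrightarrow> (x, w) \<in> stack_path"
  unfolding stack_path_def by (rule rtrancl_trans)

lemma stack_edgeI:
  "(Top i, Top (i + 1)) \<in> stack_path" "(Bot i, Bot (i + 1)) \<in> stack_path"
  "t \<in> {1..n} \<Longrightarrow> t \<noteq> i \<Longrightarrow> t \<noteq> i + 1 \<Longrightarrow> (Top t, Bot t) \<in> stack_path"
  "p t \<noteq> 0 \<Longrightarrow> (Bot t, Bot (p t)) \<in> stack_path"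
proof -
  show "(Bot t, Bot (p t)) \<in> stack_path" if t: "p t \<noteq> 0"
  proof (cases "t < p t")
    case True
    then show ?thesis by (intro stack_path_step) (auto simp: stack_edges_def links_of_def)
  next
    case False
    then have "(p t, t) \<in> links_of p"
      using t matching_neq[OF p t] matchingD(3)[OF p t] unfolding links_of_def
      by (intro CollectI exI[of _ "p t"]) simp
    then have "{Bot t, Bot (p t)} \<in> stack_edges"
      by (auto simp: stack_edges_def insert_commute)
    then show ?thesis by (intro stack_path_step) simp
  qed
qed (intro stack_path_step; auto simp: stack_edges_def e_diagram_def)+

lemma top_path:
  assumes t: "t \<in> {1..n}" and q: "e_link i p t \<noteq> 0"
  shows "(Top t, Top (e_link i p t)) \<in> stack_path"
proof -
  note trans = stack_path_trans
  have le: "p i \<le> n" "p (i + 1) \<le> n" "p t \<le> n" by (rule matching_le[OF p])+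
  have b: "p (i + 1) \<noteq> i \<or> p i = i + 1" "p (i + 1) \<noteq> i + 1" "p i \<noteq> i"
    using matchingD(3)[OF p, of "i + 1"] matchingD(4)[OF p, of i] matchingD(4)[OF p, of "i + 1"] i(1) by auto
  have via: "(Top (p i), Top (p (i + 1))) \<in> stack_path"
    if "p i \<noteq> i + 1" "p i \<noteq> 0" "p (i + 1) \<noteq> 0"
  proof -
    have "(Top (p i), Bot (p i)) \<in> stack_path" "(Bot (p i), Bot i) \<in> stack_path"
      "(Bot i, Bot (i + 1)) \<in> stack_path" "(Bot (i + 1), Bot (p (i + 1))) \<in> stack_path"
      "(Bot (p (i + 1)), Top (p (i + 1))) \<in> stack_path"
    proof -
      show "(Top (p i), Bot (p i)) \<in> stack_path" using that le b by (intro stack_edgeI(3)) auto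
      show "(Bot (p i), Bot i) \<in> stack_path" using that by (intro stack_path_sym[OF stack_edgeI(4)])
      show "(Bot i, Bot (i + 1)) \<in> stack_path" by (rule stack_edgeI(2))
      show "(Bot (i + 1), Bot (p (i + 1))) \<in> stack_path" using that by (intro stack_edgeI(4))
      show "(Bot (p (i + 1)), Top (p (i + 1))) \<in> stack_path"
        using that le b by (intro stack_path_sym[OF stack_edgeI(3)]) auto
    qed
    then show ?thesis by (meson trans)
  qed
  consider "t = i" | "t = i + 1" | "t \<noteq> 0" "t = p i" | "t \<noteq> 0" "t = p (i + 1)"
    | "t \<noteq> 0" "t \<noteq> i" "t \<noteq> i + 1" "t \<noteq> p i" "t \<noteq> p (i + 1)"
    using t by fastforce
  then show ?thesis
  proof cases
    case 1 then show ?thesis using e_link_self(1)[OF i(1)] stack_edgeI(1) by simp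
  next
    case 2 then show ?thesis
      using e_link_self(2)[OF i(1), of p] stack_path_sym[OF stack_edgeI(1)] by simp
  next
    case 3
    then show ?thesis
      using via q e_link_partner(1)[OF p i(1)] e_link_loop[OF p i(1)] e_link_self(2)[OF i(1), of p]
        stack_path_sym[OF stack_edgeI(1)] by (cases "p i = i + 1") auto
  next
    case 4
    then show ?thesis
      using stack_path_sym[OF via] q e_link_partner(2)[OF p i(1)] e_link_self(1)[OF i(1), of p] matchingD(3)[OF p, of i]
        stack_edgeI(1) i by (cases "p i = i + 1") auto
  next
    case *: 5
    then have "e_link i p t = p t" by (intro e_link_other[OF p])
    moreover from this q * have "p t \<noteq> i" "p t \<noteq> i + 1"
      using matchingD(3)[OF p, of t] by auto
    ultimately have "(Top t, Bot t) \<in> stack_path" "(Bot t, Bot (e_link i p t)) \<in> stack_path"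
      "(Bot (e_link i p t), Top (e_link i p t)) \<in> stack_path"
      using t * q le stack_edgeI(4)[of t] by (auto intro!: stack_edgeI stack_path_sym[OF stack_edgeI(3)])
    then show ?thesis by (meson trans)
  qed
qed

lemma stack_links_e_diagram: "stack_links n (e_diagram n i) (links_of p) = links_of (e_link i p)"
proof -
  have q: "matching n (e_link i p)" by (rule matching_e_link[OF p i])
  have path: "(Top a, Top b) \<in> stack_path \<longleftrightarrow> b = e_link i p a" if "1 \<le> a" "a < b" "b \<le> n" for a b
  proof
    assume "(Top a, Top b) \<in> stack_path"
    from label_invariant[OF this] have "{b, e_link i p b} - {0} = {a, e_link i p a} - {0}"
      by (simp add: stack_label_def)
    moreover have "b \<in> {b, e_link i p b} - {0}" using that by simp
    ultimately have "b \<in> {a, e_link i p a}" by blast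
    then show "b = e_link i p a" using that by simp
  next
    assume "b = e_link i p a"
    then show "(Top a, Top b) \<in> stack_path" using top_path[of a] that by auto
  qed
  have "1 \<le> a \<and> a < b \<and> b \<le> n \<and> (Top a, Top b) \<in> stack_path \<longleftrightarrow> a < b \<and> b = e_link i p a" for a b
  proof
    assume *: "a < b \<and> b = e_link i p a"
    then have "a \<noteq> 0" "b \<le> n" using matchingD(1)[OF q] matching_le[OF q, of a] by (auto intro: ccontr)
    then show "1 \<le> a \<and> a < b \<and> b \<le> n \<and> (Top a, Top b) \<in> stack_path"
      using * path[of a b] by simp
  qed (use path in blast)
  moreover have "stack_links n (e_diagram n i) (links_of p)
      = {(a, b). 1 \<le> a \<and> a < b \<and> b \<le> n \<and> (Top a, Top b) \<in> stack_path}"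
    by (auto simp: stack_links_def stack_conn_def vertices_def stack_path_def stack_edges_def)
  ultimately show ?thesis by (auto simp: links_of_def)
qed

text \<open>
  Every bottom vertex other than \<open>i\<close> and \<open>i + 1\<close> is connected to a top vertex, so only these two can form
  a closed loop.
\<close>

lemma stack_loops_e_diagram:
  "stack_loops n (e_diagram n i) (links_of p) = (if p i = i + 1 then 1 else 0)"
proof -
  let ?r = "stack_conn n (e_diagram n i) (links_of p)"
  have r: "?r = stack_path \<inter> vertices n \<times> vertices n"
    by (simp add: stack_conn_def stack_path_def stack_edges_def)
  have loop: "K = {Bot i, Bot (i + 1)} \<and> p i = i + 1"
    if K: "K \<in> vertices n // ?r" "K \<subseteq> Bot ` linked (links_of p)" for K
  proof -
    obtain x where x: "x \<in> vertices n" "K = ?r `` {x}" using K(1) by (rule quotientE)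
    have closed: "w \<in> K" if "z \<in> K" "(z, w) \<in> stack_path" "w \<in> vertices n" for z w
      using that x unfolding r by (auto intro: stack_path_trans)
    have refl: "(x, x) \<in> stack_path" by (simp add: stack_path_def)
    then have xK: "x \<in> K" using x by (auto simp: r)
    have sub: "z = Bot i \<or> z = Bot (i + 1)" if z: "z \<in> K" for z
    proof (rule ccontr)
      assume *: "\<not> ?thesis"
      obtain t where t: "z = Bot t" using z K(2) by blast
      have "z \<in> vertices n" using z x by (auto simp: r)
      then have "(z, Top t) \<in> stack_path" "Top t \<in> vertices n"
        using * t stack_path_sym[OF stack_edgeI(3)[of t]] by (auto simp: vertices_def)
      then have "Top t \<in> K" using closed z by blast
      then show False using K(2) by auto
    qed
    have both: "Bot i \<in> K \<and> Bot (i + 1) \<in> K"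
      using sub[OF xK] xK closed[of x] stack_edgeI(2) stack_path_sym[OF stack_edgeI(2)] i
      by (auto simp: vertices_def)
    have "p i \<noteq> 0" using both K(2) by (auto simp: linked_links_of[OF p])
    then have "Bot (p i) \<in> K"
      using closed[of "Bot i", OF _ stack_edgeI(4)[of i]] both matching_le[OF p, of i]
      by (auto simp: vertices_def)
    then have "p i = i + 1" using sub matchingD(4)[OF p, of i] i(1) by auto
    then show ?thesis using sub both by auto
  qed
  show ?thesis
  proof (cases "p i = i + 1")
    case True
    then have pi: "p (i + 1) = i" using matchingD(3)[OF p, of i] by auto
    have "?r `` {Bot i} = {Bot i, Bot (i + 1)}"
    proof (intro equalityI subsetI)
      fix z assume "z \<in> ?r `` {Bot i}"
      then have "stack_label z = {}" "z \<in> vertices n"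
        using label_invariant[of "Bot i" z] True by (auto simp: r stack_label_def)
      then show "z \<in> {Bot i, Bot (i + 1)}"
        by (auto simp: vertices_def stack_label_def Let_def split: if_splits)
    next
      fix z assume "z \<in> {Bot i, Bot (i + 1)}"
      then show "z \<in> ?r `` {Bot i}"
        using stack_edgeI(2) i by (auto simp: r vertices_def) (simp add: stack_path_def)
    qed
    then have "{Bot i, Bot (i + 1)} \<in> vertices n // ?r"
      using i by (auto simp: quotient_def vertices_def)
    moreover have "{Bot i, Bot (i + 1)} \<subseteq> Bot ` linked (links_of p)"
      using True pi i by (auto simp: linked_links_of[OF p])
    ultimately have "{K \<in> vertices n // ?r. K \<subseteq> Bot ` linked (links_of p)} = {{Bot i, Bot (i + 1)}}"
      using loop by blast
    then show ?thesis using True by (simp add: stack_loops_def)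
  next
    case False
    then have "{K \<in> vertices n // ?r. K \<subseteq> Bot ` linked (links_of p)} = {}"
      using loop by blast
    then show ?thesis using False by (simp only: stack_loops_def card.empty if_False)
  qed
qed

end

section \<open>The link module\<close>

definition defect_set :: "nat \<Rightarrow> (nat \<Rightarrow> nat) \<Rightarrow> nat set" where
  "defect_set n p = {x \<in> {1..n}. p x = 0}"

definition num_defects :: "nat \<Rightarrow> (nat \<Rightarrow> nat) \<Rightarrow> nat" where
  "num_defects n p = card (defect_set n p)"

lemma card_defects_links_of: "matching n p \<Longrightarrow> card (defects n (links_of p)) = num_defects n p"
  by (simp add: defects_links_of num_defects_def defect_set_def)

text \<open>
  If exactly one of \<open>i, i + 1\<close> is a defect, it is replaced as a defect by the partner of the other one.
\<close>

lemma num_defects_e_link: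
  assumes p: "matching n p" and i: "1 \<le> i" "i < n"
  shows "\<not> (p i = 0 \<and> p (i + 1) = 0) \<Longrightarrow> num_defects n (e_link i p) = num_defects n p"
    and "p i = 0 \<Longrightarrow> p (i + 1) = 0 \<Longrightarrow> num_defects n (e_link i p) < num_defects n p"
proof -
  let ?D = "{x \<in> {1..n}. p x = 0}" and ?D' = "{x \<in> {1..n}. e_link i p x = 0}"
  note le = matching_le[OF p]
  have ne: "p i \<noteq> i" "p (i + 1) \<noteq> i + 1" "p i = i + 1 \<longleftrightarrow> p (i + 1) = i"
    by (rule matching_adjacent[OF p i(1)])+
  have zero: "e_link i p x = 0 \<longleftrightarrow> x \<noteq> i \<and> x \<noteq> i + 1 \<and>
      (if x = p i then p (i + 1) = 0 else if x = p (i + 1) then p i = 0 else p x = 0)"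
    if "x \<noteq> 0" for x
    using that i unfolding e_link_def fun_upd_apply by auto
  have pp: "p (p i) \<noteq> 0" if "p i \<noteq> 0"
    using matchingD(3)[OF p that] i by simp
  have pp1: "p (p (i + 1)) \<noteq> 0" if "p (i + 1) \<noteq> 0"
    using matchingD(3)[OF p that] i by simp
  show "num_defects n (e_link i p) = num_defects n p" if nz: "\<not> (p i = 0 \<and> p (i + 1) = 0)"
  proof -
    consider "p i \<noteq> 0" "p (i + 1) \<noteq> 0" | "p i = 0" "p (i + 1) \<noteq> 0" | "p i \<noteq> 0" "p (i + 1) = 0"
      using nz by metis
    then show ?thesis
    proof cases
      case 1
      then have "e_link i p x = 0 \<longleftrightarrow> p x = 0" if "x \<noteq> 0" for x
        using zero[OF that] pp pp1 by (metis (full_types))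
      then have "?D' = ?D" by (intro Collect_cong conj_cong refl) simp
      then show ?thesis by (simp add: num_defects_def defect_set_def)
    next
      case 2
      then have iff: "e_link i p x = 0 \<longleftrightarrow> x = p (i + 1) \<or> p x = 0 \<and> x \<noteq> i" if "x \<noteq> 0" for x
        using zero[OF that] pp1 ne that by (metis (full_types))
      have mem: "p (i + 1) \<in> {1..n}" using 2 le[of "i + 1"] by simp
      have "?D' = insert (p (i + 1)) (?D - {i})"
      proof (rule Set.set_eqI)
        fix x
        show "x \<in> ?D' \<longleftrightarrow> x \<in> insert (p (i + 1)) (?D - {i})"
          using iff[of x] mem by (cases "x = 0"; cases "x = p (i + 1)") simp_all
      qed
      then show ?thesis
        using 2 pp1 i card.remove[of ?D i] by (simp add: num_defects_def defect_set_def card_insert_if)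
    next
      case 3
      then have iff: "e_link i p x = 0 \<longleftrightarrow> x = p i \<or> p x = 0 \<and> x \<noteq> i + 1" if "x \<noteq> 0" for x
        using zero[OF that] pp ne that by (metis (full_types))
      have mem: "p i \<in> {1..n}" using 3 le[of i] by simp
      have "?D' = insert (p i) (?D - {i + 1})"
      proof (rule Set.set_eqI)
        fix x
        show "x \<in> ?D' \<longleftrightarrow> x \<in> insert (p i) (?D - {i + 1})"
          using iff[of x] mem by (cases "x = 0"; cases "x = p i") simp_all
      qed
      then show ?thesis
        using 3 pp i card.remove[of ?D "i + 1"] by (simp add: num_defects_def defect_set_def card_insert_if)
    qed
  qed
  show "num_defects n (e_link i p) < num_defects n p" if "p i = 0" "p (i + 1) = 0"
  proof -
    have "?D' \<subseteq> ?D - {i}"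
    proof
      fix x assume "x \<in> ?D'"
      then show "x \<in> ?D - {i}" using zero[of x] that by (auto split: if_splits)
    qed
    then have "card ?D' \<le> card (?D - {i})" by (intro card_mono) auto
    also have "\<dots> < card ?D" using that i by (intro card_Diff1_less) auto
    finally show ?thesis by (simp add: num_defects_def defect_set_def)
  qed
qed

lemma num_defects_e_link_le:
  assumes "matching n p" "1 \<le> i" "i < n"
  shows "num_defects n (e_link i p) \<le> num_defects n p"
  using num_defects_e_link[OF assms] by fastforce

lemma link_span_eq:
  "link_span n P = {x :: (nat \<times> nat) set \<Rightarrow>\<^sub>0 'a::field.
     keys x \<subseteq> links_of ` {p. matching n p \<and> P (num_defects n p)}}"
proof -
  have "{unit_vec l | l. l \<in> link_diagrams n \<and> P (card (defects n l))}
      = {unit_vec l :: (nat \<times> nat) set \<Rightarrow>\<^sub>0 'a | l. l \<in> links_of ` {p. matching n p \<and> P (num_defects n p)}}"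
  proof -
    have "{l \<in> link_diagrams n. P (card (defects n l))} = links_of ` {p. matching n p \<and> P (num_defects n p)}"
      unfolding link_diagrams_eq using card_defects_links_of by (auto intro!: imageI)
    then show ?thesis by blast
  qed
  then show ?thesis unfolding link_span_def by (simp only: span_unit_vec)
qed

lemma link_span_eq_on:
  fixes f g :: "((nat \<times> nat) set \<Rightarrow>\<^sub>0 'a::field) \<Rightarrow> ('c \<Rightarrow>\<^sub>0 'a)"
  assumes "x \<in> link_span n P" "flinear f" "flinear g"
    and "\<And>p. matching n p \<Longrightarrow> P (num_defects n p) \<Longrightarrow>
      f (unit_vec (links_of p)) = g (unit_vec (links_of p))"
  shows "f x = g x"
proof (rule flinear_eq_on_keys[OF assms(2,3)])
  fix w assume "w \<in> keys x"
  then obtain p where "w = links_of p" "matching n p" "P (num_defects n p)"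
    using assms(1) unfolding link_span_eq by blast
  then show "f (unit_vec w) = g (unit_vec w)" using assms(4) by simp
qed

abbreviation e_act :: "nat \<Rightarrow> 'a::field \<Rightarrow> nat \<Rightarrow>
    ((nat \<times> nat) set \<Rightarrow>\<^sub>0 'a) \<Rightarrow> ((nat \<times> nat) set \<Rightarrow>\<^sub>0 'a)" where
  "e_act n \<epsilon> i \<equiv> diagram_act n \<epsilon> (e_diagram n i)"

lemma flinear_e_act: "flinear (e_act n \<epsilon> i)"
  unfolding diagram_act_def by (rule flinear_lin)

lemma e_act_single:
  assumes "matching n p" "1 \<le> i" "i < n"
  shows "e_act n \<epsilon> i (single (links_of p) c)
    = single (links_of (e_link i p)) (c * (if p i = i + 1 then \<epsilon> else 1))"
  by (simp add: diagram_act_def stack_links_e_diagram[OF assms] stack_loops_e_diagram[OF assms])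

text \<open>
  The relations hold on link diagrams with any number of defects, not just modulo those with fewer, as is
  needed for the action on the submodules to be well defined before passing to the quotient.
\<close>

lemma tl_operators_link_span:
  fixes \<epsilon> :: "'a::field"
  shows "tl_operators n \<epsilon> (e_act n \<epsilon>) (link_span n (\<lambda>k. k \<le> d))"
proof (rule tl_operators.intro)
  show "flinear (e_act n \<epsilon> i)" for i by (rule flinear_e_act)
  show "free.subspace (link_span n (\<lambda>k. k \<le> d) :: ((nat \<times> nat) set \<Rightarrow>\<^sub>0 'a) set)"
    unfolding link_span_def by (rule free.subspace_span)
next
  fix i and x :: "(nat \<times> nat) set \<Rightarrow>\<^sub>0 'a"
  assume i: "i \<in> {1..<n}" and x: "x \<in> link_span n (\<lambda>k. k \<le> d)"
  show "e_act n \<epsilon> i x \<in> link_span n (\<lambda>k. k \<le> d)"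
    unfolding link_span_def
  proof (rule flinear_span_subset[OF flinear_e_act _ x[unfolded link_span_def]])
    fix z :: "(nat \<times> nat) set \<Rightarrow>\<^sub>0 'a"
    assume "z \<in> {unit_vec l | l. l \<in> link_diagrams n \<and> card (defects n l) \<le> d}"
    then obtain p where "z = unit_vec (links_of p)" "matching n p" "num_defects n p \<le> d"
      by (auto simp: link_diagrams_eq card_defects_links_of)
    then have "e_act n \<epsilon> i z = single (links_of (e_link i p)) (if p i = i + 1 then \<epsilon> else 1)"
      "matching n (e_link i p)" "num_defects n (e_link i p) \<le> d"
      using i num_defects_e_link_le[of n p i] matching_e_link[of n p i] by (auto simp: e_act_single)
    then have "e_act n \<epsilon> i z \<in> link_span n (\<lambda>k. k \<le> d)"
      unfolding link_span_eq by auto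
    then show "e_act n \<epsilon> i z \<in> free.span {unit_vec l | l. l \<in> link_diagrams n \<and> card (defects n l) \<le> d}"
      unfolding link_span_def .
  qed
  show "e_act n \<epsilon> i (e_act n \<epsilon> i x) = scale \<epsilon> (e_act n \<epsilon> i x)"
    using i by (intro link_span_eq_on[OF x, of "\<lambda>x. e_act n \<epsilon> i (e_act n \<epsilon> i x)" "\<lambda>x. scale \<epsilon> (e_act n \<epsilon> i x)"]
        flinear_compose[OF flinear_e_act flinear_e_act] flinear_compose[OF _ flinear_e_act]
        flinearI)
      (auto simp: e_act_single matching_e_link e_link_square e_link_self[unfolded Suc_eq_plus1[symmetric]]
        free.scale_right_distrib mult.commute)
next
  fix i j and x :: "(nat \<times> nat) set \<Rightarrow>\<^sub>0 'a"
  assume i: "i \<in> {1..<n}" and j: "j \<in> {1..<n}" and x: "x \<in> link_span n (\<lambda>k. k \<le> d)"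
  show "e_act n \<epsilon> i (e_act n \<epsilon> j (e_act n \<epsilon> i x)) = e_act n \<epsilon> i x" if ij: "\<bar>int i - int j\<bar> = 1"
  proof (rule link_span_eq_on[OF x, of "\<lambda>x. e_act n \<epsilon> i (e_act n \<epsilon> j (e_act n \<epsilon> i x))"])
    fix p assume p: "matching n p"
    have "j = i + 1 \<or> i = j + 1" using ij by auto
    then show "e_act n \<epsilon> i (e_act n \<epsilon> j (e_act n \<epsilon> i (unit_vec (links_of p))))
        = e_act n \<epsilon> i (unit_vec (links_of p))"
      using i j p e_link_braid[OF p, of i j]
      by (simp only: e_act_single matching_e_link atLeastLessThan_iff if_False mult_1_right)
  qed (intro flinear_compose[OF flinear_e_act flinear_compose[OF flinear_e_act flinear_e_act]]
      flinear_e_act)+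
  show "e_act n \<epsilon> i (e_act n \<epsilon> j x) = e_act n \<epsilon> j (e_act n \<epsilon> i x)" if ij: "\<bar>int i - int j\<bar> > 1"
  proof (rule link_span_eq_on[OF x, of "\<lambda>x. e_act n \<epsilon> i (e_act n \<epsilon> j x)" "\<lambda>x. e_act n \<epsilon> j (e_act n \<epsilon> i x)"])
    fix p assume p: "matching n p"
    have *: "e_act n \<epsilon> i (e_act n \<epsilon> j (unit_vec (links_of p))) = e_act n \<epsilon> j (e_act n \<epsilon> i (unit_vec (links_of p)))"
      if "1 \<le> i" "i < n" "1 \<le> j" "j < n" "i + 1 < j" for i j
    proof -
      have dis: "p i = i + 1 \<Longrightarrow> \<not> (p i = j \<and> p (i + 1) = j + 1 \<or> p i = j + 1 \<and> p (i + 1) = j)"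
        "p j = j + 1 \<Longrightarrow> \<not> (p i = j \<and> p (i + 1) = j + 1 \<or> p i = j + 1 \<and> p (i + 1) = j)"
        using that matchingD(3)[OF p, of i] matchingD(3)[OF p, of "i + 1"] by auto
      show ?thesis
        using that p dis e_link_commute[OF p that(1,5)]
        by (auto simp: e_act_single matching_e_link simp del: One_nat_def add_Suc_right add_0_right)
    qed
    have "i + 1 < j \<or> j + 1 < i" using ij by linarith
    then show "e_act n \<epsilon> i (e_act n \<epsilon> j (unit_vec (links_of p))) = e_act n \<epsilon> j (e_act n \<epsilon> i (unit_vec (links_of p)))"
      using *[of i j] *[of j i] i j by auto
  qed (intro flinear_compose[OF flinear_e_act flinear_e_act])+
qed

section \<open>The 1-factor of a link diagram\<close>

definition sgn_of :: "(nat \<Rightarrow> nat) \<Rightarrow> nat \<Rightarrow> int" where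
  "sgn_of p x = (if p x \<noteq> 0 \<and> p x < x then -1 else 1)"

definition seq_of :: "nat \<Rightarrow> (nat \<Rightarrow> nat) \<Rightarrow> int list" where
  "seq_of n p = map (sgn_of p) [1..<n + 1]"

lemma link_seq_eq: "matching n p \<Longrightarrow> link_seq n (links_of p) = seq_of n p"
  by (simp add: link_seq_links_of seq_of_def sgn_of_def)

lemma length_seq_of [simp]: "length (seq_of n p) = n"
  by (simp add: seq_of_def)

lemma nth_seq_of: "1 \<le> k \<Longrightarrow> k \<le> n \<Longrightarrow> seq_of n p ! (k - Suc 0) = sgn_of p k"
  by (simp add: seq_of_def nth_append del: upt_Suc)

lemma sum_sgn_closed:
  assumes p: "matching n p" and S: "finite S" "\<And>x. x \<in> S \<Longrightarrow> p x \<in> S \<and> p x \<noteq> 0"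
  shows "sum (sgn_of p) S = 0"
proof -
  have flip: "sgn_of p (p x) = - sgn_of p x" if "x \<in> S" for x
  proof -
    have "p x \<noteq> 0" "p (p x) = x" "x \<noteq> 0" "x < p x \<or> p x < x"
      using S(2)[OF that] matchingD(1)[OF p] matchingD(3)[OF p, of x] matching_neq[OF p, of x]
      by (auto intro: ccontr)
    then show ?thesis by (auto simp: sgn_of_def)
  qed
  have "sum (sgn_of p) S = sum (\<lambda>x. sgn_of p (p x)) S"
  proof (rule sum.reindex_bij_betw[symmetric])
    have inv: "p (p x) = x" if "x \<in> S" for x
      using S(2)[OF that] matchingD(3)[OF p] by blast
    show "bij_betw p S S"
      by (rule bij_betw_byWitness[where f' = p]) (use inv S(2) in auto)
  qed
  also have "\<dots> = - sum (sgn_of p) S" by (simp add: flip sum_negf)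
  finally show ?thesis by simp
qed

text \<open>
  The two ends of a link inside \<open>S\<close> cancel. A vertex of \<open>S\<close> whose partner is missing from \<open>S\<close> is a
  left endpoint or a defect, and counts \<open>1\<close>.
\<close>

lemma sum_sgn_right_closed:
  assumes p: "matching n p" and S: "finite S" "\<And>x. x \<in> S \<Longrightarrow> p x \<noteq> 0 \<Longrightarrow> p x < x \<Longrightarrow> p x \<in> S" "0 \<notin> S"
  shows "sum (sgn_of p) S = int (card {x \<in> S. p x \<notin> S})"
proof -
  let ?A = "{x \<in> S. p x \<in> S}" and ?B = "{x \<in> S. p x \<notin> S}"
  have nz: "p x \<noteq> 0" if "p x \<in> S" for x using that S(3) by metis
  have "sum (sgn_of p) ?A = 0"
    using S(1) nz matchingD(3)[OF p] by (intro sum_sgn_closed[OF p]) auto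
  moreover have "sum (sgn_of p) ?B = (\<Sum>x\<in>?B. 1)"
    by (rule sum.cong) (use S(2) in \<open>auto simp: sgn_of_def\<close>)
  moreover have "sum (sgn_of p) S = sum (sgn_of p) ?A + sum (sgn_of p) ?B"
    using S(1) by (subst sum.union_disjoint[symmetric]) (auto intro: sum.cong)
  ultimately show ?thesis by simp
qed

lemma sum_sgn_link:
  assumes p: "matching n p" and x: "x < p x"
  shows "sum (sgn_of p) {x..p x} = 0"
proof (rule sum_sgn_closed[OF p])
  fix z assume z: "z \<in> {x..p x}"
  have x0: "x \<noteq> 0" "p (p x) = x"
    using x matchingD(1)[OF p] matchingD(3)[OF p, of x] by (auto intro: ccontr)
  consider "z = x" | "z = p x" | "x < z" "z < p x" using z by force
  then show "p z \<in> {x..p x} \<and> p z \<noteq> 0"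
  proof cases
    case 3
    then show ?thesis using matchingD(5,6)[OF p 3] by simp
  qed (use x x0 in auto)
qed simp

text \<open>
  All vertices from one end of a link to the other are matched among themselves, so their number is even.
\<close>

lemma odd_link:
  assumes p: "matching n p" and x: "p x \<noteq> 0"
  shows "odd (x + p x)"
proof -
  have *: "odd (x + p x)" if x: "x < p x" for x
  proof -
    have "{z \<in> {x..p x}. odd (sgn_of p z)} = {x..p x}" by (auto simp: sgn_of_def)
    then have "even (card {x..p x})"
      using sum_sgn_link[OF p x] even_sum_iff[of "{x..p x}" "sgn_of p"] by simp
    then show ?thesis using x by auto
  qed
  consider "x < p x" | "p x < x" using matching_neq[OF p x] by blast
  then show ?thesis
  proof cases
    case 2
    then have "p (p x) = x" using matchingD(3)[OF p x] by simp
    then show ?thesis using *[of "p x"] 2 by (simp add: add.commute)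
  qed (rule *)
qed

lemma sum_sgn_prefix:
  assumes p: "matching n p" and x: "1 \<le> x" "x \<le> j" and beyond: "p x = 0 \<or> j < p x"
  shows "sum (sgn_of p) {x..j} \<noteq> 0"
proof -
  have "sum (sgn_of p) {x..j} = int (card {z \<in> {x..j}. p z \<notin> {x..j}})"
  proof (rule sum_sgn_right_closed[OF p])
    fix z assume z: "z \<in> {x..j}" "p z \<noteq> 0" "p z < z"
    have "\<not> p z < x"
    proof
      assume "p z < x"
      moreover have "x \<noteq> z" using z beyond by auto
      moreover have "p (p z) = z" using matchingD(3)[OF p z(2)] .
      ultimately have "p z < p x" "p x < z"
        using matchingD(5,6)[OF p, of "p z" x] z by auto
      then show False using beyond z by auto
    qed
    then show "p z \<in> {x..j}" using z by auto
  qed (use x in auto)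
  moreover have "x \<in> {z \<in> {x..j}. p z \<notin> {x..j}}" using x beyond by auto
  then have "card {z \<in> {x..j}. p z \<notin> {x..j}} \<noteq> 0" by (subst card_0_eq) auto
  ultimately show ?thesis by simp
qed

text \<open>
  Partial sums from a left endpoint stay positive until they vanish at the other end of the link, and
  partial sums from a defect stay positive forever.
\<close>

lemma pairing_seq_of:
  assumes p: "matching n p"
  shows "pairing (seq_of n p) x j \<longleftrightarrow> x < p x \<and> j = p x"
proof -
  have sum: "(\<Sum>k=x..j. seq_of n p ! (k - 1)) = sum (sgn_of p) {x..j}" if "1 \<le> x" "j \<le> n" for j
    using that by (intro sum.cong) (auto simp: nth_seq_of)
  show ?thesis
  proof
    assume "pairing (seq_of n p) x j"
    then have x: "1 \<le> x" "x < j" "j \<le> n" and first: "sgn_of p x = 1"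
      and zero: "sum (sgn_of p) {x..j} = 0"
      and pos: "\<And>j'. x < j' \<Longrightarrow> j' < j \<Longrightarrow> sum (sgn_of p) {x..j'} \<noteq> 0"
      using sum by (auto simp: pairing_def nth_seq_of)
    have "\<not> (p x = 0 \<or> j < p x)" using sum_sgn_prefix[OF p x(1), of j] x(2) zero by (metis less_imp_le)
    moreover from this have "p x \<noteq> 0" by simp
    moreover from this have "x < p x"
      using first matching_neq[OF p, of x] by (auto simp: sgn_of_def split: if_splits)
    moreover have "\<not> p x < j" using pos[of "p x"] sum_sgn_link[OF p] calculation by blast
    ultimately show "x < p x \<and> j = p x" by auto
  next
    assume *: "x < p x \<and> j = p x"
    then have x: "1 \<le> x" "j \<le> n" using matchingD(1)[OF p] matching_le[OF p, of x]
      by (auto intro!: Suc_leI intro: ccontr)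
    have "sum (sgn_of p) {x..j'} \<noteq> 0" if "x < j'" "j' < j" for j'
      using sum_sgn_prefix[OF p x(1), of j'] that * by simp
    then show "pairing (seq_of n p) x j"
      using * x sum sum_sgn_link[OF p, of x] by (auto simp: pairing_def nth_seq_of sgn_of_def)
  qed
qed

lemma seq_of_inj:
  assumes "matching n p" "matching n q" "seq_of n p = seq_of n q"
  shows "p = q"
proof -
  have "x < p x \<and> j = p x \<longleftrightarrow> x < q x \<and> j = q x" for x j
    using pairing_seq_of[OF assms(1)] pairing_seq_of[OF assms(2)] assms(3) by metis
  then have "links_of p = links_of q"
    by (auto simp: links_of_def)
  then show ?thesis by (rule links_of_inj[OF assms(1,2)])
qed

section \<open>Vectors given by their coefficients\<close>

definition words :: "nat \<Rightarrow> int list set" where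
  "words n = {w. length w = n \<and> set w \<subseteq> {1, -1}}"

lemma finite_words [simp]: "finite (words n)"
  unfolding words_def using finite_lists_length_eq[of "{1, -1 :: int}" n] by (simp add: conj_commute)

definition vec :: "nat \<Rightarrow> (int list \<Rightarrow> 'a::field) \<Rightarrow> (int list \<Rightarrow>\<^sub>0 'a)" where
  "vec n f = (\<Sum>w\<in>words n. single w (f w))"

lemma lookup_vec: "lookup (vec n f) w = (if w \<in> words n then f w else 0)"
  by (simp add: vec_def lookup_sum lookup_single when_def)

lemma keys_vec: "keys (vec n f) \<subseteq> words n"
  by (auto simp: in_keys_iff lookup_vec split: if_splits)

lemma vec_cong: "(\<And>w. w \<in> words n \<Longrightarrow> f w = g w) \<Longrightarrow> vec n f = vec n g"
  by (simp add: vec_def)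

lemma scale_vec: "scale c (vec n f) = vec n (\<lambda>w. c * f w)"
  by (rule poly_mapping_eqI) (simp add: lookup_vec)

lemma vec_zero: "vec n (\<lambda>w. 0) = 0"
  by (rule poly_mapping_eqI) (simp add: lookup_vec)

text \<open>
  The coefficients of \<open>y 1 * y (-1) - scale v (y (-1) * y 1)\<close>, the vector of a single link.
\<close>

definition pair_coeff :: "'a::field \<Rightarrow> int \<Rightarrow> int \<Rightarrow> 'a" where
  "pair_coeff v r s = (if r = 1 \<and> s = -1 then 1 else if r = -1 \<and> s = 1 then - v else 0)"

lemma yw_mult: "yw u * yw w = yw (u @ w)"
  by (simp add: yw_def mult_single plus_list_def)

lemma split_at_pair:
  assumes "1 \<le> i" "i < length u"
  shows "u = take (i - 1) u @ [u ! (i - 1), u ! i] @ drop (i + 1) u"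
proof -
  have "u = take (i - 1) u @ u ! (i - 1) # drop (Suc (i - 1)) u"
    using assms by (intro id_take_nth_drop) simp
  also have "drop (Suc (i - 1)) u = u ! i # drop (i + 1) u"
    using assms Cons_nth_drop_Suc[of i u] by simp
  finally show ?thesis by simp
qed

text \<open>
  \<open>edot v i\<close> has rank one on the two tensor factors concerned: it is the contraction with values
  \<open>- inverse v\<close> at \<open>(1, -1)\<close> and \<open>1\<close> at \<open>(-1, 1)\<close>, followed by insertion of the vector of a link.
\<close>

lemma edot_eq_vec:
  assumes v: "v \<noteq> (0::'a::field)" and i: "1 \<le> i" "i < n" and x: "keys x \<subseteq> words n"
  shows "edot v i x = vec n (\<lambda>w. pair_coeff v (w ! (i - 1)) (w ! i) *
    (lookup x (w[i - 1 := -1, i := 1])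
      - inverse v * lookup x (w[i - 1 := 1, i := -1])))"
    (is "_ = ?T x")
proof (rule flinear_eq_on_keys[of "edot v i" ?T])
  show "flinear (edot v i)" unfolding edot_def by (rule flinear_lin)
  show "flinear ?T"
    by (rule flinearI; rule poly_mapping_eqI) (simp_all add: lookup_vec lookup_add algebra_simps)
  fix u assume "u \<in> keys x"
  then have u: "length u = n" "set u \<subseteq> {1, -1}" using x by (auto simp: words_def)
  define a r s b where "a = take (i - 1) u" and "r = u ! (i - 1)" and "s = u ! i" and "b = drop (i + 1) u"
  have u_eq: "u = a @ [r, s] @ b"
    unfolding a_def b_def r_def s_def using i u by (intro split_at_pair) auto
  have la: "length a = i - 1" "length b = n - i - 1" using i u by (auto simp: a_def b_def)
  have rs: "r \<in> {1, -1}" "s \<in> {1, -1}" using u(2) by (auto simp: u_eq)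
  define cap where "cap = (if r = 1 \<and> s = -1 then - inverse v else if r = -1 \<and> s = 1 then 1 else 0)"
  have edot2: "edot2 v r s = scale cap (yw [1, -1] - scale v (yw [-1, 1]))"
    using rs v by (auto simp: edot2_def cap_def yw_mult yw_def mult_single plus_list_def
        free.scale_right_diff_distrib single_uminus)
  have "edot v i (unit_vec u) = yw a * edot2 v r s * yw b"
    by (simp add: edot_def a_def b_def r_def s_def)
  also have "\<dots> = scale cap (yw (a @ [1, -1] @ b) - scale v (yw (a @ [-1, 1] @ b)))"
    by (simp add: edot2 scale_mult_left scale_mult_right right_diff_distrib left_diff_distrib yw_mult)
  finally have L: "edot v i (unit_vec u) = \<dots>" .
  show "edot v i (unit_vec u) = ?T (unit_vec u)"
  proof (rule poly_mapping_eqI)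
    fix w :: "int list"
    show "lookup (edot v i (unit_vec u)) w = lookup (?T (unit_vec u)) w"
    proof (cases "w \<in> words n")
      case True
      define a' r' s' b' where "a' = take (i - 1) w" and "r' = w ! (i - 1)" and "s' = w ! i"
        and "b' = drop (i + 1) w"
      have w_eq: "w = a' @ [r', s'] @ b'"
        unfolding a'_def b'_def r'_def s'_def using i True
        by (intro split_at_pair) (auto simp: words_def)
      have la': "length a' = i - 1" "length b' = n - i - 1" using i True by (auto simp: a'_def b'_def words_def)
      have up: "w[i - 1 := c, i := d] = a' @ [c, d] @ b'" for c d
        using la' i by (cases i) (auto simp: w_eq list_update_append)
      have eq: "a' @ [c, d] @ b' = a @ [e, f] @ b \<longleftrightarrow> a' = a \<and> b' = b \<and> c = e \<and> d = f" for c d e f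
        using la la' by auto
      have eq': "w = a @ [e, f] @ b \<longleftrightarrow> a' = a \<and> b' = b \<and> r' = e \<and> s' = f" for e f
        using eq[of r' s' e f] by (simp add: w_eq)
      have look: "lookup (yw z :: int list \<Rightarrow>\<^sub>0 'a) z' = of_bool (z' = z)" for z z'
        by (simp add: yw_def lookup_single when_def)
      have "lookup (edot v i (unit_vec u)) w
          = cap * (of_bool (a' = a \<and> b' = b \<and> r' = 1 \<and> s' = -1)
              - v * of_bool (a' = a \<and> b' = b \<and> r' = -1 \<and> s' = 1))"
        by (simp only: L lookup_scale lookup_minus look eq')
      also have "\<dots> = pair_coeff v r' s' * (of_bool (a' = a \<and> b' = b \<and> -1 = r \<and> 1 = s)
          - inverse v * of_bool (a' = a \<and> b' = b \<and> 1 = r \<and> -1 = s))"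
        using rs v by (auto simp: cap_def pair_coeff_def)
      also have "\<dots> = lookup (?T (unit_vec u)) w"
        using True by (simp only: lookup_vec up r'_def s'_def u_eq eq
            yw_def[symmetric] look if_True)
      finally show ?thesis .
    next
      case False
      moreover have "a @ [1, -1] @ b \<in> words n" "a @ [-1, 1] @ b \<in> words n"
        using u by (auto simp: u_eq words_def)
      ultimately show ?thesis
        unfolding L by (auto simp: lookup_vec lookup_minus yw_def lookup_single when_def)
    qed
  qed
qed

section \<open>Contracting links and defects\<close>

definition letter :: "int list \<Rightarrow> nat \<Rightarrow> int" where
  "letter w x = w ! (x - 1)"

text \<open>
  The factor of a vertex \<open>x\<close> with partner \<open>z\<close> in the coefficient at the word \<open>W\<close>. A link contributes
  through its left endpoint only. The letter \<open>\<tau> x\<close> prescribed at a defect \<open>x\<close> is \<open>1\<close> for \<open>\<eta>\<close>, but other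
  prescriptions are needed to describe the image of \<open>\<eta>\<close> under the lowering operator. The parameter
  \<open>\<sigma> = \<plusminus>1\<close> gives each vector the sign by which the two assertions of the theorem differ.
\<close>

definition vertex_factor :: "'a::field \<Rightarrow> 'a \<Rightarrow> (nat \<Rightarrow> int) \<Rightarrow> (nat \<Rightarrow> int) \<Rightarrow> nat \<Rightarrow> nat \<Rightarrow> 'a" where
  "vertex_factor \<sigma> v \<tau> W x z = (if z = 0 then of_bool (W x = \<tau> x)
     else if x < z then \<sigma> ^ z * pair_coeff v (W x) (W z) else 1)"

definition word_coeff :: "'a::field \<Rightarrow> 'a \<Rightarrow> nat \<Rightarrow> (nat \<Rightarrow> nat) \<Rightarrow> (nat \<Rightarrow> int) \<Rightarrow> (nat \<Rightarrow> int) \<Rightarrow> 'a" where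
  "word_coeff \<sigma> v n p \<tau> W = (\<Prod>x\<in>{1..n}. vertex_factor \<sigma> v \<tau> W x (p x))"

lemma word_coeff_cong:
  assumes "matching n p" "\<And>x. 1 \<le> x \<Longrightarrow> x \<le> n \<Longrightarrow> W x = W' x"
  shows "word_coeff \<sigma> v n p \<tau> W = word_coeff \<sigma> v n p \<tau> W'"
  unfolding word_coeff_def
proof (rule prod.cong[OF refl])
  fix x assume "x \<in> {1..n}"
  then show "vertex_factor \<sigma> v \<tau> W x (p x) = vertex_factor \<sigma> v \<tau> W' x (p x)"
    using assms(2)[of x] assms(2)[of "p x"] matching_le[OF assms(1), of x]
    by (simp add: vertex_factor_def)
qed

lemma sign_power_eq:
  assumes "\<sigma> = 1 \<or> \<sigma> = (-1::'a::field)" "odd (a + b)"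
  shows "\<sigma> * \<sigma> ^ a = \<sigma> ^ b"
  using assms by (auto simp: minus_one_power_iff)

text \<open>
  All factors except those of \<open>i\<close>, \<open>i + 1\<close> and their partners are the same before and after relinking and
  are independent of the letters at \<open>i\<close> and \<open>i + 1\<close>. This leaves an identity between a few factors in each
  of the possible relative positions: partners on one side each, both on the right, both on the left, or
  one of the two vertices being a defect, whose position is then forced because it cannot lie beneath the
  link of the other one.
\<close>

lemma word_coeff_e_link:
  fixes v \<sigma> :: "'a::field" and p n i
  assumes p: "matching n p" and i: "1 \<le> i" "i < n" and v: "v \<noteq> 0" and \<sigma>: "\<sigma> = 1 \<or> \<sigma> = -1"
    and W: "\<And>x. 1 \<le> x \<Longrightarrow> x \<le> n \<Longrightarrow> W x = 1 \<or> W x = -1"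
  defines "C \<equiv> word_coeff \<sigma> v n p (\<lambda>_. 1)"
  defines "D \<equiv> \<sigma> * (pair_coeff v (W i) (W (i + 1)) *
      (C (W(i := -1, i + 1 := 1)) - inverse v * C (W(i := 1, i + 1 := -1))))"
  shows "p i = i + 1 \<Longrightarrow> D = - \<sigma> * (v + inverse v) * C W"
    and "p i = 0 \<Longrightarrow> p (i + 1) = 0 \<Longrightarrow> D = 0"
    and "p i \<noteq> i + 1 \<Longrightarrow> \<not> (p i = 0 \<and> p (i + 1) = 0) \<Longrightarrow> D = word_coeff \<sigma> v n (e_link i p) (\<lambda>_. 1) W"
proof -
  let ?f = "vertex_factor \<sigma> v (\<lambda>_. 1)"
  have ne: "p i \<noteq> i" "p (i + 1) \<noteq> i + 1" "p i = i + 1 \<longleftrightarrow> p (i + 1) = i"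
    by (rule matching_adjacent[OF p i(1)])+
  define S where "S = {i, i + 1, p i, p (i + 1)} - {0}"
  have S: "finite S" "S \<subseteq> {1..n}"
    using i matching_le[OF p, of i] matching_le[OF p, of "i + 1"] by (auto simp: S_def)
  define rest where "rest = (\<Prod>x\<in>{1..n} - S. ?f W x (p x))"
  have out: "p x \<noteq> i" "p x \<noteq> i + 1" "x \<noteq> i" "x \<noteq> i + 1" "e_link i p x = p x"
    if "x \<in> {1..n} - S" for x
  proof -
    have x: "x \<noteq> 0" "x \<noteq> i" "x \<noteq> i + 1" "x \<noteq> p i" "x \<noteq> p (i + 1)"
      using that by (auto simp: S_def)
    show "p x \<noteq> i" "p x \<noteq> i + 1"
      using x matchingD(3)[OF p, of x] i by auto
    show "x \<noteq> i" "x \<noteq> i + 1" by fact+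
    show "e_link i p x = p x" by (rule e_link_other[OF p x])
  qed
  have upd: "?f (W(i := r, i + 1 := s)) x (p x) = ?f W x (p x)" if "x \<in> {1..n} - S" for x r s
    using out(1-4)[OF that] by (simp add: vertex_factor_def)
  have split: "(\<Prod>x\<in>{1..n}. g x) = (\<Prod>x\<in>S. g x) * (\<Prod>x\<in>{1..n} - S. g x)" for g :: "nat \<Rightarrow> 'a"
    using prod.subset_diff[OF S(2), of g] by (simp add: mult.commute)
  have C_upd: "C (W(i := r, i + 1 := s)) = (\<Prod>x\<in>S. ?f (W(i := r, i + 1 := s)) x (p x)) * rest" for r s
    unfolding C_def word_coeff_def rest_def split using upd by simp
  have C_W: "C W = (\<Prod>x\<in>S. ?f W x (p x)) * rest"
    unfolding C_def word_coeff_def rest_def split ..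
  have C_e_link: "word_coeff \<sigma> v n (e_link i p) (\<lambda>_. 1) W = (\<Prod>x\<in>S. ?f W x (e_link i p x)) * rest"
    unfolding word_coeff_def rest_def split using out(5) by simp
  have sq: "\<sigma> * \<sigma> = 1" using \<sigma> by auto
  have Wi: "W i = 1 \<or> W i = -1" "W (i + 1) = 1 \<or> W (i + 1) = -1" using W[of i] W[of "i + 1"] i by auto
  show "D = - \<sigma> * (v + inverse v) * C W" if pi: "p i = i + 1"
  proof -
    have "S = {i, i + 1}" using pi ne i by (auto simp: S_def)
    then show ?thesis
      unfolding D_def C_upd C_W using pi ne v i
      by (simp add: vertex_factor_def pair_coeff_def algebra_simps)
  qed
  show "D = 0" if "p i = 0" "p (i + 1) = 0"
  proof -
    have "S = {i, i + 1}" using that i by (auto simp: S_def)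
    then show ?thesis
      unfolding D_def C_upd C_W using that by (simp add: vertex_factor_def)
  qed
  show "D = word_coeff \<sigma> v n (e_link i p) (\<lambda>_. 1) W" if *: "p i \<noteq> i + 1" "\<not> (p i = 0 \<and> p (i + 1) = 0)"
  proof -
    have jp: "p i \<noteq> 0 \<Longrightarrow> e_link i p (p i) = p (i + 1)" "p (i + 1) \<noteq> 0 \<Longrightarrow> e_link i p (p (i + 1)) = p i"
      "e_link i p i = i + 1" "e_link i p (i + 1) = i"
      using e_link_partner[OF p i(1) *(1)] e_link_self[OF i(1), of p] by auto
    have pp: "p i \<noteq> 0 \<Longrightarrow> p (p i) = i" "p (i + 1) \<noteq> 0 \<Longrightarrow> p (p (i + 1)) = i + 1"
      using matchingD(3)[OF p] by auto
    consider (right) "p i = 0" "p (i + 1) \<noteq> 0" | (left) "p i \<noteq> 0" "p (i + 1) = 0"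
      | (both) "p i \<noteq> 0" "p (i + 1) \<noteq> 0"
      using *(2) by metis
    then show ?thesis
    proof cases
      case right
      define k where "k = p (i + 1)"
      have k: "i + 1 < k"
      proof (rule ccontr)
        assume "\<not> i + 1 < k"
        then have "k < i" using ne * k_def by auto
        then have "k < p i" using matchingD(5)[OF p, of k i] pp right by (simp add: k_def)
        then show False using right by simp
      qed
      have "odd (k + (i + 1))" using odd_link[OF p, of "i + 1"] right by (simp add: k_def)
      then have sk: "\<sigma> * \<sigma> ^ k = \<sigma> ^ (i + 1)" by (intro sign_power_eq[OF \<sigma>])
      have SS: "S = {i, i + 1, k}" using right i by (auto simp: S_def k_def)
      have eqs: "p i = 0" "p (i + 1) = k" "p k = i + 1" "e_link i p i = i + 1"
        "e_link i p (i + 1) = i" "e_link i p k = 0"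
        using right pp jp by (auto simp: k_def)
      have C1: "C (W(i := r, i + 1 := s)) = of_bool (r = 1) * (\<sigma> ^ k * pair_coeff v s (W k)) * rest" for r s
        unfolding C_upd SS using k eqs by (simp add: vertex_factor_def)
      have C2: "word_coeff \<sigma> v n (e_link i p) (\<lambda>_. 1) W
          = \<sigma> ^ (i + 1) * pair_coeff v (W i) (W (i + 1)) * of_bool (W k = 1) * rest"
        unfolding C_e_link SS using k eqs i by (simp add: vertex_factor_def)
      have "D = (\<sigma> * \<sigma> ^ k) * pair_coeff v (W i) (W (i + 1)) * of_bool (W k = 1) * rest"
        unfolding D_def C1 using v by (simp add: pair_coeff_def)
      then show ?thesis unfolding C2 sk .
    next
      case left
      define k where "k = p i"
      have k: "k < i"
      proof (rule ccontr)
        assume "\<not> k < i"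
        then have "i + 1 < k" using ne * k_def by auto
        then have "i < p (i + 1)" using matchingD(5)[OF p, of i "i + 1"] pp left by (simp add: k_def)
        then show False using left by simp
      qed
      have Wk: "W k = 1 \<or> W k = -1" using W[of k] k left i by (simp add: k_def)
      have SS: "S = {i, i + 1, k}" using left i by (auto simp: S_def k_def)
      have eqs: "p i = k" "p (i + 1) = 0" "p k = i" "e_link i p i = i + 1"
        "e_link i p (i + 1) = i" "e_link i p k = 0"
        using left pp jp by (auto simp: k_def)
      have "k \<noteq> 0" using left by (simp add: k_def)
      then have C1: "C (W(i := r, i + 1 := s)) = of_bool (s = 1) * (\<sigma> ^ i * pair_coeff v (W k) r) * rest" for r s
        unfolding C_upd SS using k eqs by (simp add: vertex_factor_def)
      have C2: "word_coeff \<sigma> v n (e_link i p) (\<lambda>_. 1) W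
          = \<sigma> ^ (i + 1) * pair_coeff v (W i) (W (i + 1)) * of_bool (W k = 1) * rest"
        unfolding C_e_link SS using k eqs i by (simp add: vertex_factor_def)
      show ?thesis unfolding D_def C1 C2 using v Wk by (auto simp: pair_coeff_def)
    next
      case both
      define j k where "j = p i" and "k = p (i + 1)"
      have jk: "j \<noteq> k" using matching_inj[OF p, of i "i + 1"] both by (auto simp: j_def k_def)
      have dist: "j \<noteq> i" "j \<noteq> i + 1" "k \<noteq> i" "k \<noteq> i + 1" using ne * by (auto simp: j_def k_def)
      have nz: "j \<noteq> 0" "k \<noteq> 0" using both by (auto simp: j_def k_def)
      have eqs: "p i = j" "p (i + 1) = k" "p j = i" "p k = i + 1" "e_link i p i = i + 1"
        "e_link i p (i + 1) = i" "e_link i p j = k" "e_link i p k = j"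
        using both pp jp by (auto simp: j_def k_def)
      have SS: "S = {i, i + 1, j, k}" using both i by (auto simp: S_def j_def k_def)
      have Wjk: "W j = 1 \<or> W j = -1" "W k = 1 \<or> W k = -1"
        using W[of j] W[of k] nz matching_le[OF p, of i] matching_le[OF p, of "i + 1"]
        by (auto simp: j_def k_def)
      have odd: "odd (j + i)" "odd (k + (i + 1))"
        using odd_link[OF p, of i] odd_link[OF p, of "i + 1"] both by (auto simp: j_def k_def)
      have sk: "\<sigma> * \<sigma> ^ k = \<sigma> ^ (i + 1)" using odd(2) by (intro sign_power_eq[OF \<sigma>])
      have sj: "\<sigma> * \<sigma> ^ i = \<sigma> ^ j"
        using odd(1) by (intro sign_power_eq[OF \<sigma>]) (simp add: add.commute)
      consider (a) "j < i" "i + 1 < k" | (b) "i + 1 < k" "k < j" | (c) "k < j" "j < i"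
      proof -
        have "\<not> (k < i \<and> i + 1 < j)"
          using matchingD(6)[OF p, of k i] eqs by auto
        moreover have "\<not> (i + 1 < j \<and> j < k)"
          using matchingD(5)[OF p, of "i + 1" j] eqs by auto
        moreover have "\<not> (j < k \<and> k < i)"
          using matchingD(6)[OF p, of j k] eqs by auto
        ultimately show thesis using a b c jk dist by linarith
      qed
      then show ?thesis
      proof cases
        case a
        have C1: "C (W(i := r, i + 1 := s)) = (\<sigma> ^ i * \<sigma> ^ k) * (pair_coeff v (W j) r * pair_coeff v s (W k)) * rest" for r s
          unfolding C_upd SS using a nz jk dist eqs i by (simp add: vertex_factor_def)
        have C2: "word_coeff \<sigma> v n (e_link i p) (\<lambda>_. 1) W
            = (\<sigma> ^ (i + 1) * \<sigma> ^ k) * (pair_coeff v (W i) (W (i + 1)) * pair_coeff v (W j) (W k)) * rest"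
          unfolding C_e_link SS using a nz jk dist eqs i by (simp add: vertex_factor_def)
        have sign: "\<sigma> * (\<sigma> ^ i * \<sigma> ^ k) = \<sigma> ^ (i + 1) * \<sigma> ^ k" by simp
        define g where "g = (\<sigma> ^ i * \<sigma> ^ k)"
        have "D = (\<sigma> * g) * (pair_coeff v (W i) (W (i + 1)) * pair_coeff v (W j) (W k)) * rest"
          unfolding D_def C1 g_def[symmetric] using v Wjk by (elim disjE) (simp_all add: pair_coeff_def)
        then show ?thesis unfolding C2 sign[folded g_def] .
      next
        case b
        have C1: "C (W(i := r, i + 1 := s)) = (\<sigma> ^ j * \<sigma> ^ k) * (pair_coeff v r (W j) * pair_coeff v s (W k)) * rest" for r s
          unfolding C_upd SS using b nz jk dist eqs i by (simp add: vertex_factor_def)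
        have C2: "word_coeff \<sigma> v n (e_link i p) (\<lambda>_. 1) W
            = (\<sigma> ^ (i + 1) * \<sigma> ^ j) * (pair_coeff v (W i) (W (i + 1)) * pair_coeff v (W k) (W j)) * rest"
          unfolding C_e_link SS using b nz jk dist eqs i by (simp add: vertex_factor_def)
        have sign: "\<sigma> * (\<sigma> ^ j * \<sigma> ^ k) = \<sigma> ^ (i + 1) * \<sigma> ^ j" using sk by (metis mult.left_commute mult.commute)
        define g where "g = (\<sigma> ^ j * \<sigma> ^ k)"
        have "D = (\<sigma> * g) * (pair_coeff v (W i) (W (i + 1)) * pair_coeff v (W k) (W j)) * rest"
          unfolding D_def C1 g_def[symmetric] using v Wjk by (elim disjE) (simp_all add: pair_coeff_def)
        then show ?thesis unfolding C2 sign[folded g_def] .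
      next
        case c
        have C1: "C (W(i := r, i + 1 := s)) = (\<sigma> ^ i * \<sigma> ^ (i + 1)) * (pair_coeff v (W j) r * pair_coeff v (W k) s) * rest" for r s
          unfolding C_upd SS using c nz jk dist eqs i by (simp add: vertex_factor_def)
        have C2: "word_coeff \<sigma> v n (e_link i p) (\<lambda>_. 1) W
            = (\<sigma> ^ (i + 1) * \<sigma> ^ j) * (pair_coeff v (W i) (W (i + 1)) * pair_coeff v (W k) (W j)) * rest"
          unfolding C_e_link SS using c nz jk dist eqs i by (simp add: vertex_factor_def)
        have sign: "\<sigma> * (\<sigma> ^ i * \<sigma> ^ (i + 1)) = \<sigma> ^ (i + 1) * \<sigma> ^ j" by (simp only: mult.assoc[symmetric] sj mult.commute)
        define g where "g = (\<sigma> ^ i * \<sigma> ^ (i + 1))"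
        have "D = (\<sigma> * g) * (pair_coeff v (W i) (W (i + 1)) * pair_coeff v (W k) (W j)) * rest"
          unfolding D_def C1 g_def[symmetric] using v Wjk by (elim disjE) (simp_all add: pair_coeff_def)
        then show ?thesis unfolding C2 sign[folded g_def] .
      qed
    qed
  qed
qed

section \<open>Tensor products and the lowering operator\<close>

lemma vec_mult: "vec m f * vec k g = vec (m + k) (\<lambda>w. f (take m w) * g (drop m w))"
proof (rule poly_mapping_eqI)
  fix z
  have "lookup (vec m f * vec k g) z
      = (\<Sum>u\<in>words m. \<Sum>w\<in>words k. if z = u @ w then f u * g w else 0)"
    unfolding vec_def sum_product lookup_sum
    by (auto simp: mult_single lookup_single when_def plus_list_def intro!: sum.cong)
  also have "\<dots> = (\<Sum>u\<in>words m. \<Sum>w\<in>words k.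
      if u = take m z then if w = drop m z then f u * g w else 0 else 0)"
    by (intro sum.cong refl) (auto simp: words_def)
  also have "\<dots> = (if take m z \<in> words m \<and> drop m z \<in> words k then f (take m z) * g (drop m z) else 0)"
    by (subst sum.swap) (cases "take m z \<in> words m"; simp add: sum.delta)
  also have "take m z \<in> words m \<and> drop m z \<in> words k \<longleftrightarrow> z \<in> words (m + k)"
  proof -
    have "set z = set (take m z) \<union> set (drop m z)"
      by (metis append_take_drop_id set_append)
    then show ?thesis by (auto simp: words_def)
  qed
  finally show "lookup (vec m f * vec k g) z
      = lookup (vec (m + k) (\<lambda>w. f (take m w) * g (drop m w))) z"
    by (simp add: lookup_vec)
qed

lemma y_vec: "r \<in> {1, -1} \<Longrightarrow> y r = vec 1 (\<lambda>w. of_bool (w = [r]))"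
  by (rule poly_mapping_eqI) (auto simp: yw_def lookup_vec lookup_single when_def words_def)

lemma yw_Nil: "yw [] = (1 :: int list \<Rightarrow>\<^sub>0 'a::field)"
  unfolding yw_def zero_list_def[symmetric] by simp

text \<open>
  The operator \<open>K\<^sup>-\<^sup>1\<close> on the whole tensor algebra. It expresses the coproduct of the lowering operator
  \<open>F\<close>, namely \<open>F \<otimes> K\<^sup>-\<^sup>1 + 1 \<otimes> F\<close>.
\<close>

definition Kinv :: "'a::field \<Rightarrow> (int list \<Rightarrow>\<^sub>0 'a) \<Rightarrow> (int list \<Rightarrow>\<^sub>0 'a)" where
  "Kinv v = lin (\<lambda>w. scale (v powi (- sum_list w)) (yw w))"

lemma flinear_F: "flinear (F v)"
  unfolding F_def by (rule flinear_lin)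

lemma flinear_Kinv: "flinear (Kinv v)"
  unfolding Kinv_def by (rule flinear_lin)

lemma prod_Kinv1:
  assumes "v \<noteq> 0"
  shows "prod_list (map (Kinv1 v) w) = scale (v powi (- sum_list w)) (yw w)"
proof (induction w)
  case Nil
  show ?case by (simp add: yw_Nil)
next
  case (Cons r w)
  have "v powi (- r) * v powi (- sum_list w) = v powi (- sum_list (r # w))"
    using assms by (simp add: power_int_add[symmetric])
  then show ?case using Cons
    by (simp add: mult.commute[of "v powi (- sum_list w)"] Kinv1_def scale_mult_left scale_mult_right yw_mult)
qed

lemma F_Cons:
  assumes "v \<noteq> 0"
  shows "F v (yw (r # w)) = F1 r * Kinv v (yw w) + y r * F v (yw w)"
proof -
  have F: "F v (yw u) = (\<Sum>j<length u. yw (take j u) * F1 (u ! j) * prod_list (map (Kinv1 v) (drop (Suc j) u)))" for u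
    by (simp add: F_def yw_def)
  have "F v (yw (r # w)) = yw [] * F1 r * prod_list (map (Kinv1 v) w) +
      (\<Sum>j<length w. y r * (yw (take j w) * F1 (w ! j) * prod_list (map (Kinv1 v) (drop (Suc j) w))))"
    by (simp add: F sum.lessThan_Suc_shift mult.assoc[symmetric] yw_mult del: sum.lessThan_Suc)
  also note yw_Nil
  also have "prod_list (map (Kinv1 v) w) = Kinv v (yw w)"
    by (simp add: prod_Kinv1[OF assms] Kinv_def yw_def)
  finally show ?thesis by (simp add: F sum_distrib_left)
qed

lemma Kinv_mult:
  assumes "v \<noteq> 0"
  shows "Kinv v (a * b) = Kinv v a * Kinv v b"
proof (rule flinear_eq_on_keys[of "\<lambda>a. Kinv v (a * b)" "\<lambda>a. Kinv v a * Kinv v b"])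
  note lin = flinear_add[OF flinear_Kinv] flinear_scale[OF flinear_Kinv]
  show "flinear (\<lambda>a. Kinv v (a * b))" "flinear (\<lambda>a. Kinv v a * Kinv v b)"
    by (rule flinearI; simp add: lin distrib_right scale_mult_left)+
  fix u
  show "Kinv v (unit_vec u * b) = Kinv v (unit_vec u) * Kinv v b"
  proof (rule flinear_eq_on_keys[of "\<lambda>b. Kinv v (unit_vec u * b)"])
    show "flinear (\<lambda>b. Kinv v (unit_vec u * b))" "flinear (\<lambda>b. Kinv v (unit_vec u) * Kinv v b)"
      by (rule flinearI; simp add: lin distrib_left scale_mult_right)+
    fix w
    have "v powi (- sum_list u) * v powi (- sum_list w) = v powi (- sum_list (u @ w))"
      using assms by (simp add: power_int_add[symmetric])
    then show "Kinv v (unit_vec u * unit_vec w) = Kinv v (unit_vec u) * Kinv v (unit_vec w)"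
      by (simp add: Kinv_def mult_single plus_list_def yw_def)
  qed
qed

lemma F_mult:
  assumes "v \<noteq> 0"
  shows "F v (a * b) = F v a * Kinv v b + a * F v b"
proof (rule flinear_eq_on_keys[of "\<lambda>a. F v (a * b)" "\<lambda>a. F v a * Kinv v b + a * F v b"])
  note lin = flinear_add[OF flinear_F] flinear_scale[OF flinear_F]
    flinear_add[OF flinear_Kinv] flinear_scale[OF flinear_Kinv] free.scale_right_distrib
  show "flinear (\<lambda>a. F v (a * b))" "flinear (\<lambda>a. F v a * Kinv v b + a * F v b)"
    by (rule flinearI; simp add: lin distrib_right scale_mult_left algebra_simps)+
  fix u
  show "F v (unit_vec u * b) = F v (unit_vec u) * Kinv v b + unit_vec u * F v b"
  proof (rule flinear_eq_on_keys[of "\<lambda>b. F v (unit_vec u * b)"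
        "\<lambda>b. F v (unit_vec u) * Kinv v b + unit_vec u * F v b"])
    show "flinear (\<lambda>b. F v (unit_vec u * b))"
      "flinear (\<lambda>b. F v (unit_vec u) * Kinv v b + unit_vec u * F v b)"
      by (rule flinearI; simp add: lin distrib_left scale_mult_right algebra_simps)+
    fix w
    have "F v (yw (u @ w)) = F v (yw u) * Kinv v (yw w) + yw u * F v (yw w)"
    proof (induction u)
      case Nil
      have "F v (yw []) = 0"
        by (simp add: yw_def F_def)
      then show ?case by (simp add: yw_Nil)
    next
      case (Cons r u)
      have "Kinv v (yw (u @ w)) = Kinv v (yw u) * Kinv v (yw w)"
        by (simp add: Kinv_mult[OF assms, symmetric] yw_mult)
      then show ?case
        using Cons
        by (simp add: F_Cons[OF assms] distrib_left distrib_right mult.assoc[symmetric] yw_mult)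
    qed
    then show "F v (unit_vec u * unit_vec w)
        = F v (unit_vec u) * Kinv v (unit_vec w) + unit_vec u * F v (unit_vec w)"
      by (simp add: yw_def mult_single plus_list_def)
  qed
qed

lemma F_y: "F (v::'a::field) (y 1) = y (-1)" "F v (y (-1)) = 0"
  using yw_Nil[where 'a = 'a] by (simp_all add: F_def yw_def F1_def)

lemma Kinv_y: "Kinv v (y r) = scale (v powi (- r)) (y r)"
  by (simp add: Kinv_def yw_def)

lemma Kinv_homogeneous:
  assumes "\<And>w. w \<in> keys x \<Longrightarrow> sum_list w = d"
  shows "Kinv v x = scale (v powi (- d)) x"
  by (rule flinear_eq_on_keys[OF flinear_Kinv])
    (auto intro!: flinearI simp: free.scale_right_distrib mult.commute Kinv_def yw_def assms)

text \<open>
  The vector of a single link is invariant, and it remains so with an invariant vector inside.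
\<close>

lemma F_Psi:
  assumes "v \<noteq> 0" "F v c = 0" "Kinv v c = c"
  shows "F v (Psi v c) = 0"
proof -
  have "F v (y 1 * c * y (-1)) = scale v (y (-1) * c * y (-1))"
    using assms by (simp add: F_mult F_y Kinv_mult Kinv_y scale_mult_left scale_mult_right mult.assoc)
  moreover have "F v (y (-1) * c * y 1) = y (-1) * c * y (-1)"
    using assms by (simp add: F_mult F_y)
  ultimately show ?thesis
    by (simp add: Psi_def flinear_diff[OF flinear_F] flinear_scale[OF flinear_F])
qed

section \<open>Restriction of a link diagram to an interval\<close>

text \<open>
  The vertices \<open>a + 1, \<dots>, a + m\<close> are renumbered \<open>1, \<dots>, m\<close>. Truncated subtraction keeps the value \<open>0\<close> of a
  defect.
\<close>

definition window :: "nat \<Rightarrow> nat \<Rightarrow> (nat \<Rightarrow> nat) \<Rightarrow> nat \<Rightarrow> nat" where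
  "window a m p x = (if x \<in> {1..m} then p (x + a) - a else 0)"

context
  fixes n p a m
  assumes p: "matching n p" and closed: "\<And>x. x \<in> {a + 1..a + m} \<Longrightarrow> p x \<noteq> 0 \<Longrightarrow> p x \<in> {a + 1..a + m}"
begin

lemma window_shift: "x \<in> {1..m} \<Longrightarrow> p (x + a) = (if window a m p x = 0 then 0 else window a m p x + a)"
  using closed[of "x + a"] by (cases "p (x + a) = 0") (auto simp: window_def)

lemma window_mem:
  assumes "window a m p x \<noteq> 0"
  shows "x \<in> {1..m} \<and> window a m p x \<in> {1..m}"
proof -
  have x: "x \<in> {1..m}" using assms by (simp add: window_def split: if_splits)
  then have "p (x + a) - a \<noteq> 0" using assms by (simp add: window_def)
  then have "p (x + a) \<in> {a + 1..a + m}" using x by (intro closed) auto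
  then show ?thesis using x by (auto simp: window_def)
qed

lemma matching_window: "matching m (window a m p)"
  unfolding matching_def
proof (intro conjI allI impI)
  fix x assume "window a m p x \<noteq> 0"
  note x = window_mem[OF this] this
  then have "p (x + a) = window a m p x + a" using window_shift[of x] by simp
  then have "p (window a m p x + a) = x + a"
    using matchingD(3)[OF p, of "x + a"] x by simp
  moreover have "window a m p (window a m p x) = p (window a m p x + a) - a"
    using x by (simp only: window_def[of a m p "window a m p x"] if_True)
  ultimately show "window a m p (window a m p x) = x" by simp
next
  fix x assume x: "window a m p x = x"
  show "x = 0"
  proof (rule ccontr)
    assume "x \<noteq> 0"
    then have "p (x + a) = x + a" using window_mem[of x] window_shift[of x] x by auto
    then show False using matchingD(4)[OF p] \<open>x \<noteq> 0\<close> by fastforce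
  qed
next
  fix x z assume xz: "x < z \<and> z < window a m p x"
  then have x: "x \<in> {1..m}" "window a m p x \<in> {1..m}" "p (x + a) = window a m p x + a"
    using window_mem[of x] window_shift[of x] by auto
  then have "x + a < p (z + a)" "p (z + a) < p (x + a)"
    using matchingD(5,6)[OF p, of "x + a" "z + a"] xz by auto
  moreover have "z \<in> {1..m}" using xz x by auto
  ultimately show "x < window a m p z" "window a m p z < window a m p x"
    using window_shift[of z] x by (auto split: if_splits)
qed (auto simp: window_def)

lemma seq_of_window: "seq_of m (window a m p) = map (sgn_of p) [a + 1..<a + m + 1]"
proof (rule nth_equalityI)
  fix k assume "k < length (seq_of m (window a m p))"
  then have k: "k < m" by simp
  then have "seq_of m (window a m p) ! k = sgn_of (window a m p) (k + 1)"
    using nth_seq_of[of "k + 1" m] by simp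
  also have "\<dots> = sgn_of p (k + 1 + a)"
    using window_shift[of "k + 1"] k by (auto simp: sgn_of_def)
  finally show "seq_of m (window a m p) ! k = map (sgn_of p) [a + 1..<a + m + 1] ! k"
    using k by (simp add: add.commute nth_append del: upt_Suc)
qed simp

lemma prod_window:
  "(\<Prod>x\<in>{a + 1..a + m}. vertex_factor 1 v \<tau> W x (p x))
    = word_coeff 1 v m (window a m p) (\<lambda>x. \<tau> (x + a)) (\<lambda>x. W (x + a))"
  unfolding word_coeff_def
proof (rule prod.reindex_cong[of "\<lambda>x. x + a"])
  show "{a + 1..a + m} = (\<lambda>x. x + a) ` {1..m}"
    by (simp add: image_add_atLeastAtMost' add.commute)
  fix x assume x: "x \<in> {1..m}"
  then show "vertex_factor 1 v \<tau> W (x + a) (p (x + a))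
      = vertex_factor 1 v (\<lambda>x. \<tau> (x + a)) (\<lambda>x. W (x + a)) x (window a m p x)"
    using window_shift[OF x] window_mem[of x] by (simp add: vertex_factor_def)
qed simp

lemma defect_set_window: "defect_set n p \<inter> {a + 1..a + m} = (\<lambda>x. x + a) ` defect_set m (window a m p)"
  if "a + m \<le> n"
proof (intro equalityI subsetI)
  fix x assume "x \<in> defect_set n p \<inter> {a + 1..a + m}"
  then have "x - a \<in> defect_set m (window a m p)" "x = (x - a) + a"
    by (auto simp: defect_set_def window_def)
  then show "x \<in> (\<lambda>x. x + a) ` defect_set m (window a m p)" by blast
next
  fix x assume "x \<in> (\<lambda>x. x + a) ` defect_set m (window a m p)"
  then obtain z where z: "x = z + a" "z \<in> {1..m}" "window a m p z = 0"
    by (auto simp: defect_set_def)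
  then show "x \<in> defect_set n p \<inter> {a + 1..a + m}"
    using window_shift[OF z(2)] that by (auto simp: defect_set_def)
qed

end

section \<open>The vectors eta and their coefficients\<close>

definition cvec :: "'a::field \<Rightarrow> nat \<Rightarrow> (nat \<Rightarrow> nat) \<Rightarrow> (nat \<Rightarrow> int) \<Rightarrow> (int list \<Rightarrow>\<^sub>0 'a)" where
  "cvec v n p \<tau> = vec n (\<lambda>w. word_coeff 1 v n p \<tau> (letter w))"

lemma cvec_cong:
  assumes "\<And>x. 1 \<le> x \<Longrightarrow> x \<le> n \<Longrightarrow> p x = 0 \<Longrightarrow> \<tau> x = \<tau>' x"
  shows "cvec v n p \<tau> = cvec v n p \<tau>'"
  unfolding cvec_def word_coeff_def
  by (intro vec_cong prod.cong refl) (use assms in \<open>auto simp: vertex_factor_def\<close>)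

lemma Psi_vec:
  "Psi v (vec k f) = vec (k + 2) (\<lambda>w. pair_coeff v (w ! 0) (w ! (k + 1)) * f (take k (drop 1 w)))"
proof -
  have y: "y r * vec k f * y s = vec (k + 2) (\<lambda>w. of_bool (w ! 0 = r \<and> w ! (k + 1) = s) * f (take k (drop 1 w)))"
    if "r \<in> {1, -1}" "s \<in> {1, -1}" for r s
  proof -
    have "y r * vec k f * y s = vec (1 + k + 1) (\<lambda>w. of_bool (take 1 (take (1 + k) w) = [r]) *
        f (drop 1 (take (1 + k) w)) * of_bool (drop (1 + k) w = [s]))"
      by (simp only: y_vec[OF that(1)] y_vec[OF that(2)] vec_mult)
    also have "\<dots> = vec (1 + k + 1) (\<lambda>w. of_bool (w ! 0 = r \<and> w ! (k + 1) = s) * f (take k (drop 1 w)))"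
    proof (rule vec_cong)
      fix w :: "int list" assume "w \<in> words (1 + k + 1)"
      then have l: "length w = k + 2" by (simp add: words_def)
      then have "take 1 (take (1 + k) w) = [w ! 0]" by (cases w) auto
      moreover have "drop (1 + k) w = [w ! (k + 1)]"
        using l Cons_nth_drop_Suc[of "k + 1" w] by simp
      moreover have "drop 1 (take (1 + k) w) = take k (drop 1 w)" by (simp add: drop_take)
      ultimately show "of_bool (take 1 (take (1 + k) w) = [r]) *
        f (drop 1 (take (1 + k) w)) * of_bool (drop (1 + k) w = [s])
        = of_bool (w ! 0 = r \<and> w ! (k + 1) = s) * f (take k (drop 1 w))" by simp
    qed
    finally show ?thesis by simp
  qed
  show ?thesis
    unfolding Psi_def
    by (rule poly_mapping_eqI) (auto simp: y lookup_minus lookup_vec pair_coeff_def)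
qed

lemma letter_drop: "1 \<le> x \<Longrightarrow> a + x \<le> length w \<Longrightarrow> letter (drop a w) x = letter w (x + a)"
  by (simp add: letter_def) (metis add.commute Nat.add_diff_assoc2)

lemma letter_take: "1 \<le> x \<Longrightarrow> x \<le> k \<Longrightarrow> letter (take k w) x = letter w x"
  by (simp add: letter_def)

lemma first_defect_closed:
  assumes "matching (Suc m) p" "p 1 = 0" "x \<in> {1 + 1..1 + m}" "p x \<noteq> 0"
  shows "p x \<in> {1 + 1..1 + m}"
proof -
  have "p x \<noteq> 1" using matchingD(3)[OF assms(1,4)] assms(2,3) by auto
  then show ?thesis using assms(4) matching_le[OF assms(1), of x] by simp
qed

text \<open>
  This and the next lemma are the two recursive cases of \<open>\<eta>\<close>, for the vectors given by coefficients.
\<close>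

lemma cvec_defect:
  assumes p: "matching (Suc m) p" and p1: "p 1 = 0" and \<tau>: "\<tau> 1 \<in> {1, -1}"
  shows "cvec v (Suc m) p \<tau> = y (\<tau> 1) * cvec v m (window 1 m p) (\<lambda>x. \<tau> (x + 1))"
proof -
  note closed = first_defect_closed[OF p p1]
  have "word_coeff 1 v (Suc m) p \<tau> (letter w)
      = of_bool (take 1 w = [\<tau> 1]) * word_coeff 1 v m (window 1 m p) (\<lambda>x. \<tau> (x + 1)) (letter (drop 1 w))"
    if w: "w \<in> words (Suc m)" for w
  proof -
    have "{1..Suc m} = insert 1 {1 + 1..1 + m}" by auto
    then have "word_coeff 1 v (Suc m) p \<tau> (letter w)
        = vertex_factor 1 v \<tau> (letter w) 1 (p 1) * (\<Prod>x\<in>{1 + 1..1 + m}. vertex_factor 1 v \<tau> (letter w) x (p x))"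
      unfolding word_coeff_def by simp
    also have "(\<Prod>x\<in>{1 + 1..1 + m}. vertex_factor 1 v \<tau> (letter w) x (p x))
        = word_coeff 1 v m (window 1 m p) (\<lambda>x. \<tau> (x + 1)) (\<lambda>x. letter w (x + 1))"
      by (rule prod_window[OF p closed])
    also have "\<dots> = word_coeff 1 v m (window 1 m p) (\<lambda>x. \<tau> (x + 1)) (letter (drop 1 w))"
      by (rule word_coeff_cong[OF matching_window[OF p closed]])
        (use w in \<open>auto simp: letter_drop words_def\<close>)
    also have "vertex_factor 1 v \<tau> (letter w) 1 (p 1) = of_bool (take 1 w = [\<tau> 1])"
      using w p1 by (cases w) (auto simp: vertex_factor_def letter_def words_def)
    finally show ?thesis .
  qed
  then show ?thesis
    unfolding cvec_def y_vec[OF \<tau>] vec_mult plus_1_eq_Suc by (rule vec_cong)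
qed

lemma cvec_link:
  assumes p: "matching (k + 2 + m) p" and p1: "p 1 = k + 2"
  shows "cvec v (k + 2 + m) p \<tau>
    = Psi v (cvec v k (window 1 k p) (\<lambda>x. \<tau> (x + 1))) * cvec v m (window (k + 2) m p) (\<lambda>x. \<tau> (x + (k + 2)))"
    and "x \<in> {1 + 1..1 + k} \<Longrightarrow> p x \<in> {1 + 1..1 + k}"
    and "x \<in> {k + 2 + 1..k + 2 + m} \<Longrightarrow> p x \<noteq> 0 \<Longrightarrow> p x \<in> {k + 2 + 1..k + 2 + m}"
proof -
  have pk: "p (k + 2) = 1" using matchingD(3)[OF p, of 1] p1 by simp
  show inner: "p x \<in> {1 + 1..1 + k}" if "x \<in> {1 + 1..1 + k}" for x
    using matchingD(5,6)[OF p, of 1 x] that p1 by auto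
  show outer: "p x \<in> {k + 2 + 1..k + 2 + m}" if x: "x \<in> {k + 2 + 1..k + 2 + m}" "p x \<noteq> 0" for x
  proof -
    have "p x \<le> k + 2 + m" by (rule matching_le[OF p])
    moreover have "p (p x) = x" using matchingD(3)[OF p] x by blast
    then have "p x \<noteq> 1" "p x \<noteq> k + 2" "p x \<notin> {1 + 1..1 + k}"
      using x p1 pk inner[of "p x"] by auto
    ultimately show ?thesis using x(2) by simp
  qed
  have "word_coeff 1 v (k + 2 + m) p \<tau> (letter w)
      = (pair_coeff v (take (k + 2) w ! 0) (take (k + 2) w ! (k + 1)) *
          word_coeff 1 v k (window 1 k p) (\<lambda>x. \<tau> (x + 1)) (letter (take k (drop 1 (take (k + 2) w))))) *
        word_coeff 1 v m (window (k + 2) m p) (\<lambda>x. \<tau> (x + (k + 2))) (letter (drop (k + 2) w))"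
    if w: "w \<in> words (k + 2 + m)" for w
  proof -
    let ?f = "\<lambda>x. vertex_factor 1 v \<tau> (letter w) x (p x)"
    have "{1..k + 2 + m} = insert 1 (insert (k + 2) ({1 + 1..1 + k} \<union> {k + 2 + 1..k + 2 + m}))"
      by auto
    moreover have "{1 + 1..1 + k} \<inter> {k + 2 + 1..k + 2 + m} = {}" by auto
    ultimately have "word_coeff 1 v (k + 2 + m) p \<tau> (letter w)
        = ?f 1 * (?f (k + 2) * (prod ?f {1 + 1..1 + k} * prod ?f {k + 2 + 1..k + 2 + m}))"
      unfolding word_coeff_def by (simp add: prod.union_disjoint)
    also have "prod ?f {1 + 1..1 + k} = word_coeff 1 v k (window 1 k p) (\<lambda>x. \<tau> (x + 1)) (\<lambda>x. letter w (x + 1))"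
      by (rule prod_window[OF p inner])
    also have "\<dots> = word_coeff 1 v k (window 1 k p) (\<lambda>x. \<tau> (x + 1)) (letter (take k (drop 1 (take (k + 2) w))))"
      by (rule word_coeff_cong[OF matching_window[OF p inner]])
        (use w in \<open>auto simp: letter_def words_def\<close>)
    also have "prod ?f {k + 2 + 1..k + 2 + m}
        = word_coeff 1 v m (window (k + 2) m p) (\<lambda>x. \<tau> (x + (k + 2))) (\<lambda>x. letter w (x + (k + 2)))"
      by (rule prod_window[OF p outer])
    also have "\<dots> = word_coeff 1 v m (window (k + 2) m p) (\<lambda>x. \<tau> (x + (k + 2))) (letter (drop (k + 2) w))"
      by (rule word_coeff_cong[OF matching_window[OF p outer]])
        (use w in \<open>auto simp: letter_drop words_def\<close>)
    also have "?f (k + 2) = 1" using pk by (simp add: vertex_factor_def)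
    also have "?f 1 = pair_coeff v (take (k + 2) w ! 0) (take (k + 2) w ! (k + 1))"
      using p1 by (simp add: vertex_factor_def letter_def)
    finally show ?thesis by (simp add: mult.assoc)
  qed
  then show "cvec v (k + 2 + m) p \<tau>
    = Psi v (cvec v k (window 1 k p) (\<lambda>x. \<tau> (x + 1))) * cvec v m (window (k + 2) m p) (\<lambda>x. \<tau> (x + (k + 2)))"
    unfolding cvec_def Psi_vec vec_mult by (rule vec_cong)
qed

lemma seq_of_Suc: "seq_of (Suc m) p = sgn_of p 1 # map (sgn_of p) [2..<m + 2]"
  by (simp add: seq_of_def upt_conv_Cons numeral_2_eq_2 del: upt_Suc)

lemma eta_defect:
  assumes "matching (Suc m) p" "p 1 = 0"
  shows "eta v (seq_of (Suc m) p) = y 1 * eta v (seq_of m (window 1 m p))"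
proof -
  note closed = first_defect_closed[OF assms]
  have "\<nexists>j. pairing (seq_of (Suc m) p) 1 j"
    using pairing_seq_of[OF assms(1)] assms(2) by simp
  then have "eta v (seq_of (Suc m) p) = y 1 * eta v (map (sgn_of p) [2..<m + 2])"
    unfolding seq_of_Suc eta.simps by (simp only: if_False)
  also have "map (sgn_of p) [2..<m + 2] = seq_of m (window 1 m p)"
    by (subst seq_of_window[OF assms(1) closed]) (simp_all add: numeral_2_eq_2)
  finally show ?thesis .
qed

lemma eta_link:
  assumes p: "matching (k + 2 + m) p" and p1: "p 1 = k + 2"
  shows "eta v (seq_of (k + 2 + m) p)
    = Psi v (eta v (seq_of k (window 1 k p))) * eta v (seq_of m (window (k + 2) m p))"
proof -
  have pair: "pairing (seq_of (k + 2 + m) p) 1 j \<longleftrightarrow> j = k + 2" for j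
    using pairing_seq_of[OF p] p1 by simp
  let ?b = "map (sgn_of p) [2..<k + m + 3]"
  have seq: "seq_of (k + 2 + m) p = sgn_of p 1 # ?b"
    using seq_of_Suc[of "k + m + 1" p] by (simp add: numeral_eq_Suc)
  have the: "(THE j. pairing (sgn_of p 1 # ?b) 1 j) = k + 2" "\<exists>j. pairing (sgn_of p 1 # ?b) 1 j"
    unfolding seq[symmetric] pair by auto
  have "eta v (seq_of (k + 2 + m) p) = Psi v (eta v (take (k + 2 - 2) ?b)) * eta v (drop (k + 2 - 1) ?b)"
    unfolding seq eta.simps Let_def the(1) using the(2) by (simp only: if_True)
  also have "take (k + 2 - 2) ?b = seq_of k (window 1 k p)"
    by (subst seq_of_window[OF p cvec_link(2)[OF p p1]])
      (simp_all add: take_map numeral_2_eq_2 del: upt_Suc)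
  also have "drop (k + 2 - 1) ?b = seq_of m (window (k + 2) m p)"
    by (subst seq_of_window[OF p cvec_link(3)[OF p p1]])
      (simp_all add: drop_map numeral_eq_Suc add.commute del: upt_Suc)
  finally show ?thesis .
qed

abbreviation up :: "nat \<Rightarrow> int" where "up \<equiv> \<lambda>_. 1"

text \<open>
  The value of \<open>F\<close>: each defect is lowered in turn, and \<open>K\<^sup>-\<^sup>1\<close> acts on the part to the right of it, whose
  weight is the number of defects there.
\<close>

definition lowered :: "'a::field \<Rightarrow> nat \<Rightarrow> (nat \<Rightarrow> nat) \<Rightarrow> (int list \<Rightarrow>\<^sub>0 'a)" where
  "lowered v n p = (\<Sum>t\<in>defect_set n p.
     scale (v powi (- int (card {s \<in> defect_set n p. t < s}))) (cvec v n p (up(t := -1))))"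

lemma finite_defect_set [simp]: "finite (defect_set n p)"
  by (simp add: defect_set_def)

lemma sum_list_keys_mult:
  assumes "\<And>w. w \<in> keys a \<Longrightarrow> sum_list w = d" "\<And>w. w \<in> keys b \<Longrightarrow> sum_list w = (e::int)"
    and "w \<in> keys (a * b)"
  shows "sum_list w = d + e"
  using keys_mult[of a b] assms by (fastforce simp: plus_list_def)

text \<open>
  The coefficients, the weight and the image under \<open>F\<close> are found in one induction along the recursion for
  \<open>\<eta>\<close>: the computation of \<open>F\<close> uses that the part beneath a link is killed by \<open>F\<close> and has weight \<open>0\<close>,
  having no defects.
\<close>

lemma eta_coeff:
  fixes v :: "'a::field"
  assumes v: "v \<noteq> 0" and p: "matching n p"
  shows "eta v (seq_of n p) = cvec v n p up
    \<and> (\<forall>w\<in>keys (cvec v n p up). sum_list w = int (card (defect_set n p)))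
    \<and> F v (cvec v n p up) = lowered v n p"
  using p
proof (induction n arbitrary: p rule: less_induct)
  case (less n)
  note p = less.prems
  have keys_y: "sum_list w = r" if "w \<in> keys (y r :: int list \<Rightarrow>\<^sub>0 'a)" for w r
    using that by (simp add: yw_def)
  show ?case
  proof (cases n)
    case 0
    have "cvec v 0 p \<tau> = 1" for \<tau>
      by (simp add: cvec_def vec_def words_def word_coeff_def yw_Nil[symmetric] yw_def cong: conj_cong)
    moreover have "F v (1 :: int list \<Rightarrow>\<^sub>0 'a) = 0"
      unfolding yw_Nil[symmetric] by (simp add: F_def yw_def)
    ultimately show ?thesis
      by (simp add: 0 seq_of_def lowered_def defect_set_def zero_list_def)
  next
    case (Suc m)
    show ?thesis
    proof (cases "p 1 = 0")
      case True
      let ?q = "window 1 m p"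
      have pm: "matching (Suc m) p" using p Suc by simp
      note closed = first_defect_closed[OF pm True]
      have q: "matching m ?q" by (rule matching_window[OF pm closed])
      note IH = less.IH[OF _ q]
      have D: "defect_set n p = insert 1 ((\<lambda>x. x + 1) ` defect_set m ?q)"
      proof -
        have "defect_set n p = insert 1 (defect_set n p \<inter> {1 + 1..1 + m})"
          using True Suc by (auto simp: defect_set_def)
        then show ?thesis using defect_set_window[OF pm closed] Suc by simp
      qed
      have D1: "1 \<notin> (\<lambda>x. x + 1) ` defect_set m ?q" by (auto simp: defect_set_def)
      have inj: "inj_on (\<lambda>x. x + 1) A" for A :: "nat set" by simp
      have card: "card (defect_set n p) = card (defect_set m ?q) + 1"
        using D1 by (simp add: D card_image)
      let ?c = "cvec v m ?q up"
      have eq: "cvec v n p up = y 1 * ?c"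
        using cvec_defect[OF pm True, of up v] Suc by simp
      have low1: "cvec v n p (up(1 := -1)) = y (-1) * ?c"
      proof -
        have "cvec v m ?q (\<lambda>x. (up(1 := -1)) (x + 1)) = ?c" by (rule cvec_cong) simp
        then show ?thesis using cvec_defect[OF pm True, of "up(1 := -1)" v] Suc by simp
      qed
      have low: "cvec v n p (up(t + 1 := -1)) = y 1 * cvec v m ?q (up(t := -1))" if "t \<in> defect_set m ?q" for t
      proof -
        have "(up(t + 1 := -1)) 1 = 1" "(\<lambda>x. (up(t + 1 := -1)) (x + 1)) = up(t := -1)"
          using that by (auto simp: defect_set_def)
        then show ?thesis
          using cvec_defect[OF pm True, of "up(t + 1 := -1)" v] Suc by simp
      qed
      have "eta v (seq_of n p) = cvec v n p up"
        using eta_defect[OF pm True, of v] IH Suc eq by simp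
      moreover have "\<forall>w\<in>keys (cvec v n p up). sum_list w = int (card (defect_set n p))"
      proof
        fix w assume "w \<in> keys (cvec v n p up)"
        then have "sum_list w = 1 + int (card (defect_set m ?q))"
          unfolding eq using IH Suc by (intro sum_list_keys_mult[of "y 1"]) (auto dest: keys_y)
        then show "sum_list w = int (card (defect_set n p))" by (simp add: card)
      qed
      moreover have "F v (cvec v n p up) = lowered v n p"
      proof -
        let ?g = "\<lambda>t. scale (v powi (- int (card {s \<in> defect_set n p. t < s}))) (cvec v n p (up(t := -1)))"
        have "Kinv v ?c = scale (v powi (- int (card (defect_set m ?q)))) ?c"
          using IH Suc by (intro Kinv_homogeneous) auto
        then have "F v (cvec v n p up)
            = scale (v powi (- int (card (defect_set m ?q)))) (y (-1) * ?c) + y 1 * lowered v m ?q"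
          unfolding eq using IH Suc by (simp add: F_mult[OF v] F_y scale_mult_right)
        also have "y 1 * lowered v m ?q = (\<Sum>t\<in>defect_set m ?q.
            scale (v powi (- int (card {s \<in> defect_set n p. t + 1 < s}))) (cvec v n p (up(t + 1 := -1))))"
          unfolding lowered_def sum_distrib_left
        proof (rule sum.cong[OF refl])
          fix t assume t: "t \<in> defect_set m ?q"
          have "{s \<in> defect_set n p. t + 1 < s} = (\<lambda>x. x + 1) ` {s \<in> defect_set m ?q. t < s}"
            by (auto simp: D)
          then have "card {s \<in> defect_set n p. t + 1 < s} = card {s \<in> defect_set m ?q. t < s}"
            by (simp add: card_image)
          then show "y 1 * scale (v powi - int (card {s \<in> defect_set m ?q. t < s})) (cvec v m ?q (up(t := - 1)))
              = scale (v powi (- int (card {s \<in> defect_set n p. t + 1 < s}))) (cvec v n p (up(t + 1 := -1)))"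
            by (simp only: low[OF t] scale_mult_right)
        qed
        also have "scale (v powi (- int (card (defect_set m ?q)))) (y (-1) * ?c)
            = scale (v powi (- int (card {s \<in> defect_set n p. 1 < s}))) (cvec v n p (up(1 := -1)))"
        proof -
          have "{s \<in> defect_set n p. 1 < s} = (\<lambda>x. x + 1) ` defect_set m ?q"
          proof -
            have "1 \<le> t" if "t \<in> defect_set m ?q" for t using that by (simp add: defect_set_def)
            then show ?thesis unfolding D by fastforce
          qed
          then have "card {s \<in> defect_set n p. 1 < s} = card (defect_set m ?q)"
            by (simp add: card_image)
          then show ?thesis by (simp only: low1)
        qed
        finally have "F v (cvec v n p up) = ?g 1 + (\<Sum>t\<in>defect_set m ?q. ?g (t + 1))" .
        also have "\<dots> = sum ?g (insert 1 ((\<lambda>x. x + 1) ` defect_set m ?q))"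
          using D1 by (subst sum.insert) (simp_all only: finite_imageI finite_defect_set
              sum.reindex[OF inj] comp_def not_False_eq_True)
        also have "\<dots> = lowered v n p" by (simp only: lowered_def D[symmetric])
        finally show ?thesis .
      qed
      ultimately show ?thesis by blast
    next
      case False
      have "p 1 \<noteq> 1" "p 1 \<le> n" using matchingD(4)[OF p, of 1] matching_le[OF p, of 1] by auto
      define k r where "k = p 1 - 2" and "r = n - p 1"
      have p1: "p 1 = k + 2" and n: "n = k + 2 + r"
        using False \<open>p 1 \<noteq> 1\<close> \<open>p 1 \<le> n\<close> by (auto simp: k_def r_def)
      have pm: "matching (k + 2 + r) p" using p n by simp
      let ?q = "window 1 k p" and ?s = "window (k + 2) r p"
      note inner = cvec_link(2)[OF pm p1] and outer = cvec_link(3)[OF pm p1]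
      have q: "matching k ?q" by (rule matching_window[OF pm inner])
      have s: "matching r ?s" by (rule matching_window[OF pm outer])
      have IHq: "eta v (seq_of k ?q) = cvec v k ?q up"
          "\<And>w. w \<in> keys (cvec v k ?q up) \<Longrightarrow> sum_list w = int (card (defect_set k ?q))"
          "F v (cvec v k ?q up) = lowered v k ?q"
        and IHs: "eta v (seq_of r ?s) = cvec v r ?s up"
          "\<And>w. w \<in> keys (cvec v r ?s up) \<Longrightarrow> sum_list w = int (card (defect_set r ?s))"
          "F v (cvec v r ?s up) = lowered v r ?s"
        using less.IH[OF _ q] less.IH[OF _ s] n by auto
      have nod: "p x \<noteq> 0" if "x \<in> {1..k + 2}" for x
      proof -
        consider "x = 1" | "x = k + 2" | "x \<in> {1 + 1..1 + k}" using \<open>x \<in> {1..k + 2}\<close> by force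
        then show ?thesis
        proof cases
          case 2
          then show ?thesis using matchingD(3)[OF p, of 1] p1 by simp
        next
          case 3
          from inner[OF 3] show ?thesis by auto
        qed (use p1 in simp)
      qed
      have Dq: "defect_set k ?q = {}"
      proof -
        have "p x \<noteq> 0" if "x \<in> {1 + 1..1 + k}" for x by (rule nod) (use that in auto)
        then have "defect_set n p \<inter> {1 + 1..1 + k} = {}" unfolding defect_set_def by blast
        moreover have "defect_set n p \<inter> {1 + 1..1 + k} = (\<lambda>x. x + 1) ` defect_set k ?q"
          using defect_set_window[OF pm inner] n by simp
        ultimately show ?thesis by simp
      qed
      have D: "defect_set n p = (\<lambda>x. x + (k + 2)) ` defect_set r ?s"
      proof -
        have "defect_set n p = defect_set n p \<inter> {k + 2 + 1..k + 2 + r}"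
        proof -
          have "x \<in> {k + 2 + 1..k + 2 + r}" if "x \<in> defect_set n p" for x
            using that nod[of x] n by (force simp: defect_set_def)
          then show ?thesis by blast
        qed
        then show ?thesis using defect_set_window[OF pm outer] n by simp
      qed
      have inj: "inj_on (\<lambda>x. x + (k + 2)) A" for A :: "nat set" by (rule inj_on_add')
      have card: "card (defect_set n p) = card (defect_set r ?s)" unfolding D by (rule card_image[OF inj])
      let ?c = "cvec v k ?q up" and ?d = "cvec v r ?s up"
      have eq: "cvec v n p up = Psi v ?c * ?d"
        using cvec_link(1)[OF pm p1, of v up] n by simp
      have low: "cvec v n p (up(t + (k + 2) := -1)) = Psi v ?c * cvec v r ?s (up(t := -1))" for t
      proof -
        have "cvec v k ?q (\<lambda>x. (up(t + (k + 2) := -1)) (x + 1)) = ?c"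
          by (rule cvec_cong) (use Dq in \<open>auto simp: defect_set_def\<close>)
        moreover have "(\<lambda>x. (up(t + (k + 2) := -1)) (x + (k + 2))) = up(t := -1)" by auto
        ultimately show ?thesis
          using cvec_link(1)[OF pm p1, of v "up(t + (k + 2) := -1)"] n by simp
      qed
      have "eta v (seq_of n p) = cvec v n p up"
        using eta_link[OF pm p1, of v] IHq IHs n eq by simp
      moreover have "\<forall>w\<in>keys (cvec v n p up). sum_list w = int (card (defect_set n p))"
      proof
        have c0: "sum_list w = 0" if "w \<in> keys ?c" for w
          using IHq(2)[OF that] Dq by simp
        have yby: "sum_list w = 0" if "w \<in> keys (y a * ?c * y (- a))" for w a
        proof -
          have "sum_list w = a + 0 + - a"
            by (rule sum_list_keys_mult[OF sum_list_keys_mult[of "y a"] _ that])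
              (use c0 keys_y in blast)+
          then show ?thesis by simp
        qed
        have "sum_list w = 0" if "w \<in> keys (Psi v ?c)" for w
        proof -
          have "w \<in> keys (y 1 * ?c * y (- 1)) \<or> w \<in> keys (y (- 1) * ?c * y 1)"
            using that by (auto simp: Psi_def in_keys_iff lookup_minus)
          then show ?thesis using yby[of w 1] yby[of w "- 1"] by auto
        qed
        fix w assume "w \<in> keys (cvec v n p up)"
        then have "sum_list w = 0 + int (card (defect_set r ?s))"
          unfolding eq using IHs(2) \<open>\<And>w. w \<in> keys (Psi v ?c) \<Longrightarrow> sum_list w = 0\<close>
          by (intro sum_list_keys_mult[of "Psi v ?c"])
        then show "sum_list w = int (card (defect_set n p))" by (simp add: card)
      qed
      moreover have "F v (cvec v n p up) = lowered v n p"
      proof -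
        have "F v ?c = 0" unfolding IHq(3) lowered_def Dq by simp
        moreover have "Kinv v ?c = ?c"
          using Kinv_homogeneous[of ?c 0 v] IHq(2) Dq by simp
        ultimately have "F v (cvec v n p up) = Psi v ?c * lowered v r ?s"
          unfolding eq F_mult[OF v] IHs(3) by (simp only: F_Psi[OF v] mult_zero_left add_0_left)
        also have "\<dots> = (\<Sum>t\<in>defect_set r ?s.
            scale (v powi (- int (card {s \<in> defect_set n p. t + (k + 2) < s}))) (cvec v n p (up(t + (k + 2) := -1))))"
          unfolding lowered_def sum_distrib_left
        proof (rule sum.cong[OF refl])
          fix t
          have "{s \<in> defect_set n p. t + (k + 2) < s} = (\<lambda>x. x + (k + 2)) ` {s \<in> defect_set r ?s. t < s}"
            by (auto simp: D)
          then have "card {s \<in> defect_set n p. t + (k + 2) < s} = card {s \<in> defect_set r ?s. t < s}"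
            by (simp only: card_image[OF inj])
          then show "Psi v ?c * scale (v powi - int (card {s \<in> defect_set r ?s. t < s})) (cvec v r ?s (up(t := - 1)))
              = scale (v powi (- int (card {s \<in> defect_set n p. t + (k + 2) < s}))) (cvec v n p (up(t + (k + 2) := -1)))"
            by (simp only: low scale_mult_right)
        qed
        also have "\<dots> = sum (\<lambda>t. scale (v powi (- int (card {s \<in> defect_set n p. t < s})))
            (cvec v n p (up(t := -1)))) ((\<lambda>x. x + (k + 2)) ` defect_set r ?s)"
          by (simp only: sum.reindex[OF inj] comp_def)
        also have "\<dots> = lowered v n p" by (simp only: lowered_def D[symmetric])
        finally show ?thesis .
      qed
      ultimately show ?thesis by blast
    qed
  qed
qed

section \<open>The spans of mu and eta\<close>

lemma matching_mono: "matching n p \<Longrightarrow> n \<le> N \<Longrightarrow> matching N p"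
  by (simp add: matching_def)

lemma matching_restrict: "matching (Suc n) p \<Longrightarrow> p (Suc n) = 0 \<Longrightarrow> matching n p"
  unfolding matching_def by (metis Suc_lessI)

lemma matching_cut:
  assumes p: "matching (Suc n) p" and t: "t = p (Suc n)" "t \<noteq> 0"
  shows "matching n (p(t := 0, Suc n := 0))"
proof -
  note m = matchingD[OF p]
  have pt: "p t = Suc n" "t \<noteq> Suc n" using m(3)[of "Suc n"] m(4)[of "Suc n"] t by auto
  let ?q = "p(t := 0, Suc n := 0)"
  have q: "x \<noteq> t \<and> x \<noteq> Suc n \<and> ?q x = p x" if "?q x \<noteq> 0" for x
    using that by (auto split: if_splits)
  show ?thesis
    unfolding matching_def
  proof (intro conjI allI impI)
    show "?q 0 = 0" using m(1) by simp
  next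
    fix x assume "n < x"
    then show "?q x = 0" using m(2)[of x] by (cases "x = Suc n") auto
  next
    fix x assume "?q x \<noteq> 0"
    from q[OF this] this have x: "x \<noteq> t" "x \<noteq> Suc n" "?q x = p x" "p (p x) = x" using m(3)[of x] by auto
    moreover have "p x \<noteq> t" "p x \<noteq> Suc n" using x pt t by auto
    ultimately show "?q (?q x) = x" by simp
  next
    fix x assume "?q x = x"
    then show "x = 0" using m(4)[of x] by (auto split: if_splits)
  next
    fix x z assume xz: "x < z \<and> z < ?q x"
    then have "?q x = p x" using q[of x] by linarith
    moreover from this have "x < p z" "p z < p x" using xz m(5,6)[of x z] by simp_all
    ultimately have x: "?q x = p x" "x < p z" "p z < p x" .
    have "p x \<le> Suc n" by (rule matching_le[OF p])
    then have "z \<noteq> t" "z \<noteq> Suc n" using x pt xz by auto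
    then have "?q z = p z" by simp
    then show "x < ?q z" "?q z < ?q x" using x by simp_all
  qed
qed

lemma matching_link:
  assumes p: "matching n p" and st: "1 \<le> s" "s < t" "t \<le> n" "p s = 0" "p t = 0"
    and adjacent: "\<And>r. s < r \<Longrightarrow> r < t \<Longrightarrow> p r \<noteq> 0"
  shows "matching n (p(s := t, t := s))"
proof -
  note m = matchingD[OF p]
  let ?q = "p(s := t, t := s)"
  have q: "?q s = t" "?q t = s" and qo: "x \<noteq> s \<Longrightarrow> x \<noteq> t \<Longrightarrow> ?q x = p x" for x
    using st by auto
  show ?thesis
    unfolding matching_def
  proof (intro conjI allI impI)
    show "?q 0 = 0" using m(1) st by simp
  next
    fix x assume "n < x"
    then show "?q x = 0" using m(2)[of x] st by auto
  next
    fix x assume x: "?q x \<noteq> 0"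
    show "?q (?q x) = x"
    proof (cases "x = s \<or> x = t")
      case True
      then show ?thesis using q by auto
    next
      case False
      then have "p (p x) = x" "?q x = p x" using x m(3)[of x] by auto
      moreover from this have "p x \<noteq> s" "p x \<noteq> t" using st False x m(1) by auto
      ultimately show ?thesis by simp
    qed
  next
    fix x assume "?q x = x"
    then show "x = 0" using m(4)[of x] st by (auto split: if_splits)
  next
    fix x z assume xz: "x < z \<and> z < ?q x"
    have "x < ?q z \<and> ?q z < ?q x"
    proof (cases "x = s")
      case True
      then have z: "s < z" "z < t" using xz q by auto
      then have pz: "p z \<noteq> 0" "p (p z) = z" using adjacent m(3) by auto
      have "p z \<noteq> s" "p z \<noteq> t" using pz st z by auto
      moreover have "\<not> p z < s" using m(5)[of "p z" s] pz z st by auto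
      moreover have "\<not> t < p z" using m(5)[of z t] z st by auto
      ultimately show ?thesis using True z q qo[of z] by auto
    next
      case False
      then have x: "?q x = p x" using xz st by (auto split: if_splits)
      then have z: "x < p z" "p z < p x" using m(5,6)[of x z] xz by auto
      then have "z \<noteq> s" "z \<noteq> t" using st by auto
      then show ?thesis using x z by simp
    qed
    then show "x < ?q z" "?q z < ?q x" by auto
  qed
qed

lemma cvec_snoc:
  assumes p: "matching n p" and \<tau>: "\<tau> (Suc n) \<in> {1, -1}"
  shows "cvec v (Suc n) p \<tau> = cvec v n p \<tau> * y (\<tau> (Suc n))"
proof -
  have "word_coeff 1 v (Suc n) p \<tau> (letter w) = word_coeff 1 v n p \<tau> (letter (take n w)) * of_bool (drop n w = [\<tau> (Suc n)])"
    if w: "w \<in> words (n + 1)" for w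
  proof -
    have "p (Suc n) = 0" using matchingD(2)[OF p] by simp
    moreover have "letter w (Suc n) = \<tau> (Suc n) \<longleftrightarrow> drop n w = [\<tau> (Suc n)]"
    proof -
      have "drop n w = [w ! n]" using w Cons_nth_drop_Suc[of n w] by (simp add: words_def)
      then show ?thesis by (simp add: letter_def)
    qed
    ultimately have "word_coeff 1 v (Suc n) p \<tau> (letter w)
        = word_coeff 1 v n p \<tau> (letter w) * of_bool (drop n w = [\<tau> (Suc n)])"
      unfolding word_coeff_def by (simp add: vertex_factor_def)
    also have "word_coeff 1 v n p \<tau> (letter w) = word_coeff 1 v n p \<tau> (letter (take n w))"
      by (rule word_coeff_cong[OF p]) (simp add: letter_take)
    finally show ?thesis .
  qed
  then show ?thesis
    unfolding cvec_def y_vec[OF \<tau>] vec_mult unfolding Suc_eq_plus1 by (rule vec_cong)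
qed

text \<open>
  The vector of a link is \<open>y 1 * y (-1) - scale v (y (-1) * y 1)\<close>: the difference of the two ways of lowering
  one of its ends, the left one taken with the factor \<open>v\<close>.
\<close>

lemma cvec_link_defects:
  assumes st: "1 \<le> s" "s < t" "t \<le> n" "p s = 0" "p t = 0"
  shows "cvec v n (p(s := t, t := s)) up = cvec v n p (up(t := -1)) - scale v (cvec v n p (up(s := -1)))"
proof -
  have "word_coeff 1 v n (p(s := t, t := s)) up W
      = word_coeff 1 v n p (up(t := -1)) W - v * word_coeff 1 v n p (up(s := -1)) W" for W
  proof -
    let ?R = "{1..n} - {s, t}"
    have split: "prod g {1..n} = g s * (g t * prod g ?R)" for g :: "nat \<Rightarrow> 'a"
    proof -
      have "{1..n} = insert s (insert t ?R)" using st by auto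
      then show ?thesis using st by (metis Diff_iff finite_Diff finite_atLeastAtMost finite_insert
            insert_iff less_irrefl prod.insert)
    qed
    define R where "R = (\<Prod>x\<in>?R. vertex_factor 1 v up W x (p x))"
    have "(\<Prod>x\<in>?R. vertex_factor 1 v up W x ((p(s := t, t := s)) x)) = R"
      unfolding R_def by (intro prod.cong) auto
    then have "word_coeff 1 v n (p(s := t, t := s)) up W = pair_coeff v (W s) (W t) * R"
      unfolding word_coeff_def split using st by (simp add: vertex_factor_def)
    moreover have "word_coeff 1 v n p (up(t := -1)) W = of_bool (W s = 1) * of_bool (W t = -1) * R"
    proof -
      have "(\<Prod>x\<in>?R. vertex_factor 1 v (up(t := -1)) W x (p x)) = R"
        unfolding R_def by (intro prod.cong) (auto simp: vertex_factor_def)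
      then show ?thesis
        unfolding word_coeff_def split using st by (simp add: vertex_factor_def)
    qed
    moreover have "word_coeff 1 v n p (up(s := -1)) W = of_bool (W s = -1) * of_bool (W t = 1) * R"
    proof -
      have "(\<Prod>x\<in>?R. vertex_factor 1 v (up(s := -1)) W x (p x)) = R"
        unfolding R_def by (intro prod.cong) (auto simp: vertex_factor_def)
      then show ?thesis
        unfolding word_coeff_def split using st by (simp add: vertex_factor_def)
    qed
    ultimately show ?thesis by (simp add: pair_coeff_def)
  qed
  then show ?thesis
    unfolding cvec_def by (intro poly_mapping_eqI) (simp add: lookup_vec lookup_minus)
qed

lemma qint_Suc: "v \<noteq> 0 \<Longrightarrow> v * qint v (int (Suc k)) = qint v (int k) + v ^ Suc k"
proof -
  assume v: "v \<noteq> 0"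
  have "v * qint v (int (Suc k)) = (\<Sum>t<Suc k. v powi (int (Suc k) - 2 * int t))"
    using v by (simp add: qint_def sum_distrib_left power_int_add_1'[symmetric] del: sum.lessThan_Suc of_nat_Suc)
  also have "\<dots> = v ^ Suc k + (\<Sum>t<k. v powi (int k - 1 - 2 * int t))"
    by (subst sum.lessThan_Suc_shift) (simp add: power_int_def nat_add_distrib algebra_simps)
  finally show ?thesis by (simp add: qint_def)
qed

text \<open>
  Let \<open>t\<close> be a defect and \<open>U\<^sub>s\<close> the vector in which the defect \<open>s\<close> is lowered. If \<open>k\<close> defects
  \<open>s\<^sub>1 < \<dots> < s\<^sub>k\<close> precede \<open>t\<close>, this is \<open>[k] U\<^sub>t - \<Sum>\<^sub>j v\<^sup>j U\<close> with \<open>U\<close> taken at \<open>s\<^sub>j\<close>. For the new last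
  vertex \<open>t\<close> it is the value of \<open>\<Phi>\<^sub>2\<close>; the other values of \<open>t\<close> occur in the evaluation by telescoping.
\<close>

definition raise_sum :: "'a::field \<Rightarrow> nat \<Rightarrow> (nat \<Rightarrow> nat) \<Rightarrow> nat \<Rightarrow> (int list \<Rightarrow>\<^sub>0 'a)" where
  "raise_sum v n p t = (let T = {s \<in> defect_set n p. s < t} in
     scale (qint v (int (card T))) (cvec v n p (up(t := -1)))
     - (\<Sum>s\<in>T. scale (v ^ card {r \<in> T. r \<le> s}) (cvec v n p (up(s := -1)))))"

text \<open>
  One step of the telescoping sum: with \<open>s = s\<^sub>k\<close>, the multiple \<open>[k] (U\<^sub>t - v U\<^sub>s)\<close> is split off, and
  the remaining coefficient of \<open>U\<^sub>s\<close> is \<open>v [k] - v\<^sup>k = [k - 1]\<close>.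
\<close>

lemma raise_sum_step:
  fixes v :: "'a::field"
  assumes v: "v \<noteq> 0" and p: "matching n p" and t: "t \<in> defect_set n p"
    and s: "s \<in> defect_set n p" "s < t" and adj: "\<And>r. s < r \<Longrightarrow> r < t \<Longrightarrow> p r \<noteq> 0"
  shows "raise_sum v n p t
    = scale (qint v (int (card {s \<in> defect_set n p. s < t}))) (cvec v n (p(s := t, t := s)) up)
      + raise_sum v n p s"
proof -
  let ?U = "\<lambda>t. cvec v n p (up(t := -1))"
  define T where "T = {s \<in> defect_set n p. s < t}"
  define T' where "T' = {r \<in> defect_set n p. r < s}"
  have TT': "T = insert s T'" "s \<notin> T'"
  proof -
    have "x < s" if "x \<in> T" "x \<noteq> s" for x
      using that adj[of x] by (cases "s < x") (auto simp: T_def defect_set_def)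
    then show "T = insert s T'" using s by (auto simp: T_def T'_def)
  qed (simp add: T'_def)
  have fin: "finite T'" by (simp add: T'_def)
  have card: "card T = Suc (card T')" using TT' fin by simp
  have "{r \<in> T. r \<le> s} = T" using TT' by (auto simp: T'_def)
  moreover have "card {r \<in> T. r \<le> u} = card {r \<in> T'. r \<le> u}" if "u \<in> T'" for u
  proof -
    have "{r \<in> T. r \<le> u} = {r \<in> T'. r \<le> u}" using that TT' by (auto simp: T'_def)
    then show ?thesis by simp
  qed
  ultimately have "(\<Sum>u\<in>T. scale (v ^ card {r \<in> T. r \<le> u}) (?U u))
      = scale (v ^ card T) (?U s) + (\<Sum>u\<in>T'. scale (v ^ card {r \<in> T'. r \<le> u}) (?U u))"
    using TT' fin by (simp add: sum.insert[of T' s])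
  moreover have "cvec v n (p(s := t, t := s)) up = ?U t - scale v (?U s)"
    using s t by (intro cvec_link_defects) (auto simp: defect_set_def)
  moreover have "scale (v ^ card T) (?U s) = scale (v * qint v (int (card T))) (?U s) - scale (qint v (int (card T'))) (?U s)"
    unfolding card qint_Suc[OF v] by (simp add: free.scale_left_distrib)
  ultimately show ?thesis
    unfolding raise_sum_def Let_def T_def[symmetric] T'_def[symmetric]
    by (simp add: free.scale_right_diff_distrib mult.commute)
qed

lemma defect_set_link:
  assumes "s \<in> defect_set n p" "t \<in> defect_set n p" "s < t"
  shows "card (defect_set n (p(s := t, t := s))) + 2 = card (defect_set n p)"
proof -
  have "defect_set n (p(s := t, t := s)) = defect_set n p - {s, t}"
    using assms by (auto simp: defect_set_def)
  moreover have "card (defect_set n p - {s, t}) = card (defect_set n p) - card {s, t}"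
    using assms by (intro card_Diff_subset) auto
  moreover have "card {s, t} \<le> card (defect_set n p)"
    using assms by (intro card_mono) auto
  ultimately show ?thesis using assms by simp
qed

lemma raise_sum_span:
  fixes v :: "'a::field"
  assumes v: "v \<noteq> 0" and p: "matching n p" and t: "t \<in> defect_set n p"
  shows "raise_sum v n p t
    \<in> free.span {cvec v n q up | q. matching n q \<and> card (defect_set n q) + 2 = card (defect_set n p)}"
  using t
proof (induction t rule: less_induct)
  case (less t)
  let ?T = "{s \<in> defect_set n p. s < t}"
  show ?case
  proof (cases "?T = {}")
    case True
    then have "raise_sum v n p t = 0" unfolding raise_sum_def Let_def True by (simp add: qint_def)
    then show ?thesis by (simp add: free.span_zero)
  next
    case False
    define s where "s = Max ?T"
    have s: "s \<in> ?T" unfolding s_def using False by (intro Max_in) auto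
    have adj: "p r \<noteq> 0" if "s < r" "r < t" for r
    proof
      assume "p r = 0"
      then have "r \<in> ?T" using that less.prems by (auto simp: defect_set_def)
      then have "r \<le> s" unfolding s_def by (intro Max_ge) auto
      then show False using that by simp
    qed
    have "matching n (p(s := t, t := s))"
      using s less.prems adj by (intro matching_link[OF p]) (auto simp: defect_set_def)
    then have "cvec v n (p(s := t, t := s)) up
      \<in> free.span {cvec v n q up | q. matching n q \<and> card (defect_set n q) + 2 = card (defect_set n p)}"
      using defect_set_link[of s n p t] s less.prems by (intro free.span_base) blast
    then show ?thesis
      using raise_sum_step[OF v p less.prems _ _ adj] s less.IH[of s]
      by (auto intro!: free.span_add free.span_scale)
  qed
qed

definition cell_basis :: "'a::field \<Rightarrow> nat \<Rightarrow> nat \<Rightarrow> (int list \<Rightarrow>\<^sub>0 'a) set" where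
  "cell_basis v n d = {cvec v n p up | p. matching n p \<and> card (defect_set n p) = d}"

definition mu_vectors :: "'a::field \<Rightarrow> nat \<Rightarrow> nat \<Rightarrow> (int list \<Rightarrow>\<^sub>0 'a) set" where
  "mu_vectors v n d = {mu v \<alpha> | \<alpha>. one_factor \<alpha> \<and> length \<alpha> = n \<and> sum_list \<alpha> = int d}"

lemma flinear_Phi1: "flinear Phi1"
  by (rule flinearI) (simp_all add: Phi1_def distrib_right scale_mult_left)

lemma flinear_Phi2: "flinear (Phi2 v)"
  unfolding Phi2_def by (rule flinear_lin)

lemma Phi1_cvec:
  assumes "matching n p"
  shows "Phi1 (cvec v n p up) = cvec v (Suc n) p up"
  using cvec_snoc[OF assms, of up v] by (simp add: Phi1_def)

lemma defect_set_Suc: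
  assumes "matching n p"
  shows "defect_set (Suc n) p = insert (Suc n) (defect_set n p)" "Suc n \<notin> defect_set n p"
  using matchingD(2)[OF assms, of "Suc n"] by (auto simp: defect_set_def le_Suc_eq)

lemma Phi2_homogeneous:
  assumes "\<And>w. w \<in> keys x \<Longrightarrow> sum_list w = d"
  shows "Phi2 v x = scale (qint v d) (x * y (-1)) - scale (v powi d) (F v x * y 1)"
proof (rule flinear_eq_on_keys[of "Phi2 v" "\<lambda>x. scale (qint v d) (x * y (-1)) - scale (v powi d) (F v x * y 1)"])
  show "flinear (\<lambda>x. scale (qint v d) (x * y (-1)) - scale (v powi d) (F v x * y 1))"
    by (rule flinearI) (simp_all add: flinear_add[OF flinear_F] flinear_scale[OF flinear_F]
        distrib_right scale_mult_left free.scale_right_distrib free.scale_right_diff_distrib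
        mult.left_commute mult.commute)
  fix w assume "w \<in> keys x"
  then show "Phi2 v (unit_vec w)
      = scale (qint v d) (unit_vec w * y (-1)) - scale (v powi d) (F v (unit_vec w) * y 1)"
    using assms by (simp add: Phi2_def yw_def)
qed (rule flinear_Phi2)

lemma Phi2_cvec:
  fixes v :: "'a::field"
  assumes v: "v \<noteq> 0" and p: "matching n p"
  shows "Phi2 v (cvec v n p up) = raise_sum v (Suc n) p (Suc n)"
proof -
  let ?D = "defect_set n p"
  let ?U = "\<lambda>t. cvec v (Suc n) p (up(t := -1))"
  have T: "{s \<in> defect_set (Suc n) p. s < Suc n} = ?D"
    unfolding defect_set_Suc[OF p] by (auto simp: defect_set_def)
  have last: "cvec v n p up * y (-1) = ?U (Suc n)"
  proof -
    have "cvec v n p (up(Suc n := -1)) = cvec v n p up" by (rule cvec_cong) simp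
    then show ?thesis using cvec_snoc[OF p, of "up(Suc n := -1)" v] by simp
  qed
  have low: "cvec v n p (up(t := -1)) * y 1 = ?U t" if "t \<in> ?D" for t
    using cvec_snoc[OF p, of "up(t := -1)" v] that by (auto simp: defect_set_def)
  have "Phi2 v (cvec v n p up) = scale (qint v (int (card ?D))) (?U (Suc n))
      - scale (v powi int (card ?D)) (lowered v n p * y 1)"
    using eta_coeff[OF v p] last by (subst Phi2_homogeneous[where d = "int (card ?D)"]) auto
  also have "scale (v powi int (card ?D)) (lowered v n p * y 1)
      = (\<Sum>t\<in>?D. scale (v ^ card {r \<in> ?D. r \<le> t}) (?U t))"
    unfolding lowered_def sum_distrib_right free.scale_sum_right
  proof (rule sum.cong[OF refl])
    fix t assume t: "t \<in> ?D"
    have "?D = {r \<in> ?D. r \<le> t} \<union> {r \<in> ?D. t < r}" by auto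
    moreover have "card ({r \<in> ?D. r \<le> t} \<union> {r \<in> ?D. t < r}) = card {r \<in> ?D. r \<le> t} + card {r \<in> ?D. t < r}"
      by (intro card_Un_disjoint) auto
    ultimately have "card ?D = card {r \<in> ?D. r \<le> t} + card {r \<in> ?D. t < r}" by simp
    then have "v powi int (card ?D) * v powi (- int (card {r \<in> ?D. t < r})) = v ^ card {r \<in> ?D. r \<le> t}"
      using v by (simp add: power_int_add[symmetric])
    then show "scale (v powi int (card ?D))
        (scale (v powi - int (card {s \<in> ?D. t < s})) (cvec v n p (up(t := - 1))) * y 1)
        = scale (v ^ card {r \<in> ?D. r \<le> t}) (?U t)"
      by (simp add: scale_mult_left low[OF t])
  qed
  finally show ?thesis
    unfolding raise_sum_def Let_def T .
qed

lemma Phi2_span: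
  fixes v :: "'a::field"
  assumes v: "v \<noteq> 0" and x: "x \<in> free.span (cell_basis v n (Suc d))"
  shows "Phi2 v x \<in> free.span (cell_basis v (Suc n) d)"
proof (rule flinear_span_subset[OF flinear_Phi2 _ x])
  fix z assume "z \<in> cell_basis v n (Suc d)"
  then obtain p where p: "matching n p" "card (defect_set n p) = Suc d" "z = cvec v n p up"
    by (auto simp: cell_basis_def)
  have P: "matching (Suc n) p" by (rule matching_mono[OF p(1)]) simp
  have "card (defect_set (Suc n) p) = d + 2"
    using defect_set_Suc[OF p(1)] p(2) by simp
  then have "raise_sum v (Suc n) p (Suc n) \<in> free.span (cell_basis v (Suc n) d)"
    using raise_sum_span[OF v P, of "Suc n"] defect_set_Suc(1)[OF p(1)] by (simp add: cell_basis_def)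
  then show "Phi2 v z \<in> free.span (cell_basis v (Suc n) d)"
    by (simp add: p(3) Phi2_cvec[OF v p(1)])
qed

lemma Phi1_span:
  assumes x: "x \<in> free.span (cell_basis v n d)"
  shows "Phi1 x \<in> free.span (cell_basis v (Suc n) (Suc d))"
proof (rule flinear_span_subset[OF flinear_Phi1 _ x])
  fix z assume "z \<in> cell_basis v n d"
  then obtain p where p: "matching n p" "card (defect_set n p) = d" "z = cvec v n p up"
    by (auto simp: cell_basis_def)
  have "matching (Suc n) p" by (rule matching_mono[OF p(1)]) simp
  moreover have "card (defect_set (Suc n) p) = Suc d"
    using defect_set_Suc[OF p(1)] p(2) by simp
  ultimately show "Phi1 z \<in> free.span (cell_basis v (Suc n) (Suc d))"
    unfolding p(3) Phi1_cvec[OF p(1)] cell_basis_def by (intro free.span_base) blast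
qed

lemma one_factor_snoc:
  "one_factor (\<alpha> @ [a]) \<longleftrightarrow> one_factor \<alpha> \<and> (a = 1 \<or> a = -1 \<and> sum_list \<alpha> \<ge> 1)"
proof -
  have "(\<forall>i\<le>length (\<alpha> @ [a]). 0 \<le> sum_list (take i (\<alpha> @ [a])))
      \<longleftrightarrow> (\<forall>i\<le>length \<alpha>. 0 \<le> sum_list (take i \<alpha>)) \<and> 0 \<le> sum_list \<alpha> + a"
    by (auto simp: le_Suc_eq)
  moreover have "0 \<le> sum_list \<alpha>" if "one_factor \<alpha>"
    using that unfolding one_factor_def by force
  ultimately show ?thesis unfolding one_factor_def by auto
qed

lemma mu_snoc: "mu v (\<alpha> @ [a]) = (if a = 1 then Phi1 else Phi2 v) (mu v \<alpha>)"
  by (simp add: mu_def)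

lemma mu_in_span_cell_basis:
  fixes v :: "'a::field"
  assumes v: "v \<noteq> 0"
  shows "one_factor \<alpha> \<Longrightarrow> sum_list \<alpha> = int d \<Longrightarrow> mu v \<alpha> \<in> free.span (cell_basis v (length \<alpha>) d)"
proof (induction \<alpha> arbitrary: d rule: rev_induct)
  case Nil
  have "matching 0 (\<lambda>_. 0)" by (simp add: matching_def)
  moreover have "card (defect_set 0 (\<lambda>_. 0)) = 0" by (simp add: defect_set_def)
  moreover have "mu v [] = cvec v 0 (\<lambda>_. 0) up"
    by (simp add: mu_def cvec_def vec_def words_def word_coeff_def yw_Nil[symmetric] yw_def cong: conj_cong)
  ultimately show ?case using Nil unfolding cell_basis_def by (intro free.span_base) auto
next
  case (snoc a \<alpha>)
  then have \<alpha>: "one_factor \<alpha>" and a: "a = 1 \<or> a = -1 \<and> sum_list \<alpha> \<ge> 1"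
    by (simp_all add: one_factor_snoc)
  have pos: "0 \<le> sum_list \<alpha>" using \<alpha> unfolding one_factor_def by force
  from a show ?case
  proof
    assume a: "a = 1"
    then obtain d' where "d = Suc d'" "sum_list \<alpha> = int d'"
      using snoc.prems pos by (cases d) auto
    then show ?thesis
      using snoc.IH[OF \<alpha>] Phi1_span a by (simp add: mu_snoc)
  next
    assume a: "a = -1 \<and> sum_list \<alpha> \<ge> 1"
    then have "sum_list \<alpha> = int (Suc d)" using snoc.prems by simp
    then show ?thesis
      using snoc.IH[OF \<alpha>] Phi2_span[OF v] a by (simp add: mu_snoc)
  qed
qed

lemma Phi1_mu:
  assumes "x \<in> free.span (mu_vectors v n d)"
  shows "Phi1 x \<in> free.span (mu_vectors v (Suc n) (Suc d))"
proof (rule flinear_span_subset[OF flinear_Phi1 _ assms])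
  fix z assume "z \<in> mu_vectors v n d"
  then obtain \<alpha> where \<alpha>: "z = mu v \<alpha>" "one_factor \<alpha>" "length \<alpha> = n" "sum_list \<alpha> = int d"
    by (auto simp: mu_vectors_def)
  then have "Phi1 z = mu v (\<alpha> @ [1])" "one_factor (\<alpha> @ [1])"
    by (simp_all add: mu_snoc one_factor_snoc)
  then show "Phi1 z \<in> free.span (mu_vectors v (Suc n) (Suc d))"
    using \<alpha> unfolding mu_vectors_def by (intro free.span_base CollectI exI[of _ "\<alpha> @ [1]"]) auto
qed

lemma Phi2_mu:
  assumes "x \<in> free.span (mu_vectors v n (Suc d))"
  shows "Phi2 v x \<in> free.span (mu_vectors v (Suc n) d)"
proof (rule flinear_span_subset[OF flinear_Phi2 _ assms])
  fix z assume "z \<in> mu_vectors v n (Suc d)"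
  then obtain \<alpha> where \<alpha>: "z = mu v \<alpha>" "one_factor \<alpha>" "length \<alpha> = n" "sum_list \<alpha> = int (Suc d)"
    by (auto simp: mu_vectors_def)
  then have "Phi2 v z = mu v (\<alpha> @ [-1])" "one_factor (\<alpha> @ [-1])"
    by (simp_all add: mu_snoc one_factor_snoc)
  then show "Phi2 v z \<in> free.span (mu_vectors v (Suc n) d)"
    using \<alpha> unfolding mu_vectors_def by (intro free.span_base CollectI exI[of _ "\<alpha> @ [-1]"]) auto
qed

text \<open>
  A diagram in which the last vertex is linked to \<open>t\<close> is recovered from the one in which this link is cut
  and the last vertex removed: by \<open>raise_sum_step\<close> the image of the latter under \<open>\<Phi>\<^sub>2\<close> is a nonzero multiple
  of the wanted vector plus vectors whose last vertex is a defect, which are images under \<open>\<Phi>\<^sub>1\<close>.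
\<close>

lemma cvec_in_span_mu:
  fixes v :: "'a::field"
  assumes v: "v \<noteq> 0"
  shows "(\<And>k. 1 \<le> k \<Longrightarrow> k \<le> n \<Longrightarrow> qint v (int k) \<noteq> 0) \<Longrightarrow> matching n p \<Longrightarrow>
    cvec v n p up \<in> free.span (mu_vectors v n (card (defect_set n p)))"
proof (induction n arbitrary: p)
  case 0
  have "cvec v 0 p up = mu v []"
    by (simp add: mu_def cvec_def vec_def words_def word_coeff_def yw_Nil[symmetric] yw_def cong: conj_cong)
  moreover have "mu v [] \<in> mu_vectors v 0 (card (defect_set 0 p))"
    unfolding mu_vectors_def by (intro CollectI exI[of _ "[]"]) (simp add: one_factor_def defect_set_def)
  ultimately show ?case by (simp add: free.span_base)
next
  case (Suc n)
  note p = Suc.prems(2)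
  have IH: "cvec v n q up \<in> free.span (mu_vectors v n (card (defect_set n q)))" if "matching n q" for q
    using Suc.IH[OF _ that] Suc.prems(1) by simp
  show ?case
  proof (cases "p (Suc n) = 0")
    case True
    then have pn: "matching n p" using matching_restrict[OF p] by blast
    have "card (defect_set (Suc n) p) = Suc (card (defect_set n p))"
      using defect_set_Suc[OF pn] by simp
    then show ?thesis
      using Phi1_mu[OF IH[OF pn]] by (simp add: Phi1_cvec[OF pn])
  next
    case False
    define t where "t = p (Suc n)"
    define q where "q = p(t := 0, Suc n := 0)"
    have pt: "p t = Suc n" and tn: "t \<noteq> Suc n" "1 \<le> t" "t \<le> n"
      using matchingD(3,4)[OF p, of "Suc n"] matching_le[OF p, of "Suc n"] False by (auto simp: t_def le_Suc_eq)
    have q: "matching n q"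
      unfolding q_def by (rule matching_cut[OF p t_def]) (use False in \<open>simp add: t_def\<close>)
    have Q: "matching (Suc n) q" by (rule matching_mono[OF q]) simp
    have tD: "t \<in> defect_set (Suc n) q" "t \<in> defect_set n q" "Suc n \<in> defect_set (Suc n) q"
      using tn by (auto simp: defect_set_def q_def)
    \<comment> \<open>Nothing beneath a link is a defect, so \<open>t\<close> is the last defect of \<open>q\<close> before \<open>Suc n\<close>.\<close>
    have adj: "q r \<noteq> 0" if "t < r" "r < Suc n" for r
      using matchingD(5)[OF p, of t r] pt that by (auto simp: q_def)
    have relinked: "q(t := Suc n, Suc n := t) = p"
      using pt by (auto simp: q_def t_def fun_eq_iff)
    let ?d = "card (defect_set n q)"
    let ?M = "free.span (mu_vectors v (Suc n) (card (defect_set (Suc n) p)))"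
    have D: "{s \<in> defect_set (Suc n) q. s < Suc n} = defect_set n q"
      unfolding defect_set_Suc[OF q] by (auto simp: defect_set_def)
    have step: "Phi2 v (cvec v n q up) = scale (qint v (int ?d)) (cvec v (Suc n) p up) + raise_sum v (Suc n) q t"
      unfolding Phi2_cvec[OF v q]
      using raise_sum_step[OF v Q tD(3) tD(1) _ adj] tn D relinked by simp
    have raise: "raise_sum v (Suc n) q t = Phi1 (raise_sum v n q t)"
    proof -
      have T: "{s \<in> defect_set (Suc n) q. s < t} = {s \<in> defect_set n q. s < t}"
        unfolding defect_set_Suc[OF q] using tn by auto
      have "cvec v (Suc n) q (up(s := -1)) = Phi1 (cvec v n q (up(s := -1)))" if "s \<le> n" for s
        using cvec_snoc[OF q, of "up(s := -1)" v] that by (simp add: Phi1_def)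
      then show ?thesis
        unfolding raise_sum_def Let_def T flinear_diff[OF flinear_Phi1] flinear_scale[OF flinear_Phi1]
          flinear_sum[OF flinear_Phi1]
        using tn by (intro arg_cong2[of _ _ _ _ "(-)"] sum.cong) auto
    qed
    have dp: "?d = Suc (card (defect_set (Suc n) p))"
    proof -
      have "card (defect_set (Suc n) p) + 2 = card (defect_set (Suc n) q)"
        using defect_set_link[OF tD(1,3)] tn relinked by simp
      then show ?thesis using defect_set_Suc[OF q] by simp
    qed
    have "Phi2 v (cvec v n q up) \<in> ?M"
      by (rule Phi2_mu) (use IH[OF q] dp in simp)
    moreover have "Phi1 (raise_sum v n q t) \<in> ?M"
    proof (rule flinear_span_subset[OF flinear_Phi1 _ raise_sum_span[OF v q tD(2)]])
      fix z assume "z \<in> {cvec v n r up | r. matching n r \<and> card (defect_set n r) + 2 = ?d}"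
      then obtain r where r: "z = cvec v n r up" "matching n r" "card (defect_set n r) + 2 = ?d" by blast
      then show "Phi1 z \<in> ?M"
        using Phi1_mu[OF IH[OF r(2)]] dp by (simp add: eval_nat_numeral)
    qed
    ultimately have "scale (qint v (int ?d)) (cvec v (Suc n) p up)
        \<in> ?M"
      using step raise free.span_diff by (metis add_diff_cancel_right')
    then have "scale (inverse (qint v (int ?d))) (scale (qint v (int ?d)) (cvec v (Suc n) p up))
        \<in> ?M"
      by (rule free.span_scale)
    moreover have "qint v (int ?d) \<noteq> 0"
    proof (rule Suc.prems(1))
      have "?d \<le> card {1..n}" by (intro card_mono) (auto simp: defect_set_def)
      then show "?d \<le> Suc n" by simp
    qed (use dp in simp)
    ultimately show ?thesis by simp
  qed
qed

lemma cell_space_eq: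
  fixes v :: "'a::field"
  assumes v: "v \<noteq> 0" and fact: "qfact v n \<noteq> 0" and l: "l2 \<le> l1" "l1 + l2 = n"
  shows "cell_space v (l1, l2) = free.span (cell_basis v n (l1 - l2))"
proof -
  have sum: "sum_list \<alpha> = int (length \<alpha>) - 2 * int (count_list \<alpha> (-1))" if "set \<alpha> \<subseteq> {1, -1 :: int}" for \<alpha>
    using that by (induction \<alpha>) auto
  have count: "count_list \<alpha> (-1) \<le> length \<alpha>" for \<alpha> :: "int list"
    by (induction \<alpha>) auto
  have "one_factor \<alpha> \<and> shape \<alpha> = (l1, l2) \<longleftrightarrow> one_factor \<alpha> \<and> length \<alpha> = n \<and> sum_list \<alpha> = int (l1 - l2)" for \<alpha>
    using sum[of \<alpha>] count[of \<alpha>] l by (auto simp: one_factor_def shape_def)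
  then have cell: "cell_space v (l1, l2) = free.span (mu_vectors v n (l1 - l2))"
    by (simp add: cell_space_def mu_vectors_def)
  have q: "qint v (int k) \<noteq> 0" if "1 \<le> k" "k \<le> n" for k
    using fact that by (auto simp: qfact_def)
  show ?thesis
    unfolding cell
  proof (intro equalityI free.span_minimal free.subspace_span)
    show "mu_vectors v n (l1 - l2) \<subseteq> free.span (cell_basis v n (l1 - l2))"
      using mu_in_span_cell_basis[OF v] by (auto simp: mu_vectors_def)
    show "cell_basis v n (l1 - l2) \<subseteq> free.span (mu_vectors v n (l1 - l2))"
    proof
      fix z assume "z \<in> cell_basis v n (l1 - l2)"
      then obtain p where p: "z = cvec v n p up" "matching n p" "card (defect_set n p) = l1 - l2"
        by (auto simp: cell_basis_def)
      show "z \<in> free.span (mu_vectors v n (l1 - l2))"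
        using cvec_in_span_mu[OF v _ p(2)] q unfolding p(1) p(3)[symmetric] by blast
    qed
  qed
qed

section \<open>The isomorphism\<close>

text \<open>
  For \<open>\<sigma> = -1\<close> this is \<open>-1\<close> to the sum of the right endpoints of the links.
\<close>

definition link_sign :: "'a::field \<Rightarrow> nat \<Rightarrow> (nat \<Rightarrow> nat) \<Rightarrow> 'a" where
  "link_sign \<sigma> n p = (\<Prod>x\<in>{1..n}. if x < p x then \<sigma> ^ p x else 1)"

lemma vec_coeff_sign:
  "vec n (\<lambda>w. word_coeff \<sigma> v n p up (letter w)) = scale (link_sign \<sigma> n p) (cvec v n p up)"
  unfolding cvec_def scale_vec
  by (rule vec_cong)
    (auto simp: word_coeff_def link_sign_def vertex_factor_def prod.distrib[symmetric] intro!: prod.cong)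

lemma edot_signed:
  fixes v \<sigma> :: "'a::field"
  assumes p: "matching n p" and i: "1 \<le> i" "i < n" and v: "v \<noteq> 0" and \<sigma>: "\<sigma> = 1 \<or> \<sigma> = -1"
  defines "B \<equiv> \<lambda>p. vec n (\<lambda>w. word_coeff \<sigma> v n p up (letter w))"
  shows "scale \<sigma> (edot v i (B p)) = (if p i = i + 1 then scale (- \<sigma> * (v + inverse v)) (B p)
     else if p i = 0 \<and> p (i + 1) = 0 then 0 else B (e_link i p))"
proof -
  have look: "lookup (B p) (w[i - 1 := r, i := s]) = word_coeff \<sigma> v n p up ((letter w)(i := r, i + 1 := s))"
    if w: "w \<in> words n" and rs: "r \<in> {1, -1}" "s \<in> {1, -1}" for w r s
  proof -
    have "set (w[i - 1 := r, i := s]) \<subseteq> insert s (insert r (set w))"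
      by (meson set_update_subset_insert subset_insertI2 insert_mono order_trans)
    then have "w[i - 1 := r, i := s] \<in> words n" using w rs by (auto simp: words_def)
    moreover have "word_coeff \<sigma> v n p up (letter (w[i - 1 := r, i := s])) = word_coeff \<sigma> v n p up ((letter w)(i := r, i + 1 := s))"
    proof (rule word_coeff_cong[OF p])
      fix x assume x: "1 \<le> x" "x \<le> n"
      have "length w = n" using w by (simp add: words_def)
      then show "letter (w[i - 1 := r, i := s]) x = ((letter w)(i := r, i + 1 := s)) x"
        using x i by (auto simp: letter_def nth_list_update)
    qed
    ultimately show ?thesis by (simp add: B_def lookup_vec)
  qed
  have "scale \<sigma> (edot v i (B p)) = vec n (\<lambda>w. \<sigma> * (pair_coeff v (letter w i) (letter w (i + 1)) *
      (word_coeff \<sigma> v n p up ((letter w)(i := -1, i + 1 := 1))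
        - inverse v * word_coeff \<sigma> v n p up ((letter w)(i := 1, i + 1 := -1)))))"
  proof -
    have "keys (B p) \<subseteq> words n" unfolding B_def by (rule keys_vec)
    note edot = edot_eq_vec[OF v i this]
    have signs: "-1 \<in> {1, -1 :: int}" "1 \<in> {1, -1 :: int}" by simp_all
    show ?thesis
      unfolding edot scale_vec
    proof (rule vec_cong)
      fix w assume w: "w \<in> words n"
      show "\<sigma> * (pair_coeff v (w ! (i - 1)) (w ! i) *
          (lookup (B p) (w[i - 1 := -1, i := 1])
            - inverse v * lookup (B p) (w[i - 1 := 1, i := -1])))
        = \<sigma> * (pair_coeff v (letter w i) (letter w (i + 1)) *
          (word_coeff \<sigma> v n p up ((letter w)(i := -1, i + 1 := 1))
            - inverse v * word_coeff \<sigma> v n p up ((letter w)(i := 1, i + 1 := -1))))"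
        unfolding look[OF w signs] look[OF w signs(2,1)] letter_def add_diff_cancel_right' ..
    qed
  qed
  also have "\<dots> = (if p i = i + 1 then scale (- \<sigma> * (v + inverse v)) (B p)
     else if p i = 0 \<and> p (i + 1) = 0 then 0 else B (e_link i p))"
  proof -
    have W: "letter w x = 1 \<or> letter w x = -1" if "w \<in> words n" "1 \<le> x" "x \<le> n" for w x
    proof -
      have "letter w x \<in> set w"
        unfolding letter_def using that by (intro nth_mem) (auto simp: words_def)
      then show ?thesis using that by (auto simp: words_def)
    qed
    note C = word_coeff_e_link[OF p i v \<sigma> W]
    consider "p i = i + 1" | "p i \<noteq> i + 1" "p i = 0" "p (i + 1) = 0"
      | "p i \<noteq> i + 1" "\<not> (p i = 0 \<and> p (i + 1) = 0)" by metis
    then show ?thesis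
    proof cases
      case 1
      then show ?thesis
        unfolding if_P[OF 1] B_def scale_vec by (intro vec_cong C(1))
    next
      case 2
      then show ?thesis
        using C(2) by (simp add: vec_zero[symmetric, of n] del: One_nat_def) (intro vec_cong, simp)
    next
      case 3
      then show ?thesis
        unfolding if_not_P[OF 3(1)] if_not_P[OF 3(2)] B_def by (intro vec_cong C(3))
    qed
  qed
  finally show ?thesis .
qed

lemma word_coeff_seq_of:
  assumes "matching n p"
  shows "word_coeff 1 v n p up (letter (seq_of n p)) = 1"
  unfolding word_coeff_def
proof (rule prod.neutral, rule ballI)
  fix x assume x: "x \<in> {1..n}"
  have s: "letter (seq_of n p) z = sgn_of p z" if "1 \<le> z" "z \<le> n" for z
    using nth_seq_of[OF that] by (simp add: letter_def)
  show "vertex_factor 1 v up (letter (seq_of n p)) x (p x) = 1"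
    using x s[of x] s[of "p x"] matching_le[OF assms, of x] matchingD(3)[OF assms, of x]
    by (auto simp: vertex_factor_def pair_coeff_def sgn_of_def)
qed

text \<open>
  At the first position where \<open>w\<close> differs from the 1-factor there can be neither a defect, where the letter
  is prescribed, nor a right endpoint, where the letter is determined by the earlier one at the left
  endpoint. So it is a left endpoint, and \<open>w\<close> has the smaller letter \<open>-1\<close> there.
\<close>

lemma word_coeff_triangular:
  assumes p: "matching n p" and w: "w \<in> words n" and nz: "word_coeff 1 v n p up (letter w) \<noteq> 0"
  shows "w \<le> seq_of n p"
proof (cases "w = seq_of n p")
  case False
  have lw: "length w = n" using w by (simp add: words_def)
  have s: "letter (seq_of n p) z = sgn_of p z" if "1 \<le> z" "z \<le> n" for z
    using nth_seq_of[OF that] by (simp add: letter_def)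
  define D where "D k \<longleftrightarrow> k < n \<and> w ! k \<noteq> seq_of n p ! k" for k
  have "\<exists>k. D k" using False lw unfolding D_def by (metis length_seq_of nth_equalityI)
  define k where "k = (LEAST k. D k)"
  have k: "k < n" "w ! k \<noteq> seq_of n p ! k"
    using LeastI_ex[OF \<open>\<exists>k. D k\<close>] by (auto simp: k_def D_def)
  have before: "w ! j = seq_of n p ! j" if "j < k" for j
    using not_less_Least[of j D] that k by (auto simp: k_def D_def)
  define x where "x = k + 1"
  have x: "1 \<le> x" "x \<le> n" "letter w x \<noteq> sgn_of p x"
    using k s[of x] by (auto simp: x_def letter_def)
  have bef: "letter w z = sgn_of p z" if "1 \<le> z" "z < x" for z
    using before[of "z - 1"] s[of z] that x by (auto simp: x_def letter_def)
  have factors: "vertex_factor 1 v up (letter w) z (p z) \<noteq> 0" if "1 \<le> z" "z \<le> n" for z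
    using nz that unfolding word_coeff_def by (auto simp: prod_zero_iff)
  have px: "x < p x"
  proof (rule ccontr)
    assume "\<not> x < p x"
    then consider "p x = 0" | "p x \<noteq> 0" "p x < x" using matching_neq[OF p, of x] by blast
    then show False
    proof cases
      case 1
      then show False using factors[OF x(1,2)] x(3) by (simp add: vertex_factor_def sgn_of_def)
    next
      case 2
      then have pp: "p (p x) = x" using matchingD(3)[OF p] by blast
      then have "letter w (p x) = 1" using bef[of "p x"] 2 by (simp add: sgn_of_def)
      moreover have "pair_coeff v (letter w (p x)) (letter w x) \<noteq> 0"
        using factors[of "p x"] 2 pp x by (simp add: vertex_factor_def)
      ultimately show False using x(3) 2 by (simp add: pair_coeff_def sgn_of_def split: if_splits)
    qed
  qed
  then have "letter w x = -1"
    using factors[OF x(1,2)] x(3) by (simp add: vertex_factor_def pair_coeff_def sgn_of_def split: if_splits)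
  then have "w ! k < seq_of n p ! k"
    using px s[of x] x by (simp add: x_def letter_def sgn_of_def)
  moreover have "take k w = take k (seq_of n p)"
    using before k lw by (intro nth_take_lemma) auto
  ultimately have "(w, seq_of n p) \<in> lexord {(u, v). u < v}"
    unfolding lexord_take_index_conv using k lw by auto
  then show ?thesis by (simp add: list_less_def order.strict_implies_order)
qed simp

lemma seq_of_in_words: "seq_of n p \<in> words n"
  by (auto simp: words_def seq_of_def sgn_of_def)

lemma link_sign_nonzero: "\<sigma> \<noteq> 0 \<Longrightarrow> link_sign \<sigma> n p \<noteq> 0"
  by (simp add: link_sign_def prod_zero_iff)

text \<open>
  Diagrams with a number of defects different from \<open>d\<close> are sent to \<open>0\<close>; on diagrams with at most \<open>d\<close>
  defects the kernel then consists of those with fewer than \<open>d\<close>.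
\<close>

definition link_map :: "'a::field \<Rightarrow> 'a \<Rightarrow> nat \<Rightarrow> nat \<Rightarrow>
    ((nat \<times> nat) set \<Rightarrow>\<^sub>0 'a) \<Rightarrow> (int list \<Rightarrow>\<^sub>0 'a)" where
  "link_map \<sigma> v n d = lin (\<lambda>l. let p = inv_into {p. matching n p} links_of l in
     if num_defects n p = d then scale (link_sign \<sigma> n p) (cvec v n p up) else 0)"

lemma flinear_link_map: "flinear (link_map \<sigma> v n d)"
  unfolding link_map_def by (rule flinear_lin)

lemma link_map_single:
  assumes "matching n p"
  shows "link_map \<sigma> v n d (single (links_of p) c)
    = (if num_defects n p = d then scale c (scale (link_sign \<sigma> n p) (cvec v n p up)) else 0)"
proof -
  have "inj_on links_of {p. matching n p}" by (rule inj_onI) (auto intro: links_of_inj)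
  then have "inv_into {p. matching n p} links_of (links_of p) = p"
    using assms by (intro inv_into_f_f) auto
  then show ?thesis by (simp add: link_map_def Let_def)
qed

lemma link_map_equivariant:
  fixes v \<sigma> :: "'a::field"
  assumes i: "i \<in> {1..<n}" and v: "v \<noteq> 0" and \<sigma>: "\<sigma> = 1 \<or> \<sigma> = -1"
    and x: "x \<in> link_span n (\<lambda>k. k \<le> d)"
  shows "link_map \<sigma> v n d (e_act n (- \<sigma> * (v + inverse v)) i x) = scale \<sigma> (edot v i (link_map \<sigma> v n d x))"
proof -
  let ?h = "link_map \<sigma> v n d" and ?e = "- \<sigma> * (v + inverse v)"
  have edot: "flinear (edot v i)" unfolding edot_def by (rule flinear_lin)
  have right: "flinear (\<lambda>x. scale \<sigma> (edot v i (?h x)))"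
    by (rule flinearI) (simp_all add: flinear_add[OF edot] flinear_scale[OF edot]
        flinear_add[OF flinear_link_map] flinear_scale[OF flinear_link_map] free.scale_right_distrib
        mult.commute)
  show ?thesis
  proof (rule link_span_eq_on[OF x flinear_compose[OF flinear_link_map flinear_e_act] right])
    fix p assume p: "matching n p" and d: "num_defects n p \<le> d"
    have i': "1 \<le> i" "i < n" using i by auto
    note J = matching_e_link[OF p i']
    note E = edot_signed[OF p i' v \<sigma>, unfolded vec_coeff_sign]
    show "?h (e_act n ?e i (unit_vec (links_of p))) = scale \<sigma> (edot v i (?h (unit_vec (links_of p))))"
    proof (cases "num_defects n p = d")
      case False
      then have "num_defects n (e_link i p) \<noteq> d" using num_defects_e_link_le[OF p i'] d by simp
      then show ?thesis
        using False by (simp add: e_act_single[OF p i'] link_map_single[OF p] link_map_single[OF J]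
            flinear_zero[OF edot])
    next
      case True
      consider "p i = i + 1" | "p i \<noteq> i + 1" "p i = 0" "p (i + 1) = 0"
        | "p i \<noteq> i + 1" "\<not> (p i = 0 \<and> p (i + 1) = 0)" by metis
      then show ?thesis
      proof cases
        case 1
        then show ?thesis
          using E True by (simp only: e_act_single[OF p i'] e_link_loop[OF p i'(1) 1] link_map_single[OF p]
              if_True simp_thms mult_1_left free.scale_one)
      next
        case 2
        then have "num_defects n (e_link i p) \<noteq> d" using num_defects_e_link(2)[OF p i'] True by auto
        then show ?thesis
          using E True 2 by (simp add: e_act_single[OF p i'] link_map_single[OF p] link_map_single[OF J])
      next
        case 3
        then have "num_defects n (e_link i p) = d" using num_defects_e_link(1)[OF p i'] True by auto
        then show ?thesis
          using E True 3 by (simp only: e_act_single[OF p i'] link_map_single[OF p] link_map_single[OF J]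
              if_True if_False simp_thms mult_1_left free.scale_one)
      qed
    qed
  qed
qed

lemma link_map_image:
  fixes v \<sigma> :: "'a::field"
  assumes \<sigma>: "\<sigma> \<noteq> 0"
  shows "link_map \<sigma> v n d ` link_span n (\<lambda>k. k \<le> d) = free.span (cell_basis v n d)"
proof
  show "link_map \<sigma> v n d ` link_span n (\<lambda>k. k \<le> d) \<subseteq> free.span (cell_basis v n d)"
  proof (rule image_subsetI)
    fix x :: "(nat \<times> nat) set \<Rightarrow>\<^sub>0 'a"
    assume x: "x \<in> link_span n (\<lambda>k. k \<le> d)"
    show "link_map \<sigma> v n d x \<in> free.span (cell_basis v n d)"
    proof (rule flinear_span_subset[OF flinear_link_map _ x[unfolded link_span_def]])
      fix z :: "(nat \<times> nat) set \<Rightarrow>\<^sub>0 'a"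
      assume "z \<in> {unit_vec l | l. l \<in> link_diagrams n \<and> card (defects n l) \<le> d}"
      then obtain p where "matching n p" "z = unit_vec (links_of p)" by (auto simp: link_diagrams_eq)
      then show "link_map \<sigma> v n d z \<in> free.span (cell_basis v n d)"
      proof (cases "num_defects n p = d")
        case True
        then have "cvec v n p up \<in> free.span (cell_basis v n d)"
          using \<open>matching n p\<close> by (intro free.span_base) (auto simp: cell_basis_def num_defects_def)
        then show ?thesis
          using True \<open>matching n p\<close> \<open>z = _\<close> by (simp add: link_map_single free.span_scale)
      qed (simp add: \<open>z = _\<close> link_map_single[OF \<open>matching n p\<close>] free.span_zero)
    qed
  qed
  have sub: "free.subspace (link_map \<sigma> v n d ` link_span n (\<lambda>k. k \<le> d))"
    unfolding link_span_def by (rule module_hom.subspace_image[OF flinear_link_map free.subspace_span])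
  show "free.span (cell_basis v n d) \<subseteq> link_map \<sigma> v n d ` link_span n (\<lambda>k. k \<le> d)"
  proof (rule free.span_minimal[OF _ sub], rule subsetI)
    fix z assume "z \<in> cell_basis v n d"
    then obtain p where p: "matching n p" "num_defects n p = d" "z = cvec v n p up"
      by (auto simp: cell_basis_def num_defects_def)
    let ?x = "single (links_of p) (inverse (link_sign \<sigma> n p))"
    have "link_map \<sigma> v n d ?x = z"
      using p link_sign_nonzero[OF \<sigma>, of n p] by (simp add: link_map_single)
    moreover have "?x \<in> link_span n (\<lambda>k. k \<le> d)"
      using p by (auto simp: link_span_eq)
    ultimately show "z \<in> link_map \<sigma> v n d ` link_span n (\<lambda>k. k \<le> d)" by (metis image_eqI)
  qed
qed

text \<open>
  In a vector of the kernel, consider among the diagrams with \<open>d\<close> defects that occur the one with the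
  largest 1-factor. By triangularity no other one contributes to the coefficient at this word.
\<close>

lemma link_map_kernel:
  fixes v \<sigma> :: "'a::field"
  assumes \<sigma>: "\<sigma> \<noteq> 0"
  shows "{x \<in> link_span n (\<lambda>k. k \<le> d). link_map \<sigma> v n d x = 0} = link_span n (\<lambda>k. k < d)"
proof (intro equalityI subsetI)
  fix x :: "(nat \<times> nat) set \<Rightarrow>\<^sub>0 'a"
  assume x: "x \<in> link_span n (\<lambda>k. k < d)"
  have "link_map \<sigma> v n d x = 0"
    by (rule link_span_eq_on[OF x flinear_link_map, of "\<lambda>_. 0"])
      (auto intro!: flinearI simp: link_map_single)
  moreover have "x \<in> link_span n (\<lambda>k. k \<le> d)"
    using x by (force simp: link_span_eq)
  ultimately show "x \<in> {x \<in> link_span n (\<lambda>k. k \<le> d). link_map \<sigma> v n d x = 0}" by simp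
next
  fix x :: "(nat \<times> nat) set \<Rightarrow>\<^sub>0 'a"
  assume "x \<in> {x \<in> link_span n (\<lambda>k. k \<le> d). link_map \<sigma> v n d x = 0}"
  then have x: "keys x \<subseteq> links_of ` {p. matching n p \<and> num_defects n p \<le> d}"
    and zero: "link_map \<sigma> v n d x = 0" by (simp_all add: link_span_eq)
  define K where "K = {p. matching n p \<and> num_defects n p = d \<and> links_of p \<in> keys x}"
  have "K = {}"
  proof (rule ccontr)
    assume "K \<noteq> {}"
    have "inj_on links_of K" by (rule inj_onI) (auto simp: K_def intro: links_of_inj)
    moreover have "links_of ` K \<subseteq> keys x" by (auto simp: K_def)
    ultimately have "finite K" by (meson finite_imageD finite_keys finite_subset)
    define m where "m = Max (seq_of n ` K)"
    have "m \<in> seq_of n ` K" unfolding m_def using \<open>finite K\<close> \<open>K \<noteq> {}\<close> by (intro Max_in) auto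
    then obtain q where q: "q \<in> K" "m = seq_of n q" by blast
    have max: "seq_of n p \<le> seq_of n q" if "p \<in> K" for p
      unfolding q(2)[symmetric] m_def using \<open>finite K\<close> that by (intro Max_ge) auto
    have mq: "matching n q" using q by (simp add: K_def)
    let ?w = "seq_of n q"
    have other: "lookup (link_map \<sigma> v n d (unit_vec l)) ?w = 0"
      if l: "l \<in> keys x" "l \<noteq> links_of q" for l
    proof -
      obtain p where p: "matching n p" "l = links_of p" using l(1) x by blast
      show ?thesis
      proof (cases "num_defects n p = d")
        case True
        then have "p \<in> K" "p \<noteq> q" using p l by (auto simp: K_def)
        have "word_coeff 1 v n p up (letter ?w) = 0"
        proof (rule ccontr)
          assume "word_coeff 1 v n p up (letter ?w) \<noteq> 0"
          from word_coeff_triangular[OF p(1) seq_of_in_words this] max[OF \<open>p \<in> K\<close>]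
          have "seq_of n q = seq_of n p" by simp
          then show False using seq_of_inj[OF mq p(1)] \<open>p \<noteq> q\<close> by simp
        qed
        then show ?thesis by (simp add: p link_map_single cvec_def lookup_vec)
      qed (simp add: p link_map_single)
    qed
    have lq: "links_of q \<in> keys x" using q by (simp add: K_def)
    have expand: "link_map \<sigma> v n d x = (\<Sum>l\<in>keys x.
        scale (lookup x l) (link_map \<sigma> v n d (unit_vec l)))"
      by (simp add: link_map_def lin_def)
    have "0 = lookup (link_map \<sigma> v n d x) ?w" by (simp only: zero lookup_zero)
    also have "\<dots> = (\<Sum>l\<in>keys x. lookup x l *
        lookup (link_map \<sigma> v n d (unit_vec l)) ?w)"
      by (simp only: expand lookup_sum lookup_scale)
    also have "\<dots> = lookup x (links_of q) *
        lookup (link_map \<sigma> v n d (unit_vec (links_of q))) ?w"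
      using lq other by (subst sum.remove[OF finite_keys lq]) simp
    also have "lookup (link_map \<sigma> v n d (unit_vec (links_of q))) ?w = link_sign \<sigma> n q"
      using q mq by (simp add: K_def link_map_single cvec_def lookup_vec seq_of_in_words word_coeff_seq_of)
    finally show False
      using lq link_sign_nonzero[OF \<sigma>] by (simp add: in_keys_iff)
  qed
  show "x \<in> link_span n (\<lambda>k. k < d)"
    unfolding link_span_eq
  proof (intro CollectI subsetI)
    fix l assume l: "l \<in> keys x"
    then obtain p where p: "l = links_of p" "matching n p" "num_defects n p \<le> d" using x by blast
    moreover have "num_defects n p \<noteq> d" using \<open>K = {}\<close> p l by (auto simp: K_def)
    ultimately show "l \<in> links_of ` {p. matching n p \<and> num_defects n p < d}" by simp
  qed
qed

lemma link_module_iso_signed: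
  fixes v \<sigma> :: "'a::field"
  assumes v: "v \<noteq> 0" and fact: "qfact v n \<noteq> 0" and l: "l2 \<le> l1" "l1 + l2 = n"
    and \<sigma>: "\<sigma> = 1 \<or> \<sigma> = -1"
  defines "\<epsilon> \<equiv> - \<sigma> * (v + inverse v)" and "d \<equiv> l1 - l2"
  shows "\<exists>\<phi>. (\<forall>p. matching n p \<longrightarrow> num_defects n p = d \<longrightarrow>
        \<phi> (link_class n \<epsilon> d (links_of p)) = scale (link_sign \<sigma> n p) (eta v (seq_of n p)))
    \<and> left_module_iso (TL n \<epsilon>) (link_module n \<epsilon> d)
        (tl_module (\<lambda>i x. scale \<sigma> (edot v i x)) (cell_space v (l1, l2))) \<phi>"
proof -
  have \<sigma>0: "\<sigma> \<noteq> 0" using \<sigma> by auto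
  have edot: "flinear (edot v i)" for i unfolding edot_def by (rule flinear_lin)
  have E': "flinear (\<lambda>x. scale \<sigma> (edot v i x))" for i
    by (rule flinearI) (simp_all add: flinear_add[OF edot] flinear_scale[OF edot]
        free.scale_right_distrib mult.commute)
  have image: "link_map \<sigma> v n d ` link_span n (\<lambda>k. k \<le> d) = cell_space v (l1, l2)"
    unfolding cell_space_eq[OF v fact l] d_def by (rule link_map_image[OF \<sigma>0])
  have "\<exists>\<phi>. (\<forall>x\<in>link_span n (\<lambda>k. k \<le> d).
        \<phi> (link_span n (\<lambda>k. k < d) +>\<^bsub>link_module_le n \<epsilon> d\<^esub> x) = link_map \<sigma> v n d x)
    \<and> left_module_iso (TL n \<epsilon>) (link_module n \<epsilon> d)
        (tl_module (\<lambda>i x. scale \<sigma> (edot v i x)) (cell_space v (l1, l2))) \<phi>"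
    unfolding link_module_le_def link_module_def
    by (rule quotient_tl_module_iso[OF tl_operators_link_span E' flinear_link_map _ image
          link_map_kernel[OF \<sigma>0]])
      (unfold \<epsilon>_def, rule link_map_equivariant[OF _ v \<sigma>])
  then obtain \<phi> where \<phi>: "\<And>x. x \<in> link_span n (\<lambda>k. k \<le> d) \<Longrightarrow>
        \<phi> (link_span n (\<lambda>k. k < d) +>\<^bsub>link_module_le n \<epsilon> d\<^esub> x) = link_map \<sigma> v n d x"
      and iso: "left_module_iso (TL n \<epsilon>) (link_module n \<epsilon> d)
        (tl_module (\<lambda>i x. scale \<sigma> (edot v i x)) (cell_space v (l1, l2))) \<phi>"
    by blast
  have "\<phi> (link_class n \<epsilon> d (links_of p)) = scale (link_sign \<sigma> n p) (eta v (seq_of n p))"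
    if "matching n p" "num_defects n p = d" for p
    unfolding link_class_def using that eta_coeff[OF v that(1)]
    by (subst \<phi>) (auto simp: link_span_eq link_map_single)
  then show ?thesis using iso by blast
qed

theorem theorem6p2:
  fixes v :: "'a::field" and n l1 l2 :: nat
  assumes "v \<noteq> 0" and "n \<ge> 1" and "qfact v n \<noteq> 0"
    and "l2 \<le> l1" and "l1 + l2 = n"
  shows "let \<delta> = v + inverse v; d = l1 - l2 in
     (\<exists>\<phi>. (\<forall>l\<in>link_diagrams n. card (defects n l) = d \<longrightarrow>
              \<phi> (link_class n (- \<delta>) d l) = eta v (link_seq n l))
          \<and> left_module_iso (TL n (- \<delta>)) (link_module n (- \<delta>) d) (cell_module v (l1, l2)) \<phi>)
   \<and> (\<exists>\<psi>. left_module_iso (TL n \<delta>) (link_module n \<delta> d) (cell_module_neg v (l1, l2)) \<psi>)"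
proof -
  let ?d = "l1 - l2" and ?\<delta> = "v + inverse v"
  have one: "link_sign 1 n p = 1" for p
    unfolding link_sign_def by (rule prod.neutral) simp
  have neg: "scale (- 1) x = - x" for x :: "int list \<Rightarrow>\<^sub>0 'a"
    by (rule poly_mapping_eqI) simp
  obtain \<phi> where \<phi>: "\<And>p. matching n p \<Longrightarrow> num_defects n p = ?d \<Longrightarrow>
        \<phi> (link_class n (- ?\<delta>) ?d (links_of p)) = eta v (seq_of n p)"
      "left_module_iso (TL n (- ?\<delta>)) (link_module n (- ?\<delta>) ?d) (cell_module v (l1, l2)) \<phi>"
    using link_module_iso_signed[OF assms(1,3,4,5), of 1]
    by (auto simp: one cell_module_def)
  have "\<phi> (link_class n (- ?\<delta>) ?d l) = eta v (link_seq n l)"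
    if "l \<in> link_diagrams n" "card (defects n l) = ?d" for l
    using that \<phi>(1) by (auto simp: link_diagrams_eq card_defects_links_of link_seq_eq)
  moreover obtain \<psi> where "left_module_iso (TL n ?\<delta>) (link_module n ?\<delta> ?d) (cell_module_neg v (l1, l2)) \<psi>"
    using link_module_iso_signed[OF assms(1,3,4,5), of "- 1"]
    by (auto simp: neg cell_module_neg_def)
  ultimately show ?thesis using \<phi>(2) unfolding Let_def by blast
qed

end
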